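(* There exists a numerical constant $c>0$ such that, for all integers $p\ge q\ge 1$ and any real $p\times q$ matrix $\mathbf A$, with $\mathbf Y=\mathbf A+\mathbf E$, $$\mathbb E\big[\,|\sigma_1^2(\mathbf Y)-p-\sigma_1^2(\mathbf A)|\,\big]\le 3\sqrt{pq}+4\|\mathbf A\|_\infty\sqrt q+8e^{-p/4}+\sqrt{64\pi p},$$ $$\mathbb E\big[\,|(\sigma_1^2(\mathbf Y)-p)_+^{1/2}-\|\mathbf A\|_\infty|\,\big]\le c\,(pq)^{1/4}.$$
   Context: $\mathbf A$ is a deterministic real $p\times q$ matrix and $\mathbf E$ is a $p\times q$ random matrix with independent standard normal entries; $\mathbf Y=\mathbf A+\mathbf E$. $\sigma_1(\mathbf B)$ is the largest singular value of $\mathbf B$, and $\|\mathbf B\|_\infty=\sigma_1(\mathbf B)$ is the operator norm. $x_+=\max(x,0)$. *)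

theory Defs
  imports "HOL-Probability.Probability" "Jordan_Normal_Form.Char_Poly"
begin

text \<open>
  Dimensions range over natural numbers inside the formal statement, so matrices are
  those of \<^theory>\<open>Jordan_Normal_Form.Matrix\<close>, with carrier \<^term>\<open>carrier_mat p q\<close>.
\<close>

definition singular_values :: "real mat \<Rightarrow> real set" where
  "singular_values B = sqrt ` {k. eigenvalue (transpose_mat B * B) k}"

definition sigma1 :: "real mat \<Rightarrow> real" where
  "sigma1 B = Max (singular_values B)"

definition op_norm :: "real mat \<Rightarrow> real" where
  "op_norm B = (SUP v\<in>{v \<in> carrier_vec (dim_col B). v \<bullet> v \<le> 1}. sqrt ((B *\<^sub>v v) \<bullet> (B *\<^sub>v v)))"

text \<open>
  The random matrix is realised on its canonical sample space: a sample point is a family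
  of entries \<open>\<omega> :: nat \<times> nat \<Rightarrow> real\<close> indexed by \<open>{..<p} \<times> {..<q}\<close>, and the matrix itself is
  \<open>mat p q \<omega>\<close>. A fixed sample space makes the constant in the statement independent of the
  probability space (an arbitrary one would bring in a type variable on which the constant
  could formally depend). The two lemmas below show that the entries are
  independent standard normal variables, and that any matrix of independent standard normal
  variables on any probability space has this same joint law.
\<close>

definition std_gaussian :: "nat \<Rightarrow> nat \<Rightarrow> (nat \<times> nat \<Rightarrow> real) measure" where
  "std_gaussian p q = Pi\<^sub>M ({..<p} \<times> {..<q}) (\<lambda>_. density lborel std_normal_density)"

lemma std_gaussian_entries:
  assumes "1 \<le> p" "1 \<le> q"
  shows "prob_space (std_gaussian p q)"
    and "prob_space.indep_vars (std_gaussian p q) (\<lambda>_. borel) (\<lambda>ij \<omega>. \<omega> ij) ({..<p} \<times> {..<q})"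
    and "\<And>ij. ij \<in> {..<p} \<times> {..<q} \<Longrightarrow>
      distributed (std_gaussian p q) lborel (\<lambda>\<omega>. \<omega> ij) std_normal_density"
proof -
  let ?I = "{..<p} \<times> {..<q}" and ?N = "density lborel std_normal_density"
  let ?X = "\<lambda>ij (\<omega> :: nat \<times> nat \<Rightarrow> real). \<omega> ij"
  have I: "?I \<noteq> {}" using assms by (auto simp: lessThan_empty_iff)
  have N: "prob_space ?N" by (rule prob_space_normal_density) simp
  show P: "prob_space (std_gaussian p q)"
    unfolding std_gaussian_def by (rule prob_space_PiM) (rule N)
  interpret prob_space "std_gaussian p q" by (rule P)
  have meas: "?X ij \<in> measurable (std_gaussian p q) borel" if "ij \<in> ?I" for ij
    using measurable_component_singleton[OF that, of "\<lambda>_. ?N"]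
    by (simp add: std_gaussian_def cong: measurable_cong_sets)
  have comp: "distr (std_gaussian p q) ?N (?X ij) = ?N" if "ij \<in> ?I" for ij
    unfolding std_gaussian_def using N that by (intro distr_PiM_component) auto
  have comp': "distr (std_gaussian p q) B (?X ij) = ?N" if "ij \<in> ?I" "sets B = sets borel" for ij B
    using comp[OF that(1)] that(2) distr_cong[of "std_gaussian p q" "std_gaussian p q" B ?N "?X ij" "?X ij"]
    by simp
  show "distributed (std_gaussian p q) lborel (?X ij) std_normal_density" if "ij \<in> ?I" for ij
    using meas[OF that] comp'[OF that, of lborel] by (simp add: distributed_def)
  have "distr (std_gaussian p q) (Pi\<^sub>M ?I (\<lambda>_. borel)) (\<lambda>\<omega>. \<lambda>ij\<in>?I. ?X ij \<omega>)
      = distr (std_gaussian p q) (std_gaussian p q) (\<lambda>\<omega>. \<omega>)"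
  proof (rule distr_cong)
    show "sets (Pi\<^sub>M ?I (\<lambda>_. borel)) = sets (std_gaussian p q)"
      unfolding std_gaussian_def by (rule sets_PiM_cong) simp_all
    show "(\<lambda>ij\<in>?I. ?X ij \<omega>) = \<omega>" if "\<omega> \<in> space (std_gaussian p q)" for \<omega>
      using that unfolding std_gaussian_def space_PiM by (simp add: PiE_restrict restrict_def[symmetric])
  qed simp
  also have "\<dots> = std_gaussian p q" by (simp add: distr_id)
  also have "\<dots> = Pi\<^sub>M ?I (\<lambda>ij. distr (std_gaussian p q) borel (?X ij))"
    using comp' by (subst std_gaussian_def) (intro PiM_cong, auto)
  finally show "indep_vars (\<lambda>_. borel) ?X ?I"
    using indep_vars_iff_distr_eq_PiM'[OF I, where M' = "\<lambda>_. borel" and X = "?X"] meas by blast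
qed

lemma std_gaussian_law:
  fixes E :: "nat \<times> nat \<Rightarrow> 'w \<Rightarrow> real"
  assumes "1 \<le> p" "1 \<le> q" and M: "prob_space M"
    and indep: "prob_space.indep_vars M (\<lambda>_. borel) E ({..<p} \<times> {..<q})"
    and normal: "\<And>ij. ij \<in> {..<p} \<times> {..<q} \<Longrightarrow> distributed M lborel (E ij) std_normal_density"
  shows "distr M (Pi\<^sub>M ({..<p} \<times> {..<q}) (\<lambda>_. borel)) (\<lambda>w. \<lambda>ij\<in>{..<p} \<times> {..<q}. E ij w)
    = std_gaussian p q"
proof -
  let ?I = "{..<p} \<times> {..<q}"
  interpret prob_space M by (rule M)
  have I: "?I \<noteq> {}" using assms(1,2) by (auto simp: lessThan_empty_iff)
  have meas: "E ij \<in> measurable M borel" if "ij \<in> ?I" for ij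
    using normal[OF that] by (simp add: distributed_def)
  have "distr M borel (E ij) = density lborel std_normal_density" if "ij \<in> ?I" for ij
    using normal[OF that] distr_cong[of M M borel lborel "E ij" "E ij"]
    by (simp add: distributed_def)
  then have "Pi\<^sub>M ?I (\<lambda>ij. distr M borel (E ij)) = std_gaussian p q"
    unfolding std_gaussian_def by (intro PiM_cong) auto
  then show ?thesis
    using indep_vars_iff_distr_eq_PiM'[OF I, where M' = "\<lambda>_. borel" and X = E] meas indep by auto
qed

end

theory Submission
  imports Defs
begin

text \<open>
  Write \<open>s = sigma1 A\<close>, and let \<open>X = sigma1 (A + E)^2 - p - s^2\<close>. For a unit vector \<open>v\<close>,
  \<open>|(A + E) v|^2 = |A v|^2 + 2 <A v, E v> + |E v|^2\<close>. Maximising over \<open>v\<close> bounds \<open>X\<close> from above by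
  \<open>2 sigma1 (A^T E) + sigma1 E^2 - p\<close>, because \<open><A v, E v> = <v, A^T E v>\<close>. Inserting a top right
  singular vector \<open>v0\<close> of \<open>A\<close> bounds \<open>X\<close> from below by \<open>- 2 sigma1 (A^T E) + |E v0|^2 - p\<close>, where
  \<open>|E v0|^2\<close> has the chi-square law with \<open>p\<close> degrees of freedom and so deviates from \<open>p\<close> by at most
  \<open>sqrt (2 p)\<close> in mean (\<open>gauss_chi_square_deviation\<close>). What is left are two second moments: the mean
  of \<open>sigma1 (E)^2\<close> is at most \<open>(sqrt p + sqrt q)^2\<close>, which exceeds \<open>p\<close> by at most \<open>3 sqrt (p q)\<close>,
  and the mean of \<open>sigma1 (A^T E)^2\<close> is at most \<open>(2 s sqrt q)^2\<close>. For \<open>p = q\<close> the first one leaves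
  room for an error of order \<open>sqrt p\<close> only, so a bound on the norm of a Gaussian matrix that loses a
  constant factor, or even a logarithm, would not do.

  Both moments are cases (\<open>B = 1\<close> and \<open>B = A\<close>) of Chevet's inequality, which bounds the mean of
  \<open>sigma1 (B^T E)^2\<close> by \<open>(|B|_F + |B| sqrt q)^2\<close> (\<open>chevet_second_moment\<close>). It is obtained by comparing the
  Gaussian process \<open><x, E v>\<close>, with \<open>x = B w\<close> and \<open>w\<close>, \<open>v\<close> unit vectors, with
  \<open><g, x> + |B| <h, v>\<close> for independent standard Gaussian vectors \<open>g\<close>, \<open>h\<close>. The difference of the
  covariances is \<open>(|B|^2 - <x, x'>) (1 - <v, v'>) - |B|^2\<close>: entrywise nonnegative and zero on the
  diagonal, up to subtracting a constant. Comparisons of Slepian type are made for this sign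
  pattern, and \<open>softmax_square_comparison\<close> proves one for the square of the soft maximum
  \<open>L s = ln (e + sum_k exp (s k))\<close>. Rescaling turns the soft maximum into the maximum over a finite
  set, and finite nets of the sphere turn that into the supremum over all unit vectors.

  The comparison itself is a Lindeberg exchange. Cut both Gaussian vectors into \<open>N\<close> independent
  pieces of size \<open>1 / sqrt N\<close> and replace the pieces of the first by those of the second one at a
  time. By Taylor's formula, one replacement changes the expectation of \<open>L^2\<close> by the difference of
  two second order terms, which has the right sign at every point (\<open>field_drift_le\<close>), plus an error
  of order \<open>N powr (-3/2)\<close>; the \<open>N\<close> errors together vanish in the limit. The pieces reassemble to
  the full vectors by the stability of the Gaussian law (\<open>gauss_rotate\<close>).

  For the second estimate let \<open>R\<close> be the square root of the positive part of \<open>sigma1 (A + E)^2 - p\<close>.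
  Then \<open>|R - s|^2 \<le> |X|\<close> and \<open>s |R - s| \<le> |X|\<close>. The bound \<open>3 sqrt (p q) + 4 s sqrt q + sqrt (8 p)\<close>
  obtained for the mean of \<open>|X|\<close> is at most \<open>6 g^2 + 4 s g\<close> for \<open>g = (p q) powr (1/4)\<close>, and the claim
  follows from the first inequality if \<open>s \<le> g\<close> and from the second one if \<open>s > g\<close>.
\<close>

section \<open>Soft maximum\<close>

text \<open>
  The summand \<open>exp 1\<close> acts as one more index at which the field has the constant value \<open>1\<close>. It
  makes the soft maximum at least \<open>1\<close> and the Gibbs weights of the remaining indices sum to at most
  \<open>1\<close>; both facts decide signs in \<open>field_drift_le\<close>.
\<close>

definition softmax :: "'k set \<Rightarrow> ('k \<Rightarrow> real) \<Rightarrow> real" where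
  "softmax T s = ln (exp 1 + (\<Sum>k\<in>T. exp (s k)))"

text \<open>
  The moments of \<open>x\<close> under the Gibbs distribution with weights proportional to \<open>exp (s k)\<close>, where the
  extra index of \<^const>\<open>softmax\<close> carries the value \<open>0\<close>. The first moment is the derivative of the
  soft maximum in direction \<open>x\<close>; the cumulants give the higher derivatives.
\<close>

definition gibbs_moment :: "'k set \<Rightarrow> ('k \<Rightarrow> real) \<Rightarrow> nat \<Rightarrow> ('k \<Rightarrow> real) \<Rightarrow> real" where
  "gibbs_moment T s n x = (\<Sum>k\<in>T. exp (s k) * x k ^ n) / (exp 1 + (\<Sum>k\<in>T. exp (s k)))"

lemma partition_pos: "exp 1 + (\<Sum>k\<in>T. exp (s k :: real)) > 0"
  by (intro add_pos_nonneg sum_nonneg) auto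

lemma softmax_ge_1: "softmax T s \<ge> 1"
proof -
  have "ln (exp 1) \<le> softmax T s"
    unfolding softmax_def by (subst ln_le_cancel_iff) (auto intro: partition_pos sum_nonneg)
  then show ?thesis by simp
qed

lemma softmax_ge:
  assumes "finite T" "k \<in> T"
  shows "softmax T s \<ge> s k"
proof -
  have "exp (s k) \<le> (\<Sum>k\<in>T. exp (s k))"
    using assms by (intro member_le_sum) auto
  then have "ln (exp (s k)) \<le> softmax T s"
    unfolding softmax_def by (subst ln_le_cancel_iff) (auto intro: partition_pos add_increasing)
  then show ?thesis by simp
qed

lemma softmax_le:
  assumes "finite T" and "m \<ge> 0" and "\<And>k. k \<in> T \<Longrightarrow> s k \<le> m"
  shows "softmax T s \<le> m + ln (exp 1 + card T)"
proof -
  have "exp 1 + (\<Sum>k\<in>T. exp (s k)) \<le> exp 1 * exp m + (\<Sum>k\<in>T. exp m)"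
    using assms by (intro add_mono sum_mono) auto
  also have "\<dots> = exp m * (exp 1 + card T)" by (simp add: algebra_simps)
  finally have "softmax T s \<le> ln (exp m * (exp 1 + card T))"
    unfolding softmax_def by (subst ln_le_cancel_iff) (auto intro!: partition_pos mult_pos_pos add_pos_nonneg)
  also have "\<dots> = m + ln (exp 1 + card T)"
    by (subst ln_mult) (auto intro: add_pos_nonneg simp: add_pos_nonneg less_imp_neq[THEN not_sym])
  finally show ?thesis .
qed

lemma softmax_perturb:
  assumes "finite T" and "\<And>k. k \<in> T \<Longrightarrow> \<bar>x k\<bar> \<le> M" and "M \<ge> 0"
  shows "softmax T (\<lambda>k. s k + x k) \<le> softmax T s + M"
proof -
  have "exp 1 + (\<Sum>k\<in>T. exp (s k + x k)) \<le> exp 1 * exp M + (\<Sum>k\<in>T. exp (s k) * exp M)"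
    using assms by (intro add_mono sum_mono) (auto simp: exp_add[symmetric] abs_le_iff)
  also have "\<dots> = exp M * (exp 1 + (\<Sum>k\<in>T. exp (s k)))"
    by (simp add: algebra_simps sum_distrib_left)
  finally have "softmax T (\<lambda>k. s k + x k) \<le> ln (exp M * (exp 1 + (\<Sum>k\<in>T. exp (s k))))"
    unfolding softmax_def
    by (subst ln_le_cancel_iff) (auto intro!: partition_pos mult_pos_pos)
  also have "\<dots> = M + softmax T s"
    unfolding softmax_def using partition_pos[of s T] by (subst ln_mult) auto
  finally show ?thesis by simp
qed

lemma gibbs_moment_abs_le:
  assumes "\<And>k. k \<in> T \<Longrightarrow> \<bar>x k\<bar> \<le> M" and "M \<ge> 0"
  shows "\<bar>gibbs_moment T s n x\<bar> \<le> M ^ n"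
proof -
  have "\<bar>\<Sum>k\<in>T. exp (s k) * x k ^ n\<bar> \<le> (\<Sum>k\<in>T. exp (s k) * M ^ n)"
    by (rule order_trans[OF sum_abs])
      (auto simp: abs_mult power_abs intro!: sum_mono power_mono assms)
  also have "\<dots> \<le> (exp 1 + (\<Sum>k\<in>T. exp (s k))) * M ^ n"
    using assms by (simp add: algebra_simps sum_distrib_left)
  finally show ?thesis
    unfolding gibbs_moment_def using partition_pos[of s T]
    by (simp add: divide_le_eq mult.commute)
qed

lemma softmax_has_derivative:
  "((\<lambda>t. softmax T (\<lambda>k. s k + t * x k)) has_real_derivative
     gibbs_moment T (\<lambda>k. s k + t * x k) 1 x) (at t)"
  unfolding softmax_def gibbs_moment_def
  by (rule derivative_eq_intros refl partition_pos | simp)+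

lemma gibbs_moment_has_derivative:
  fixes s x :: "'k \<Rightarrow> real" and t :: real and T :: "'k set"
  defines "m \<equiv> \<lambda>n t. gibbs_moment T (\<lambda>k. s k + t * x k) n x"
  shows "((\<lambda>t. gibbs_moment T (\<lambda>k. s k + t * x k) n x) has_real_derivative
     m (Suc n) t - m 1 t * m n t) (at t)"
proof -
  define Z where "Z = exp 1 + (\<Sum>k\<in>T. exp (s k + t * x k))"
  have Z: "Z > 0" unfolding Z_def by (rule partition_pos)
  have "((\<lambda>t. gibbs_moment T (\<lambda>k. s k + t * x k) n x) has_real_derivative
     ((\<Sum>k\<in>T. exp (s k + t * x k) * x k * x k ^ n) * Z
       - (\<Sum>k\<in>T. exp (s k + t * x k) * x k ^ n) * (\<Sum>k\<in>T. exp (s k + t * x k) * x k)) / (Z * Z)) (at t)"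
    unfolding gibbs_moment_def Z_def
    by (rule derivative_eq_intros refl less_imp_neq[THEN not_sym] partition_pos | simp)+
  moreover have "((\<Sum>k\<in>T. exp (s k + t * x k) * x k * x k ^ n) * Z
       - (\<Sum>k\<in>T. exp (s k + t * x k) * x k ^ n) * (\<Sum>k\<in>T. exp (s k + t * x k) * x k)) / (Z * Z)
     = m (Suc n) t - m 1 t * m n t"
    unfolding m_def gibbs_moment_def Z_def[symmetric] using Z by (simp add: field_simps)
  ultimately show ?thesis by simp
qed

text \<open>
  Second order Taylor expansion along the segment from \<open>s\<close> to \<open>s + x\<close>. The derivatives of the soft
  maximum are the cumulants of \<open>x\<close> under the Gibbs distribution, which are bounded by powers of \<open>M\<close>
  whatever the number of indices; only the factor \<open>softmax T s\<close> of the square itself is left in the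
  remainder.
\<close>

lemma softmax_square_taylor:
  fixes s x :: "'k \<Rightarrow> real"
  assumes T: "finite T" and x: "\<And>k. k \<in> T \<Longrightarrow> \<bar>x k\<bar> \<le> M" and M: "M \<ge> 0"
  defines "L \<equiv> softmax T s" and "m \<equiv> \<lambda>n. gibbs_moment T s n x"
  shows "\<bar>(softmax T (\<lambda>k. s k + x k))\<^sup>2
      - (L\<^sup>2 + 2 * L * m 1 + ((1 - L) * (m 1)\<^sup>2 + L * m 2))\<bar> \<le> 4 * (L + M) * M ^ 3"
proof -
  define l where "l = (\<lambda>t. softmax T (\<lambda>k. s k + t * x k))"
  define g where "g = (\<lambda>n t. gibbs_moment T (\<lambda>k. s k + t * x k) n x)"
  have l': "(l has_real_derivative g 1 t) (at t)" for t
    unfolding l_def g_def by (rule softmax_has_derivative)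
  have g': "(g n has_real_derivative g (Suc n) t - g 1 t * g n t) (at t)" for n t
    unfolding g_def by (rule gibbs_moment_has_derivative)
  \<comment> \<open>The first three derivatives of the square of \<open>l\<close>, by \<open>g' n = g (n + 1) - g 1 * g n\<close>.\<close>
  define F where "F = (\<lambda>(n::nat) t.
      if n = 0 then (l t)\<^sup>2
      else if n = 1 then 2 * l t * g 1 t
      else if n = 2 then 2 * ((1 - l t) * (g 1 t)\<^sup>2 + l t * g 2 t)
      else 6 * g 1 t * (g 2 t - (g 1 t)\<^sup>2)
        + 2 * l t * (g 3 t - 3 * g 1 t * g 2 t + 2 * (g 1 t) ^ 3))"
  have F': "(F n has_real_derivative F (Suc n) t) (at t)" if "n < 3" for n t
  proof -
    have "n = 0 \<or> n = 1 \<or> n = 2" using that by linarith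
    then consider "n = 0" | "n = 1" | "n = 2" by blast
    then show ?thesis
    proof cases
      case 1
      show ?thesis unfolding 1 F_def
        by (simp, (rule derivative_eq_intros l' refl | simp)+)
    next
      case 2
      have "((\<lambda>t. 2 * l t * g 1 t) has_real_derivative
          2 * g 1 t * g 1 t + 2 * l t * (g 2 t - g 1 t * g 1 t)) (at t)"
        by (rule derivative_eq_intros l' g'[of 1, unfolded One_nat_def[symmetric]] refl | simp add: numeral_2_eq_2)+
      then show ?thesis unfolding 2 F_def
        by (simp add: algebra_simps power2_eq_square numeral_2_eq_2)
    next
      case 3
      have g2': "(g 2 has_real_derivative g 3 t - g 1 t * g 2 t) (at t)"
        using g'[of 2 t] by simp
      have g1': "(g 1 has_real_derivative g 2 t - g 1 t * g 1 t) (at t)"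
        using g'[of 1 t] by (simp add: numeral_2_eq_2)
      have "((\<lambda>t. 2 * ((1 - l t) * (g 1 t)\<^sup>2 + l t * g 2 t)) has_real_derivative
          2 * ((0 - g 1 t) * (g 1 t)\<^sup>2 + (2 * g 1 t * (g 2 t - g 1 t * g 1 t)) * (1 - l t)
            + (g 1 t * g 2 t + (g 3 t - g 1 t * g 2 t) * l t))) (at t)"
        by (rule derivative_eq_intros l' g1' g2' refl | simp)+
      then show ?thesis unfolding 3 F_def
        by (simp add: algebra_simps power2_eq_square power3_eq_cube)
    qed
  qed
  obtain t where t: "0 < t" "t < 1"
    and eq: "F 0 1 = (\<Sum>i<3. F i 0 / fact i * 1 ^ i) + F 3 t / fact 3 * 1 ^ 3"
    using Maclaurin[of 1 3 F "F 0"] F' by auto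
  have gb: "\<bar>g n t\<bar> \<le> M ^ n" for n
    unfolding g_def by (rule gibbs_moment_abs_le) (use x M in auto)
  have lt: "l t \<le> L + M"
    unfolding l_def L_def
  proof (rule softmax_perturb[OF T _ M])
    fix k assume "k \<in> T"
    then have "\<bar>x k\<bar> \<le> M" by (rule x)
    moreover have "\<bar>t * x k\<bar> \<le> 1 * \<bar>x k\<bar>"
      unfolding abs_mult by (rule mult_right_mono) (use t in auto)
    ultimately show "\<bar>t * x k\<bar> \<le> M" by simp
  qed
  have l1: "l t \<ge> 1" unfolding l_def by (rule softmax_ge_1)
  have b1: "\<bar>g 1 t\<bar> \<le> M" using gb[of 1] by simp
  have b2: "\<bar>g 2 t\<bar> \<le> M\<^sup>2" using gb[of 2] by simp
  have b3: "\<bar>g 3 t\<bar> \<le> M ^ 3" using gb[of 3] by simp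
  have sq: "(g 1 t)\<^sup>2 \<le> M\<^sup>2" using b1 M by (simp add: abs_le_square_iff[symmetric])
  have c1: "\<bar>g 1 t * (g 2 t - (g 1 t)\<^sup>2)\<bar> \<le> 2 * M ^ 3"
  proof -
    have "\<bar>g 2 t - (g 1 t)\<^sup>2\<bar> \<le> 2 * M\<^sup>2"
      using b2 sq zero_le_power2[of "g 1 t"] by linarith
    then have "\<bar>g 1 t\<bar> * \<bar>g 2 t - (g 1 t)\<^sup>2\<bar> \<le> M * (2 * M\<^sup>2)"
      using b1 M by (intro mult_mono) auto
    then show ?thesis by (simp add: abs_mult power2_eq_square power3_eq_cube)
  qed
  have c2: "\<bar>g 1 t * g 2 t\<bar> \<le> M ^ 3"
    using mult_mono[OF b1 b2 M] by (simp add: abs_mult power2_eq_square power3_eq_cube)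
  have c3: "\<bar>(g 1 t) ^ 3\<bar> \<le> M ^ 3"
    using power_mono[OF b1, of 3] by (simp add: power_abs)
  have c4: "\<bar>g 3 t - 3 * g 1 t * g 2 t + 2 * (g 1 t) ^ 3\<bar> \<le> 6 * M ^ 3"
    using b3 c2 c3 by linarith
  have c5: "\<bar>l t * (g 3 t - 3 * g 1 t * g 2 t + 2 * (g 1 t) ^ 3)\<bar> \<le> l t * (6 * M ^ 3)"
    unfolding abs_mult using c4 l1 by (intro mult_mono) auto
  have M3: "M ^ 3 \<ge> 0" using M by simp
  have "\<bar>F 3 t\<bar> \<le> 12 * M ^ 3 + 12 * l t * M ^ 3"
    using c1 c5 unfolding F_def by (simp add: algebra_simps abs_le_iff)
  also have "\<dots> \<le> 24 * ((L + M) * M ^ 3)"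
    using mult_right_mono[OF l1 M3] mult_right_mono[OF lt M3] by (simp add: algebra_simps)
  finally have "\<bar>F 3 t / 6\<bar> \<le> 4 * (L + M) * M ^ 3" by (simp add: algebra_simps)
  moreover have "F 0 1 = F 0 0 + F 1 0 + F 2 0 / 2 + F 3 t / 6"
    using eq by (simp add: fact_numeral eval_nat_numeral lessThan_Suc)
  moreover have "F 0 1 = (softmax T (\<lambda>k. s k + x k))\<^sup>2"
    unfolding F_def l_def by simp
  moreover have "F 0 0 = L\<^sup>2" "F 1 0 = 2 * L * m 1" "F 2 0 / 2 = (1 - L) * (m 1)\<^sup>2 + L * m 2"
    unfolding F_def l_def g_def L_def m_def by auto
  ultimately show ?thesis by linarith
qed

section \<open>Standard Gaussian product measures\<close>

abbreviation std_normal :: "real measure" where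
  "std_normal \<equiv> density lborel std_normal_density"

definition gauss :: "'i set \<Rightarrow> ('i \<Rightarrow> real) measure" where
  "gauss I = Pi\<^sub>M I (\<lambda>_. std_normal)"

lemma std_gaussian_eq_gauss: "std_gaussian p q = gauss ({..<p} \<times> {..<q})"
  by (simp add: std_gaussian_def gauss_def)

lemma prob_space_std_normal: "prob_space std_normal"
  by (rule prob_space_normal_density) simp

lemma product_prob_space_std_normal: "product_prob_space (\<lambda>_. std_normal)"
proof -
  interpret prob_space std_normal by (rule prob_space_std_normal)
  show ?thesis by unfold_locales
qed

lemma prob_space_gauss: "prob_space (gauss I)"
  unfolding gauss_def by (intro prob_space_PiM prob_space_std_normal)

lemma measurable_gauss_component_std_normal:
  "i \<in> I \<Longrightarrow> (\<lambda>\<omega>. \<omega> i) \<in> measurable (gauss I) std_normal"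
  unfolding gauss_def by (rule measurable_component_singleton)

lemma sets_gauss [measurable_cong]: "sets (gauss I) = sets (Pi\<^sub>M I (\<lambda>_. borel))"
  unfolding gauss_def by (intro sets_PiM_cong) auto

lemma measurable_gauss_component:
  "i \<in> I \<Longrightarrow> (\<lambda>\<omega>. \<omega> i) \<in> borel_measurable (gauss I)"
  using measurable_gauss_component_std_normal[of i I] by simp

lemma measurable_into_gauss:
  assumes "\<And>i. i \<in> I \<Longrightarrow> f i \<in> borel_measurable M"
  shows "(\<lambda>x. \<lambda>i\<in>I. f i x) \<in> measurable M (gauss I)"
  unfolding gauss_def
  by (rule measurable_restrict) (use assms in \<open>simp cong: measurable_cong_sets\<close>)

lemma distr_gauss_component:
  assumes "i \<in> I"
  shows "distr (gauss I) std_normal (\<lambda>\<omega>. \<omega> i) = std_normal"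
  unfolding gauss_def by (intro distr_PiM_component prob_space_std_normal assms)

lemma integrable_std_normal_power: "integrable std_normal (\<lambda>x. \<bar>x\<bar> ^ n)"
  by (subst integrable_density) (auto intro: integrable_std_normal_moment_abs)

lemma gauss_component_integrable:
  assumes "i \<in> I"
  shows "integrable (gauss I) (\<lambda>\<omega>. \<bar>\<omega> i\<bar> ^ n)"
proof -
  have "integrable (distr (gauss I) std_normal (\<lambda>\<omega>. \<omega> i)) (\<lambda>x. \<bar>x\<bar> ^ n)"
    unfolding distr_gauss_component[OF assms] by (rule integrable_std_normal_power)
  from integrable_distr[OF measurable_gauss_component_std_normal[OF assms] this] show ?thesis .
qed

lemma gauss_integral_component:
  fixes f :: "real \<Rightarrow> real"
  assumes "i \<in> I" and [measurable]: "f \<in> borel_measurable borel"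
  shows "(\<integral>\<omega>. f (\<omega> i) \<partial>gauss I) = (\<integral>x. std_normal_density x * f x \<partial>lborel)"
proof -
  have "(\<integral>\<omega>. f (\<omega> i) \<partial>gauss I) = (\<integral>x. f x \<partial>distr (gauss I) std_normal (\<lambda>\<omega>. \<omega> i))"
    by (rule integral_distr[symmetric], rule measurable_gauss_component_std_normal[OF assms(1)]) simp
  also have "\<dots> = (\<integral>x. std_normal_density x * f x \<partial>lborel)"
    unfolding distr_gauss_component[OF assms(1)] by (subst integral_density) auto
  finally show ?thesis .
qed

lemma gauss_norm1_power_integrable:
  assumes "finite I"
  shows "integrable (gauss I) (\<lambda>\<omega>. (\<Sum>i\<in>I. \<bar>\<omega> i\<bar>) ^ n)"
proof (rule Bochner_Integration.integrable_bound)
  have pw: "(\<Sum>i\<in>I. \<bar>\<omega> i\<bar>) ^ n \<le> (real (card I)) ^ n * (1 + (\<Sum>i\<in>I. \<bar>\<omega> i\<bar> ^ n))"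
    for \<omega> :: "'a \<Rightarrow> real"
  proof (cases "I = {}")
    case True then show ?thesis by (cases n) auto
  next
    case False
    define m where "m = Max ((\<lambda>i. \<bar>\<omega> i\<bar>) ` I)"
    have "m \<in> (\<lambda>i. \<bar>\<omega> i\<bar>) ` I" unfolding m_def using False assms by (intro Max_in) auto
    then obtain j where j: "j \<in> I" "m = \<bar>\<omega> j\<bar>" by auto
    have "(\<Sum>i\<in>I. \<bar>\<omega> i\<bar>) \<le> (\<Sum>i\<in>I. m)"
      unfolding m_def by (intro sum_mono Max_ge) (use assms in auto)
    then have "(\<Sum>i\<in>I. \<bar>\<omega> i\<bar>) ^ n \<le> (card I * \<bar>\<omega> j\<bar>) ^ n"
      by (intro power_mono) (auto simp: j intro: sum_nonneg)
    also have "\<dots> = card I ^ n * \<bar>\<omega> j\<bar> ^ n" by (simp add: power_mult_distrib)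
    also have "\<dots> \<le> card I ^ n * (1 + (\<Sum>i\<in>I. \<bar>\<omega> i\<bar> ^ n))"
    proof -
      have "\<bar>\<omega> j\<bar> ^ n \<le> (\<Sum>i\<in>I. \<bar>\<omega> i\<bar> ^ n)" by (rule member_le_sum) (use j assms in auto)
      then show ?thesis by (intro mult_left_mono) auto
    qed
    finally show ?thesis by simp
  qed
  show "AE \<omega> in gauss I. norm ((\<Sum>i\<in>I. \<bar>\<omega> i\<bar>) ^ n)
      \<le> norm ((real (card I)) ^ n * (1 + (\<Sum>i\<in>I. \<bar>\<omega> i\<bar> ^ n)))"
    using pw by (auto intro!: AE_I2 simp: abs_mult sum_nonneg)
  interpret prob_space "gauss I" by (rule prob_space_gauss)
  show "integrable (gauss I) (\<lambda>\<omega>. (real (card I)) ^ n * (1 + (\<Sum>i\<in>I. \<bar>\<omega> i\<bar> ^ n)))"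
    by (intro integrable_mult_right Bochner_Integration.integrable_add integrable_const
        Bochner_Integration.integrable_sum gauss_component_integrable)
  show "(\<lambda>\<omega>. (\<Sum>i\<in>I. \<bar>\<omega> i\<bar>) ^ n) \<in> borel_measurable (gauss I)" by measurable
qed

lemma gauss_integral_first:
  assumes "i \<in> I"
  shows "integrable (gauss I) (\<lambda>\<omega>. \<omega> i)" "(\<integral>\<omega>. \<omega> i \<partial>gauss I) = 0"
proof -
  show "integrable (gauss I) (\<lambda>\<omega>. \<omega> i)"
  proof (rule integrable_abs_cancel)
    show "integrable (gauss I) (\<lambda>\<omega>. \<bar>\<omega> i\<bar>)"
      using gauss_component_integrable[OF assms, of 1] by simp
    show "(\<lambda>\<omega>. \<omega> i) \<in> borel_measurable (gauss I)"
      by (rule measurable_gauss_component) (rule assms)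
  qed
  show "(\<integral>\<omega>. \<omega> i \<partial>gauss I) = 0"
  proof -
    have "(\<integral>\<omega>. \<omega> i \<partial>gauss I) = (\<integral>x. std_normal_density x * x \<partial>lborel)"
      by (rule gauss_integral_component[OF assms]) measurable
    also have "\<dots> = 0"
      using integral_std_normal_moment_odd[of 0] by (simp only: mult_zero_right add_0_left power_one_right)
    finally show ?thesis .
  qed
qed

lemma gauss_integral_second:
  assumes I: "finite I" and ij: "i \<in> I" "j \<in> I"
  shows "integrable (gauss I) (\<lambda>\<omega>. \<omega> i * \<omega> j)"
    and "(\<integral>\<omega>. \<omega> i * \<omega> j \<partial>gauss I) = (if i = j then 1 else 0)"
proof -
  show "integrable (gauss I) (\<lambda>\<omega>. \<omega> i * \<omega> j)"
  proof (rule Bochner_Integration.integrable_bound[OF gauss_norm1_power_integrable[OF I, of 2]])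
    show "AE \<omega> in gauss I. norm (\<omega> i * \<omega> j) \<le> norm ((\<Sum>i\<in>I. \<bar>\<omega> i\<bar>)\<^sup>2)"
    proof (rule AE_I2)
      fix \<omega> :: "'a \<Rightarrow> real"
      have "\<bar>\<omega> i\<bar> * \<bar>\<omega> j\<bar> \<le> (\<Sum>i\<in>I. \<bar>\<omega> i\<bar>) * (\<Sum>i\<in>I. \<bar>\<omega> i\<bar>)"
        by (intro mult_mono member_le_sum sum_nonneg) (use I ij in auto)
      then show "norm (\<omega> i * \<omega> j) \<le> norm ((\<Sum>i\<in>I. \<bar>\<omega> i\<bar>)\<^sup>2)"
        by (simp add: abs_mult power2_eq_square sum_nonneg)
    qed
  qed (intro borel_measurable_times measurable_gauss_component ij)
  show "(\<integral>\<omega>. \<omega> i * \<omega> j \<partial>gauss I) = (if i = j then 1 else 0)"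
  proof (cases "i = j")
    case True
    have "(\<integral>\<omega>. \<omega> i * \<omega> j \<partial>gauss I) = (\<integral>\<omega>. (\<omega> i)\<^sup>2 \<partial>gauss I)"
      unfolding True power2_eq_square ..
    also have "\<dots> = (\<integral>x. std_normal_density x * x\<^sup>2 \<partial>lborel)"
      by (rule gauss_integral_component[OF ij(1)]) measurable
    also have "\<dots> = fact (2 * 1) / (2 ^ 1 * fact 1)"
      using integral_std_normal_moment_even[of 1] unfolding mult_1_right .
    also have "\<dots> = 1" by (simp add: fact_numeral)
    finally show ?thesis unfolding if_P[OF True] .
  next
    case False
    define f where "f = (\<lambda>l x. if l = i \<or> l = j then x else (1::real))"
    have f: "integrable std_normal (f l)" for l
    proof -
      have id: "integrable std_normal (\<lambda>x. x)"
      proof (rule integrable_abs_cancel)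
        show "integrable std_normal (\<lambda>x. \<bar>x\<bar>)"
          using integrable_std_normal_power[of 1] unfolding power_one_right .
        show "(\<lambda>x. x) \<in> borel_measurable std_normal" by measurable
      qed
      have const: "integrable std_normal (\<lambda>x. 1::real)"
        using integrable_std_normal_power[of 0] unfolding power_0 .
      show ?thesis
      proof (cases "l = i \<or> l = j")
        case True then show ?thesis unfolding f_def if_P[OF True] using id by fast
      next
        case False then show ?thesis unfolding f_def if_not_P[OF False] using const by fast
      qed
    qed
    have prod: "(\<Prod>l\<in>I. f l (\<omega> l)) = \<omega> i * \<omega> j" for \<omega>
    proof -
      have "(\<Prod>l\<in>I. f l (\<omega> l)) = (\<Prod>l\<in>{i,j}. f l (\<omega> l))"
        by (rule prod.mono_neutral_right) (use I ij in \<open>auto simp: f_def\<close>)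
      then show ?thesis using False by (simp add: f_def)
    qed
    have "f i = (\<lambda>x. x)" unfolding f_def by auto
    then have "(\<integral>x. f i x \<partial>std_normal) = (\<integral>\<omega>. \<omega> i \<partial>gauss {i})"
      using integral_distr[OF measurable_gauss_component_std_normal[of i "{i}"], of "\<lambda>x. x"]
      unfolding distr_gauss_component[OF singletonI] by fastforce
    also have "\<dots> = 0" by (rule gauss_integral_first) simp
    finally have "(\<integral>x. f i x \<partial>std_normal) = 0" .
    moreover have "(\<integral>\<omega>. (\<Prod>l\<in>I. f l (\<omega> l)) \<partial>gauss I) = (\<Prod>l\<in>I. \<integral>x. f l x \<partial>std_normal)"
      unfolding gauss_def
      by (rule product_sigma_finite.product_integral_prod
          [OF product_prob_space.axioms(1)[OF product_prob_space_std_normal] I f])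
    ultimately have "(\<integral>\<omega>. \<omega> i * \<omega> j \<partial>gauss I) = 0"
      using ij(1) I unfolding prod by (metis prod_zero)
    then show ?thesis unfolding if_not_P[OF False] .
  qed
qed

text \<open>
  The stability of the normal law: \<open>a x + b y\<close> is standard normal when \<open>x\<close>, \<open>y\<close> are independent and
  standard normal and \<open>a^2 + b^2 = 1\<close>.
\<close>

lemma std_normal_rotate:
  assumes ab: "a \<ge> 0" "b \<ge> 0" "a\<^sup>2 + b\<^sup>2 = 1" and \<phi> [measurable]: "\<phi> \<in> borel_measurable borel"
  shows "(\<integral>\<^sup>+x. \<integral>\<^sup>+y. \<phi> (a * x + b * y) \<partial>std_normal \<partial>std_normal) = (\<integral>\<^sup>+x. \<phi> x \<partial>std_normal)"
proof -
  interpret N: prob_space std_normal by (rule prob_space_std_normal)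
  consider "a = 0" | "b = 0" | "a > 0" "b > 0" using ab by linarith
  then show ?thesis
  proof cases
    case 1
    then have "b = 1" using ab by (simp add: power2_eq_1_iff)
    then show ?thesis using 1 N.emeasure_space_1 by simp
  next
    case 2
    then have "a = 1" using ab by (simp add: power2_eq_1_iff)
    then show ?thesis using 2 N.emeasure_space_1 by simp
  next
    case 3
    let ?P = "std_normal \<Otimes>\<^sub>M std_normal"
    interpret P: pair_prob_space std_normal std_normal ..
    have fst: "distr ?P borel fst = std_normal" and snd: "distr ?P borel snd = std_normal"
    proof -
      have "distr ?P borel fst = distr ?P std_normal fst" by (rule distr_cong) auto
      also have "\<dots> = std_normal" by (rule N.distr_pair_fst)
      finally show "distr ?P borel fst = std_normal" .
      have "distr ?P borel snd = distr (distr ?P ?P (\<lambda>(x, y). (y, x))) borel snd"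
        using P.distr_pair_swap by simp
      also have "\<dots> = distr ?P borel fst"
        by (subst distr_distr) (auto simp: comp_def case_prod_beta)
      finally show "distr ?P borel snd = std_normal" using \<open>distr ?P borel fst = std_normal\<close> by simp
    qed
    have indep: "P.indep_var borel fst borel snd"
      unfolding P.indep_var_distribution_eq
    proof (intro conjI)
      have "distr ?P (borel \<Otimes>\<^sub>M borel) (\<lambda>x. (fst x, snd x)) = distr ?P ?P (\<lambda>x. x)"
        by (rule distr_cong) (auto intro!: sets_pair_measure_cong)
      then show "distr ?P borel fst \<Otimes>\<^sub>M distr ?P borel snd
          = distr ?P (borel \<Otimes>\<^sub>M borel) (\<lambda>x. (fst x, snd x))"
        unfolding fst snd by (simp add: distr_id)
    qed (auto cong: measurable_cong_sets)
    have "distributed ?P lborel fst (normal_density 0 1)" "distributed ?P lborel snd (normal_density 0 1)"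
      using fst snd by (auto simp: distributed_def distr_cong[of ?P ?P lborel borel] cong: measurable_cong_sets)
    from P.normal_density_affine[OF this(1), of a 0] P.normal_density_affine[OF this(2), of b 0]
    have "distributed ?P lborel (\<lambda>z. a * fst z) (normal_density 0 a)"
      "distributed ?P lborel (\<lambda>z. b * snd z) (normal_density 0 b)"
      using 3 by auto
    moreover have "P.indep_var borel (\<lambda>z. a * fst z) borel (\<lambda>z. b * snd z)"
      using P.indep_var_compose[OF indep, of "(*) a" borel "(*) b" borel] by (simp add: comp_def)
    ultimately have "distributed ?P lborel (\<lambda>z. a * fst z + b * snd z) (normal_density (0 + 0) (sqrt (a\<^sup>2 + b\<^sup>2)))"
      using 3 by (intro P.add_indep_normal) auto
    then have "distributed ?P lborel (\<lambda>z. a * fst z + b * snd z) std_normal_density"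
      using ab by simp
    from distributed_nn_integral[OF this, of \<phi>]
    have "(\<integral>\<^sup>+z. \<phi> (a * fst z + b * snd z) \<partial>?P) = (\<integral>\<^sup>+x. \<phi> x \<partial>std_normal)"
      by (simp add: nn_integral_density)
    moreover have "(\<integral>\<^sup>+z. \<phi> (a * fst z + b * snd z) \<partial>?P)
        = (\<integral>\<^sup>+x. \<integral>\<^sup>+y. \<phi> (a * x + b * y) \<partial>std_normal \<partial>std_normal)"
      by (subst N.nn_integral_fst[symmetric]) (auto cong: measurable_cong_sets)
    ultimately show ?thesis by simp
  qed
qed

text \<open>
  Both sides are product measures, so it suffices to compare them on boxes, where the claim splits
  into one-dimensional ones.
\<close>

lemma distr_gauss_rotate:
  assumes I: "finite I" and ab: "a \<ge> 0" "b \<ge> 0" "a\<^sup>2 + b\<^sup>2 = 1"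
  shows "distr (gauss I \<Otimes>\<^sub>M gauss I) (gauss I) (\<lambda>z. \<lambda>i\<in>I. a * fst z i + b * snd z i) = gauss I"
    (is "distr ?P _ ?f = _")
proof -
  interpret product_sigma_finite "\<lambda>_. std_normal"
    using product_prob_space_std_normal by (rule product_prob_space.axioms)
  interpret G: prob_space "gauss I" by (rule prob_space_gauss)
  have comp: "(\<lambda>z. a * fst z i + b * snd z i) \<in> borel_measurable ?P" if "i \<in> I" for i
    by (intro borel_measurable_add borel_measurable_times borel_measurable_const
        measurable_compose[OF measurable_fst measurable_gauss_component]
        measurable_compose[OF measurable_snd measurable_gauss_component] that)
  have f: "?f \<in> measurable ?P (gauss I)"
    by (rule measurable_into_gauss) (rule comp)
  have "distr ?P (gauss I) ?f = Pi\<^sub>M I (\<lambda>_. std_normal)"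
  proof (rule PiM_eqI[OF I])
    show "sets (distr ?P (gauss I) ?f) = sets (Pi\<^sub>M I (\<lambda>_. std_normal))" by (simp add: gauss_def)
    fix A assume A: "\<And>i. i \<in> I \<Longrightarrow> A i \<in> sets std_normal"
    then have A': "\<And>i. i \<in> I \<Longrightarrow> A i \<in> sets borel" by simp
    have Amem: "Pi\<^sub>E I A \<in> sets (gauss I)"
      unfolding gauss_def by (rule sets_PiM_I_finite[OF I A])
    have "emeasure (distr ?P (gauss I) ?f) (Pi\<^sub>E I A)
        = (\<integral>\<^sup>+\<omega>. indicator (Pi\<^sub>E I A) \<omega> \<partial>distr ?P (gauss I) ?f)"
      using Amem by (subst nn_integral_indicator) simp_all
    also have "\<dots> = (\<integral>\<^sup>+z. indicator (Pi\<^sub>E I A) (?f z) \<partial>?P)"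
      by (rule nn_integral_distr[OF f], simp only: measurable_distr_eq1, rule borel_measurable_indicator[OF Amem])
    also have "\<dots> = (\<integral>\<^sup>+\<omega>. \<integral>\<^sup>+\<omega>'. indicator (Pi\<^sub>E I A) (?f (\<omega>, \<omega>')) \<partial>gauss I \<partial>gauss I)"
      by (rule G.nn_integral_fst[symmetric]) (rule measurable_compose[OF f borel_measurable_indicator[OF Amem]])
    also have "\<dots> = (\<integral>\<^sup>+\<omega>. \<integral>\<^sup>+\<omega>'. (\<Prod>i\<in>I. indicator (A i) (a * \<omega> i + b * \<omega>' i)) \<partial>gauss I \<partial>gauss I)"
    proof (intro nn_integral_cong)
      fix \<omega> \<omega>' :: "'a \<Rightarrow> real"
      show "indicator (Pi\<^sub>E I A) (?f (\<omega>, \<omega>'))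
          = (\<Prod>i\<in>I. indicator (A i) (a * \<omega> i + b * \<omega>' i) :: ennreal)"
      proof (cases "\<forall>i\<in>I. a * \<omega> i + b * \<omega>' i \<in> A i")
        case True
        then show ?thesis by (auto simp: indicator_def PiE_iff)
      next
        case False
        then obtain i where i: "i \<in> I" "a * \<omega> i + b * \<omega>' i \<notin> A i" by auto
        then have "(\<Prod>i\<in>I. indicator (A i) (a * \<omega> i + b * \<omega>' i) :: ennreal) = 0"
          using I by (intro prod_zero) (auto intro!: bexI[of _ i])
        moreover have "?f (\<omega>, \<omega>') \<notin> Pi\<^sub>E I A" using i by (auto simp: PiE_iff)
        ultimately show ?thesis by simp
      qed
    qed
    also have "\<dots> = (\<integral>\<^sup>+\<omega>. (\<Prod>i\<in>I. \<integral>\<^sup>+y. indicator (A i) (a * \<omega> i + b * y) \<partial>std_normal) \<partial>gauss I)"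
      unfolding gauss_def
    proof (intro nn_integral_cong product_nn_integral_prod I)
      fix \<omega> i assume i: "i \<in> I"
      note A'[OF i, measurable]
      show "(\<lambda>y. indicator (A i) (a * \<omega> i + b * y) :: ennreal) \<in> borel_measurable std_normal"
        by measurable
    qed
    also have "\<dots> = (\<Prod>i\<in>I. \<integral>\<^sup>+x. \<integral>\<^sup>+y. indicator (A i) (a * x + b * y) \<partial>std_normal \<partial>std_normal)"
      unfolding gauss_def
    proof (intro product_nn_integral_prod I)
      fix i assume i: "i \<in> I"
      note A'[OF i, measurable]
      interpret N: prob_space std_normal by (rule prob_space_std_normal)
      show "(\<lambda>x. \<integral>\<^sup>+y. indicator (A i) (a * x + b * y) \<partial>std_normal) \<in> borel_measurable std_normal"
        by measurable
    qed
    also have "\<dots> = (\<Prod>i\<in>I. emeasure std_normal (A i))"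
    proof (intro prod.cong refl)
      fix i assume i: "i \<in> I"
      note A'[OF i, measurable]
      have "(\<integral>\<^sup>+x. \<integral>\<^sup>+y. indicator (A i) (a * x + b * y) \<partial>std_normal \<partial>std_normal)
          = (\<integral>\<^sup>+x. indicator (A i) x \<partial>std_normal)"
        by (rule std_normal_rotate[OF ab]) measurable
      then show "(\<integral>\<^sup>+x. \<integral>\<^sup>+y. indicator (A i) (a * x + b * y) \<partial>std_normal \<partial>std_normal)
          = emeasure std_normal (A i)"
        using A[OF i] by (subst (asm) nn_integral_indicator) auto
    qed
    finally show "emeasure (distr ?P (gauss I) ?f) (Pi\<^sub>E I A) = (\<Prod>i\<in>I. emeasure std_normal (A i))" .
  qed
  then show ?thesis by (simp add: gauss_def)
qed

lemma gauss_rotate: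
  assumes I: "finite I" and ab: "a \<ge> 0" "b \<ge> 0" "a\<^sup>2 + b\<^sup>2 = 1"
    and \<phi> [measurable]: "\<phi> \<in> borel_measurable (gauss I)"
  shows "(\<integral>\<^sup>+\<omega>. \<integral>\<^sup>+\<omega>'. \<phi> (\<lambda>i\<in>I. a * \<omega> i + b * \<omega>' i) \<partial>gauss I \<partial>gauss I) = (\<integral>\<^sup>+\<omega>. \<phi> \<omega> \<partial>gauss I)"
proof -
  interpret G: prob_space "gauss I" by (rule prob_space_gauss)
  let ?f = "\<lambda>z. \<lambda>i\<in>I. a * fst z i + b * snd z i"
  have f: "?f \<in> measurable (gauss I \<Otimes>\<^sub>M gauss I) (gauss I)"
    by (intro measurable_into_gauss borel_measurable_add borel_measurable_times borel_measurable_const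
        measurable_compose[OF measurable_fst measurable_gauss_component]
        measurable_compose[OF measurable_snd measurable_gauss_component])
  have "(\<integral>\<^sup>+\<omega>. \<phi> \<omega> \<partial>gauss I) = (\<integral>\<^sup>+\<omega>. \<phi> \<omega> \<partial>distr (gauss I \<Otimes>\<^sub>M gauss I) (gauss I) ?f)"
    unfolding distr_gauss_rotate[OF I ab] ..
  also have "\<dots> = (\<integral>\<^sup>+z. \<phi> (?f z) \<partial>(gauss I \<Otimes>\<^sub>M gauss I))"
    by (rule nn_integral_distr[OF f], simp only: measurable_distr_eq1, rule \<phi>)
  also have "\<dots> = (\<integral>\<^sup>+\<omega>. \<integral>\<^sup>+\<omega>'. \<phi> (?f (\<omega>, \<omega>')) \<partial>gauss I \<partial>gauss I)"
    by (rule G.nn_integral_fst[symmetric]) (rule measurable_compose[OF f \<phi>])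
  finally show ?thesis by simp
qed

section \<open>Slepian-type comparison for the squared soft maximum\<close>

text \<open>
  The Gaussian field on the index set of \<open>k\<close> whose covariance matrix is
  \<open>\<lambda>k l. \<Sum>i\<in>I. a k i * a l i\<close>.
\<close>

definition lin_field :: "'i set \<Rightarrow> ('k \<Rightarrow> 'i \<Rightarrow> real) \<Rightarrow> ('i \<Rightarrow> real) \<Rightarrow> 'k \<Rightarrow> real" where
  "lin_field I a \<omega> k = (\<Sum>i\<in>I. a k i * \<omega> i)"

lemma measurable_lin_field [measurable]: "(\<lambda>\<omega>. lin_field I a \<omega> k) \<in> borel_measurable (gauss I)"
  unfolding lin_field_def by measurable

lemma measurable_softmax [measurable (raw)]:
  assumes "\<And>k. k \<in> T \<Longrightarrow> (\<lambda>x. f x k) \<in> borel_measurable M"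
  shows "(\<lambda>x. softmax T (f x)) \<in> borel_measurable M"
proof -
  have [measurable]: "(\<lambda>x. (\<Sum>k\<in>T. exp (f x k))) \<in> borel_measurable M"
    by (intro borel_measurable_sum measurable_compose[OF assms borel_measurable_exp])
  show ?thesis unfolding softmax_def by measurable
qed

lemma lin_field_integral:
  assumes I: "finite I"
  shows "integrable (gauss I) (\<lambda>\<omega>. lin_field I a \<omega> k)"
    and "(\<integral>\<omega>. lin_field I a \<omega> k \<partial>gauss I) = 0"
    and "integrable (gauss I) (\<lambda>\<omega>. lin_field I a \<omega> k * lin_field I a \<omega> l)"
    and "(\<integral>\<omega>. lin_field I a \<omega> k * lin_field I a \<omega> l \<partial>gauss I) = (\<Sum>i\<in>I. a k i * a l i)"
proof -
  have i1: "integrable (gauss I) (\<lambda>\<omega>. a k i * \<omega> i)" if "i \<in> I" for i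
    by (intro integrable_mult_right gauss_integral_first that)
  show "integrable (gauss I) (\<lambda>\<omega>. lin_field I a \<omega> k)"
    unfolding lin_field_def by (intro Bochner_Integration.integrable_sum i1)
  have "(\<integral>\<omega>. lin_field I a \<omega> k \<partial>gauss I) = (\<Sum>i\<in>I. \<integral>\<omega>. a k i * \<omega> i \<partial>gauss I)"
    unfolding lin_field_def by (intro Bochner_Integration.integral_sum i1)
  also have "\<dots> = (\<Sum>i\<in>I. 0)"
    by (intro sum.cong refl, subst integral_mult_right_zero) (simp add: gauss_integral_first)
  finally show "(\<integral>\<omega>. lin_field I a \<omega> k \<partial>gauss I) = 0" by simp
  have eq: "lin_field I a \<omega> k * lin_field I a \<omega> l
      = (\<Sum>i\<in>I. \<Sum>j\<in>I. (a k i * a l j) * (\<omega> i * \<omega> j))" for \<omega>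
    unfolding lin_field_def sum_product by (intro sum.cong refl) simp
  have i2: "integrable (gauss I) (\<lambda>\<omega>. (a k i * a l j) * (\<omega> i * \<omega> j))" if "i \<in> I" "j \<in> I" for i j
    by (intro integrable_mult_right gauss_integral_second that I)
  show "integrable (gauss I) (\<lambda>\<omega>. lin_field I a \<omega> k * lin_field I a \<omega> l)"
    unfolding eq by (intro Bochner_Integration.integrable_sum i2)
  have "(\<integral>\<omega>. lin_field I a \<omega> k * lin_field I a \<omega> l \<partial>gauss I)
      = (\<Sum>i\<in>I. \<integral>\<omega>. (\<Sum>j\<in>I. (a k i * a l j) * (\<omega> i * \<omega> j)) \<partial>gauss I)"
    unfolding eq by (intro Bochner_Integration.integral_sum Bochner_Integration.integrable_sum i2)
  also have "\<dots> = (\<Sum>i\<in>I. \<Sum>j\<in>I. \<integral>\<omega>. (a k i * a l j) * (\<omega> i * \<omega> j) \<partial>gauss I)"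
    by (intro sum.cong refl Bochner_Integration.integral_sum i2)
  also have "\<dots> = (\<Sum>i\<in>I. \<Sum>j\<in>I. if j = i then a k i * a l j else 0)"
    by (intro sum.cong refl, subst integral_mult_right_zero) (auto simp: gauss_integral_second[OF I])
  also have "\<dots> = (\<Sum>i\<in>I. a k i * a l i)"
    using I by (intro sum.cong refl) (simp add: sum.delta)
  finally show "(\<integral>\<omega>. lin_field I a \<omega> k * lin_field I a \<omega> l \<partial>gauss I) = (\<Sum>i\<in>I. a k i * a l i)" .
qed

lemma lin_field_bound:
  assumes "finite T" "finite I" "k \<in> T"
  shows "\<bar>lin_field I a \<omega> k\<bar> \<le> (\<Sum>k\<in>T. \<Sum>i\<in>I. \<bar>a k i\<bar>) * (\<Sum>i\<in>I. \<bar>\<omega> i\<bar>)"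
proof -
  have "\<bar>lin_field I a \<omega> k\<bar> \<le> (\<Sum>i\<in>I. \<bar>a k i\<bar> * \<bar>\<omega> i\<bar>)"
    unfolding lin_field_def abs_mult[symmetric] by (rule sum_abs)
  also have "\<dots> \<le> (\<Sum>i\<in>I. (\<Sum>k\<in>T. \<Sum>i\<in>I. \<bar>a k i\<bar>) * \<bar>\<omega> i\<bar>)"
  proof (intro sum_mono mult_right_mono)
    fix i assume "i \<in> I"
    then have "\<bar>a k i\<bar> \<le> (\<Sum>i\<in>I. \<bar>a k i\<bar>)" using assms by (intro member_le_sum) auto
    also have "\<dots> \<le> (\<Sum>k\<in>T. \<Sum>i\<in>I. \<bar>a k i\<bar>)"
      using assms by (intro member_le_sum[of k T "\<lambda>k. \<Sum>i\<in>I. \<bar>a k i\<bar>"]) (auto intro: sum_nonneg)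
    finally show "\<bar>a k i\<bar> \<le> (\<Sum>k\<in>T. \<Sum>i\<in>I. \<bar>a k i\<bar>)" .
  qed auto
  finally show ?thesis by (simp add: sum_distrib_left)
qed

definition gibbs_weight :: "'k set \<Rightarrow> ('k \<Rightarrow> real) \<Rightarrow> 'k \<Rightarrow> real" where
  "gibbs_weight T s k = exp (s k) / (exp 1 + (\<Sum>k\<in>T. exp (s k)))"

lemma gibbs_moment_weight: "gibbs_moment T s n x = (\<Sum>k\<in>T. gibbs_weight T s k * x k ^ n)"
  by (simp add: gibbs_moment_def gibbs_weight_def sum_divide_distrib)

lemma gibbs_weight_nonneg: "gibbs_weight T s k \<ge> 0"
  unfolding gibbs_weight_def using partition_pos[of s T] by (intro divide_nonneg_nonneg) auto

lemma gibbs_weight_sum_le_1: "(\<Sum>k\<in>T. gibbs_weight T s k) \<le> 1"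
  unfolding gibbs_weight_def sum_divide_distrib[symmetric]
  using partition_pos[of s T] by (simp add: divide_le_eq)

text \<open>
  The second order coefficient of the expected squared soft maximum when an infinitesimal copy of the
  field is added at \<open>s\<close>: the covariance matrix contracted with half the Hessian of the squared soft
  maximum.
\<close>

definition field_drift :: "'i set \<Rightarrow> ('k \<Rightarrow> 'i \<Rightarrow> real) \<Rightarrow> 'k set \<Rightarrow> ('k \<Rightarrow> real) \<Rightarrow> real" where
  "field_drift I a T s =
    (1 - softmax T s) * (\<Sum>k\<in>T. \<Sum>l\<in>T. gibbs_weight T s k * gibbs_weight T s l * (\<Sum>i\<in>I. a k i * a l i))
    + softmax T s * (\<Sum>k\<in>T. gibbs_weight T s k * (\<Sum>i\<in>I. a k i * a k i))"

text \<open>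
  Integrating the Taylor expansion: the first order term vanishes because the field is centred. The
  constant \<open>K\<close> does not depend on \<open>s\<close> or \<open>h\<close>, so that arbitrarily many small steps can be summed.
\<close>

lemma softmax_square_expansion:
  fixes a :: "'k \<Rightarrow> 'i \<Rightarrow> real"
  assumes T: "finite T" and I: "finite I"
  obtains K where "K \<ge> 0"
    and "\<And>s h. 0 \<le> h \<Longrightarrow> h \<le> 1 \<Longrightarrow>
      integrable (gauss I) (\<lambda>\<omega>. (softmax T (\<lambda>k. s k + h * lin_field I a \<omega> k))\<^sup>2) \<and>
      \<bar>(\<integral>\<omega>. (softmax T (\<lambda>k. s k + h * lin_field I a \<omega> k))\<^sup>2 \<partial>gauss I)
        - ((softmax T s)\<^sup>2 + h\<^sup>2 * field_drift I a T s)\<bar> \<le> h ^ 3 * K * softmax T s"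
proof
  interpret G: prob_space "gauss I" by (rule prob_space_gauss)
  define c where "c = (\<Sum>k\<in>T. \<Sum>i\<in>I. \<bar>a k i\<bar>)"
  define R where "R = (\<lambda>\<omega>::'i\<Rightarrow>real. \<Sum>i\<in>I. \<bar>\<omega> i\<bar>)"
  have c0: "c \<ge> 0" unfolding c_def by (intro sum_nonneg) auto
  have R0: "R \<omega> \<ge> 0" for \<omega> unfolding R_def by (intro sum_nonneg) auto
  have Rn: "integrable (gauss I) (\<lambda>\<omega>. (c * R \<omega>) ^ n)" for n
    unfolding power_mult_distrib R_def
    by (intro integrable_mult_right gauss_norm1_power_integrable I)
  define K where "K = 4 * (\<integral>\<omega>. (c * R \<omega>) ^ 3 + (c * R \<omega>) ^ 4 \<partial>gauss I)"
  show "K \<ge> 0" unfolding K_def using c0 R0 by (intro mult_nonneg_nonneg integral_nonneg_AE) auto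
  fix s :: "'k \<Rightarrow> real" and h :: real assume h: "0 \<le> h" "h \<le> 1"
  define L where "L = softmax T s"
  define X where "X = lin_field I a"
  define w where "w = gibbs_weight T s"
  have L1: "L \<ge> 1" unfolding L_def by (rule softmax_ge_1)
  define F where "F = (\<lambda>\<omega>. (softmax T (\<lambda>k. s k + h * X \<omega> k))\<^sup>2)"
  define P where "P = (\<lambda>\<omega>. L\<^sup>2 + 2 * L * (h * (\<Sum>k\<in>T. w k * X \<omega> k))
      + ((1 - L) * (h\<^sup>2 * (\<Sum>k\<in>T. \<Sum>l\<in>T. (w k * w l) * (X \<omega> k * X \<omega> l)))
         + L * (h\<^sup>2 * (\<Sum>k\<in>T. w k * (X \<omega> k * X \<omega> k)))))"
  have taylor: "\<bar>F \<omega> - P \<omega>\<bar> \<le> h ^ 3 * L * 4 * ((c * R \<omega>) ^ 3 + (c * R \<omega>) ^ 4)" for \<omega>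
  proof -
    define M where "M = h * (c * R \<omega>)"
    have M0: "M \<ge> 0" unfolding M_def using h c0 R0 by simp
    have x: "\<bar>h * X \<omega> k\<bar> \<le> M" if "k \<in> T" for k
      using lin_field_bound[OF T I that, of a \<omega>] h
      unfolding X_def M_def abs_mult c_def R_def by (simp add: mult_left_mono)
    have m1: "gibbs_moment T s 1 (\<lambda>k. h * X \<omega> k) = h * (\<Sum>k\<in>T. w k * X \<omega> k)"
      unfolding gibbs_moment_weight w_def by (simp add: sum_distrib_left algebra_simps)
    have m1sq: "(gibbs_moment T s 1 (\<lambda>k. h * X \<omega> k))\<^sup>2
        = h\<^sup>2 * (\<Sum>k\<in>T. \<Sum>l\<in>T. (w k * w l) * (X \<omega> k * X \<omega> l))"
      unfolding m1 power_mult_distrib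
      by (simp add: power2_eq_square[of "\<Sum>k\<in>T. w k * X \<omega> k"] sum_product algebra_simps)
    have m2: "gibbs_moment T s 2 (\<lambda>k. h * X \<omega> k) = h\<^sup>2 * (\<Sum>k\<in>T. w k * (X \<omega> k * X \<omega> k))"
      unfolding gibbs_moment_weight w_def
      by (simp add: sum_distrib_left algebra_simps power2_eq_square)
    have "\<bar>F \<omega> - P \<omega>\<bar> \<le> 4 * (L + M) * M ^ 3"
      using softmax_square_taylor[where T = T and M = M and s = s and x = "\<lambda>k. h * X \<omega> k", OF T x M0]
      unfolding F_def P_def L_def m1sq unfolding m1 m2 by simp
    also have "\<dots> \<le> h ^ 3 * L * 4 * ((c * R \<omega>) ^ 3 + (c * R \<omega>) ^ 4)"
    proof -
      have "M \<le> L * (c * R \<omega>)"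
        unfolding M_def using h L1 c0 R0[of \<omega>] by (intro mult_right_mono) auto
      then have "(L + M) * M ^ 3 \<le> (L + L * (c * R \<omega>)) * M ^ 3"
        using M0 by (intro mult_right_mono) auto
      also have "\<dots> = h ^ 3 * L * ((c * R \<omega>) ^ 3 + (c * R \<omega>) ^ 4)"
        unfolding M_def by (simp add: power_mult_distrib algebra_simps eval_nat_numeral)
      finally have "4 * ((L + M) * M ^ 3) \<le> 4 * (h ^ 3 * L * ((c * R \<omega>) ^ 3 + (c * R \<omega>) ^ 4))"
        by (rule mult_left_mono) simp
      then show ?thesis by (simp only: mult_ac)
    qed
    finally show ?thesis .
  qed
  note li = lin_field_integral[OF I, of a, folded X_def]
  have iP1: "integrable (gauss I) (\<lambda>\<omega>. \<Sum>k\<in>T. w k * X \<omega> k)"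
    by (intro Bochner_Integration.integrable_sum integrable_mult_right li)
  have iP2: "integrable (gauss I) (\<lambda>\<omega>. \<Sum>k\<in>T. \<Sum>l\<in>T. (w k * w l) * (X \<omega> k * X \<omega> l))"
    by (intro Bochner_Integration.integrable_sum integrable_mult_right li)
  have iP3: "integrable (gauss I) (\<lambda>\<omega>. \<Sum>k\<in>T. w k * (X \<omega> k * X \<omega> k))"
    by (intro Bochner_Integration.integrable_sum integrable_mult_right li)
  have iP: "integrable (gauss I) P"
    unfolding P_def
    by (intro Bochner_Integration.integrable_add integrable_mult_right iP1 iP2 iP3 G.integrable_const)
  have e1: "(\<integral>\<omega>. (\<Sum>k\<in>T. w k * X \<omega> k) \<partial>gauss I) = 0"
    by (subst Bochner_Integration.integral_sum) (simp_all add: li)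
  have e2: "(\<integral>\<omega>. (\<Sum>k\<in>T. \<Sum>l\<in>T. (w k * w l) * (X \<omega> k * X \<omega> l)) \<partial>gauss I)
      = (\<Sum>k\<in>T. \<Sum>l\<in>T. w k * w l * (\<Sum>i\<in>I. a k i * a l i))"
    by (subst Bochner_Integration.integral_sum, simp add: li,
        intro sum.cong refl, subst Bochner_Integration.integral_sum) (simp_all add: li)
  have e3: "(\<integral>\<omega>. (\<Sum>k\<in>T. w k * (X \<omega> k * X \<omega> k)) \<partial>gauss I)
      = (\<Sum>k\<in>T. w k * (\<Sum>i\<in>I. a k i * a k i))"
    by (subst Bochner_Integration.integral_sum) (simp_all add: li)
  have eP: "(\<integral>\<omega>. P \<omega> \<partial>gauss I) = L\<^sup>2 + h\<^sup>2 * field_drift I a T s"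
  proof -
    have "(\<integral>\<omega>. P \<omega> \<partial>gauss I) = L\<^sup>2 + 2 * L * (h * 0)
      + ((1 - L) * (h\<^sup>2 * (\<Sum>k\<in>T. \<Sum>l\<in>T. w k * w l * (\<Sum>i\<in>I. a k i * a l i)))
         + L * (h\<^sup>2 * (\<Sum>k\<in>T. w k * (\<Sum>i\<in>I. a k i * a k i))))"
      unfolding P_def e1[symmetric] e2[symmetric] e3[symmetric]
      by (simp add: iP1 iP2 iP3 G.prob_space)
    then show ?thesis
      unfolding field_drift_def L_def w_def by (simp add: algebra_simps)
  qed
  have Fm: "F \<in> borel_measurable (gauss I)"
    unfolding F_def X_def
    by (intro borel_measurable_power measurable_softmax borel_measurable_add borel_measurable_times
        borel_measurable_const measurable_lin_field)
  have ibd: "integrable (gauss I) (\<lambda>\<omega>. h ^ 3 * L * 4 * ((c * R \<omega>) ^ 3 + (c * R \<omega>) ^ 4))"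
    by (intro integrable_mult_right Bochner_Integration.integrable_add Rn)
  have iFP: "integrable (gauss I) (\<lambda>\<omega>. F \<omega> - P \<omega>)"
    using ibd
  proof (rule Bochner_Integration.integrable_bound)
    show "(\<lambda>\<omega>. F \<omega> - P \<omega>) \<in> borel_measurable (gauss I)"
      using Fm iP by (intro borel_measurable_diff) auto
    show "AE \<omega> in gauss I. norm (F \<omega> - P \<omega>) \<le> norm (h ^ 3 * L * 4 * ((c * R \<omega>) ^ 3 + (c * R \<omega>) ^ 4))"
      using taylor by (intro AE_I2) (simp only: real_norm_def, meson abs_ge_self order_trans)
  qed
  have iF: "integrable (gauss I) F"
    using Bochner_Integration.integrable_add[OF iFP iP] by simp
  have "\<bar>\<integral>\<omega>. F \<omega> - P \<omega> \<partial>gauss I\<bar> \<le> (\<integral>\<omega>. \<bar>F \<omega> - P \<omega>\<bar> \<partial>gauss I)"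
    by (rule integral_abs_bound)
  also have "\<dots> \<le> (\<integral>\<omega>. h ^ 3 * L * 4 * ((c * R \<omega>) ^ 3 + (c * R \<omega>) ^ 4) \<partial>gauss I)"
    by (intro integral_mono integrable_abs iFP ibd taylor)
  also have "\<dots> = h ^ 3 * K * L"
    unfolding K_def by simp
  finally have "\<bar>(\<integral>\<omega>. F \<omega> \<partial>gauss I) - (L\<^sup>2 + h\<^sup>2 * field_drift I a T s)\<bar> \<le> h ^ 3 * K * L"
    unfolding Bochner_Integration.integral_diff[OF iF iP] eP .
  with iF show "integrable (gauss I) (\<lambda>\<omega>. (softmax T (\<lambda>k. s k + h * lin_field I a \<omega> k))\<^sup>2) \<and>
      \<bar>(\<integral>\<omega>. (softmax T (\<lambda>k. s k + h * lin_field I a \<omega> k))\<^sup>2 \<partial>gauss I)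
        - ((softmax T s)\<^sup>2 + h\<^sup>2 * field_drift I a T s)\<bar> \<le> h ^ 3 * K * softmax T s"
    unfolding F_def X_def L_def by simp
qed

text \<open>
  With \<open>L\<close> the soft maximum and \<open>P\<close> the total Gibbs weight, the contribution of \<open>D\<close> to the difference of
  the drifts is \<open>1 - L \<le> 0\<close> times a nonnegative sum, because \<open>D\<close> does not touch the diagonal. The
  constant contributes \<open>- \<tau> P (P + L (1 - P))\<close>, which is nonpositive because \<open>P \<le> 1\<close>.
\<close>

lemma field_drift_le:
  assumes T: "finite T"
    and cov: "\<And>k l. k \<in> T \<Longrightarrow> l \<in> T \<Longrightarrow>
      (\<Sum>i\<in>I. a k i * a l i) - (\<Sum>j\<in>J. b k j * b l j) = D k l - \<tau>"
    and D0: "\<And>k l. k \<in> T \<Longrightarrow> l \<in> T \<Longrightarrow> D k l \<ge> 0" and Dk: "\<And>k. k \<in> T \<Longrightarrow> D k k = 0"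
    and \<tau>: "\<tau> \<ge> (0::real)"
  shows "field_drift I a T s \<le> field_drift J b T s"
proof -
  define w where "w = gibbs_weight T s"
  define L where "L = softmax T s"
  define P where "P = (\<Sum>k\<in>T. w k)"
  have L1: "L \<ge> 1" unfolding L_def by (rule softmax_ge_1)
  have w0: "w k \<ge> 0" for k unfolding w_def by (rule gibbs_weight_nonneg)
  have P: "0 \<le> P" "P \<le> 1"
    unfolding P_def using w0 gibbs_weight_sum_le_1[of T s] by (auto simp: w_def intro!: sum_nonneg)
  define Sa where "Sa = (\<Sum>k\<in>T. \<Sum>l\<in>T. w k * w l * (\<Sum>i\<in>I. a k i * a l i))"
  define Sb where "Sb = (\<Sum>k\<in>T. \<Sum>l\<in>T. w k * w l * (\<Sum>j\<in>J. b k j * b l j))"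
  define Da where "Da = (\<Sum>k\<in>T. w k * (\<Sum>i\<in>I. a k i * a k i))"
  define Db where "Db = (\<Sum>k\<in>T. w k * (\<Sum>j\<in>J. b k j * b k j))"
  have off: "(\<Sum>k\<in>T. \<Sum>l\<in>T. w k * w l * (\<Sum>i\<in>I. a k i * a l i))
      - (\<Sum>k\<in>T. \<Sum>l\<in>T. w k * w l * (\<Sum>j\<in>J. b k j * b l j))
      = (\<Sum>k\<in>T. \<Sum>l\<in>T. w k * w l * D k l) - \<tau> * P\<^sup>2"
  proof -
    have "(\<Sum>k\<in>T. \<Sum>l\<in>T. w k * w l * (\<Sum>i\<in>I. a k i * a l i))
      - (\<Sum>k\<in>T. \<Sum>l\<in>T. w k * w l * (\<Sum>j\<in>J. b k j * b l j))
      = (\<Sum>k\<in>T. \<Sum>l\<in>T. w k * w l * (D k l - \<tau>))"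
      unfolding sum_subtractf[symmetric] right_diff_distrib[symmetric]
      by (intro sum.cong refl) (simp add: cov)
    also have "\<dots> = (\<Sum>k\<in>T. \<Sum>l\<in>T. w k * w l * D k l) - (\<Sum>k\<in>T. \<Sum>l\<in>T. w k * w l) * \<tau>"
      by (simp add: right_diff_distrib sum_subtractf sum_distrib_right)
    also have "(\<Sum>k\<in>T. \<Sum>l\<in>T. w k * w l) = P\<^sup>2"
      unfolding P_def power2_eq_square sum_product ..
    finally show ?thesis by (simp add: mult.commute)
  qed
  have diag: "(\<Sum>k\<in>T. w k * (\<Sum>i\<in>I. a k i * a k i)) - (\<Sum>k\<in>T. w k * (\<Sum>j\<in>J. b k j * b k j)) = - \<tau> * P"
  proof -
    have "(\<Sum>k\<in>T. w k * (\<Sum>i\<in>I. a k i * a k i)) - (\<Sum>k\<in>T. w k * (\<Sum>j\<in>J. b k j * b k j))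
      = (\<Sum>k\<in>T. w k * (- \<tau>))"
      unfolding sum_subtractf[symmetric] right_diff_distrib[symmetric]
      by (intro sum.cong refl) (simp add: cov Dk)
    also have "\<dots> = - \<tau> * P"
      unfolding P_def by (simp add: sum_negf sum_distrib_left mult.commute)
    finally show ?thesis .
  qed
  have S0: "(\<Sum>k\<in>T. \<Sum>l\<in>T. w k * w l * D k l) \<ge> 0"
    by (intro sum_nonneg mult_nonneg_nonneg w0 D0)
  have "field_drift I a T s - field_drift J b T s
    = (1 - L) * ((\<Sum>k\<in>T. \<Sum>l\<in>T. w k * w l * D k l) - \<tau> * P\<^sup>2) + L * (- \<tau> * P)"
  proof -
    have "field_drift I a T s - field_drift J b T s = (1 - L) * (Sa - Sb) + L * (Da - Db)"
      unfolding field_drift_def L_def[symmetric] w_def[symmetric] Sa_def[symmetric] Sb_def[symmetric]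
        Da_def[symmetric] Db_def[symmetric] by (simp add: algebra_simps)
    then show ?thesis unfolding off[folded Sa_def Sb_def] diag[folded Da_def Db_def] .
  qed
  also have "\<dots> = - ((L - 1) * (\<Sum>k\<in>T. \<Sum>l\<in>T. w k * w l * D k l))
      - \<tau> * P * (P + L * (1 - P))"
    by (simp add: algebra_simps power2_eq_square)
  also have "\<dots> \<le> 0"
  proof -
    have "(L - 1) * (\<Sum>k\<in>T. \<Sum>l\<in>T. w k * w l * D k l) \<ge> 0" using L1 S0 by simp
    moreover have "\<tau> * P * (P + L * (1 - P)) \<ge> 0" using \<tau> P L1 by simp
    ultimately show ?thesis by simp
  qed
  finally show ?thesis by simp
qed

text \<open>
  A field of size \<open>sqrt (x^2 + y^2)\<close> splits into independent copies of sizes \<open>x\<close> and \<open>y\<close>. This cuts off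
  the small piece that is exchanged, and glues its replacement to the rest.
\<close>

lemma gauss_rotate_scaled:
  assumes I: "finite I" and xy: "x \<ge> 0" "y > 0"
    and G: "(\<lambda>\<omega>. G (\<lambda>k. sqrt (x\<^sup>2 + y\<^sup>2) * lin_field I a \<omega> k)) \<in> borel_measurable (gauss I)"
  shows "(\<integral>\<^sup>+\<omega>. G (\<lambda>k. sqrt (x\<^sup>2 + y\<^sup>2) * lin_field I a \<omega> k) \<partial>gauss I)
    = (\<integral>\<^sup>+\<omega>. \<integral>\<^sup>+\<omega>'. G (\<lambda>k. x * lin_field I a \<omega> k + y * lin_field I a \<omega>' k) \<partial>gauss I \<partial>gauss I)"
proof -
  define r where "r = sqrt (x\<^sup>2 + y\<^sup>2)"
  have r: "r > 0" "r\<^sup>2 = x\<^sup>2 + y\<^sup>2" unfolding r_def using xy by (auto intro!: real_sqrt_gt_zero add_nonneg_pos)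
  have lin: "r * lin_field I a (\<lambda>i\<in>I. x / r * \<omega> i + y / r * \<omega>' i) k
      = x * lin_field I a \<omega> k + y * lin_field I a \<omega>' k" for \<omega> \<omega>' k
  proof -
    have "r * lin_field I a (\<lambda>i\<in>I. x / r * \<omega> i + y / r * \<omega>' i) k
        = (\<Sum>i\<in>I. x * (a k i * \<omega> i) + y * (a k i * \<omega>' i))"
      unfolding lin_field_def sum_distrib_left using r(1) by (intro sum.cong refl) (simp add: field_simps)
    then show ?thesis unfolding lin_field_def by (simp add: sum.distrib sum_distrib_left)
  qed
  have "(x / r)\<^sup>2 + (y / r)\<^sup>2 = 1"
    unfolding power_divide add_divide_distrib[symmetric] r(2)[symmetric] using r(1) by simp
  from gauss_rotate[OF I _ _ this G[folded r_def]] show ?thesis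
    unfolding lin r_def[symmetric] using r xy by simp
qed

context
  fixes T :: "'k set" and I :: "'i set" and J :: "'j set"
    and a :: "'k \<Rightarrow> 'i \<Rightarrow> real" and b :: "'k \<Rightarrow> 'j \<Rightarrow> real"
    and D :: "'k \<Rightarrow> 'k \<Rightarrow> real" and \<tau> :: real
  assumes T: "finite T" and I: "finite I" and J: "finite J"
    and cov: "\<And>k l. k \<in> T \<Longrightarrow> l \<in> T \<Longrightarrow>
      (\<Sum>i\<in>I. a k i * a l i) - (\<Sum>j\<in>J. b k j * b l j) = D k l - \<tau>"
    and D0: "\<And>k l. k \<in> T \<Longrightarrow> l \<in> T \<Longrightarrow> D k l \<ge> 0" and Dk: "\<And>k. k \<in> T \<Longrightarrow> D k k = 0"
    and \<tau>: "\<tau> \<ge> 0"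
begin

lemma softmax_small_step:
  obtains K where "K \<ge> 0"
    and "\<And>s h. 0 \<le> h \<Longrightarrow> h \<le> 1 \<Longrightarrow>
      (\<integral>\<^sup>+\<omega>. ennreal ((softmax T (\<lambda>k. s k + h * lin_field I a \<omega> k))\<^sup>2) \<partial>gauss I)
      \<le> (\<integral>\<^sup>+\<omega>. ennreal ((softmax T (\<lambda>k. s k + h * lin_field J b \<omega> k))\<^sup>2) \<partial>gauss J)
        + ennreal (h ^ 3 * K) * ennreal (softmax T s)"
proof -
  obtain K1 where K1: "K1 \<ge> 0"
    and X: "\<And>s h. 0 \<le> h \<Longrightarrow> h \<le> 1 \<Longrightarrow>
      integrable (gauss I) (\<lambda>\<omega>. (softmax T (\<lambda>k. s k + h * lin_field I a \<omega> k))\<^sup>2) \<and>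
      \<bar>(\<integral>\<omega>. (softmax T (\<lambda>k. s k + h * lin_field I a \<omega> k))\<^sup>2 \<partial>gauss I)
        - ((softmax T s)\<^sup>2 + h\<^sup>2 * field_drift I a T s)\<bar> \<le> h ^ 3 * K1 * softmax T s"
    using softmax_square_expansion[OF T I, of a] by blast
  obtain K2 where K2: "K2 \<ge> 0"
    and Y: "\<And>s h. 0 \<le> h \<Longrightarrow> h \<le> 1 \<Longrightarrow>
      integrable (gauss J) (\<lambda>\<omega>. (softmax T (\<lambda>k. s k + h * lin_field J b \<omega> k))\<^sup>2) \<and>
      \<bar>(\<integral>\<omega>. (softmax T (\<lambda>k. s k + h * lin_field J b \<omega> k))\<^sup>2 \<partial>gauss J)
        - ((softmax T s)\<^sup>2 + h\<^sup>2 * field_drift J b T s)\<bar> \<le> h ^ 3 * K2 * softmax T s"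
    using softmax_square_expansion[OF T J, of b] by blast
  show ?thesis
  proof (rule that[of "K1 + K2"])
    fix s :: "'k \<Rightarrow> real" and h :: real assume h: "0 \<le> h" "h \<le> 1"
    define eX where "eX = (\<integral>\<omega>. (softmax T (\<lambda>k. s k + h * lin_field I a \<omega> k))\<^sup>2 \<partial>gauss I)"
    define eY where "eY = (\<integral>\<omega>. (softmax T (\<lambda>k. s k + h * lin_field J b \<omega> k))\<^sup>2 \<partial>gauss J)"
    have "field_drift I a T s \<le> field_drift J b T s"
      by (rule field_drift_le[OF T cov D0 Dk \<tau>])
    then have "h\<^sup>2 * field_drift I a T s \<le> h\<^sup>2 * field_drift J b T s"
      by (intro mult_left_mono) auto
    moreover have "eX \<le> (softmax T s)\<^sup>2 + h\<^sup>2 * field_drift I a T s + h ^ 3 * K1 * softmax T s"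
      using X[OF h, of s] unfolding eX_def by linarith
    moreover have "eY \<ge> (softmax T s)\<^sup>2 + h\<^sup>2 * field_drift J b T s - h ^ 3 * K2 * softmax T s"
      using Y[OF h, of s] unfolding eY_def by linarith
    ultimately have le: "eX \<le> eY + h ^ 3 * (K1 + K2) * softmax T s" by (simp add: algebra_simps)
    have nX: "(\<integral>\<^sup>+\<omega>. ennreal ((softmax T (\<lambda>k. s k + h * lin_field I a \<omega> k))\<^sup>2) \<partial>gauss I) = ennreal eX"
      unfolding eX_def using X[OF h, of s] by (intro nn_integral_eq_integral) auto
    have nY: "(\<integral>\<^sup>+\<omega>. ennreal ((softmax T (\<lambda>k. s k + h * lin_field J b \<omega> k))\<^sup>2) \<partial>gauss J) = ennreal eY"
      unfolding eY_def using Y[OF h, of s] by (intro nn_integral_eq_integral) auto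
    have eY0: "eY \<ge> 0" unfolding eY_def by (intro integral_nonneg_AE) auto
    have e0: "h ^ 3 * (K1 + K2) \<ge> 0" using h K1 K2 by simp
    have s0: "softmax T s \<ge> 0" using softmax_ge_1[of T s] by simp
    have "ennreal eX \<le> ennreal (eY + h ^ 3 * (K1 + K2) * softmax T s)"
      by (rule ennreal_leI[OF le])
    also have "\<dots> = ennreal eY + ennreal (h ^ 3 * (K1 + K2)) * ennreal (softmax T s)"
      using eY0 e0 s0 by (simp add: ennreal_plus ennreal_mult)
    finally show "(\<integral>\<^sup>+\<omega>. ennreal ((softmax T (\<lambda>k. s k + h * lin_field I a \<omega> k))\<^sup>2) \<partial>gauss I)
      \<le> (\<integral>\<^sup>+\<omega>. ennreal ((softmax T (\<lambda>k. s k + h * lin_field J b \<omega> k))\<^sup>2) \<partial>gauss J)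
        + ennreal (h ^ 3 * (K1 + K2)) * ennreal (softmax T s)"
      unfolding nX nY .
  qed (use K1 K2 in auto)
qed

text \<open>
  The Lindeberg exchange. The interpolation \<open>V x y\<close> is the expected squared soft maximum of \<open>x\<close> times
  the first field plus \<open>y\<close> times an independent copy of the second one; \<open>V 1 0\<close> and \<open>V 0 1\<close> are the
  quantities to be compared. Nonnegative integrals in \<^typ>\<open>ennreal\<close> make all interchanges of
  integrals unconditional.
\<close>

lemma softmax_square_comparison:
  "(\<integral>\<^sup>+\<omega>. ennreal ((softmax T (lin_field I a \<omega>))\<^sup>2) \<partial>gauss I)
    \<le> (\<integral>\<^sup>+\<omega>. ennreal ((softmax T (lin_field J b \<omega>))\<^sup>2) \<partial>gauss J)"
proof -
  interpret GI: prob_space "gauss I" by (rule prob_space_gauss)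
  interpret GJ: prob_space "gauss J" by (rule prob_space_gauss)
  interpret PIJ: pair_sigma_finite "gauss I" "gauss J" ..
  obtain K where K: "K \<ge> 0"
    and step: "\<And>s h. 0 \<le> h \<Longrightarrow> h \<le> 1 \<Longrightarrow>
      (\<integral>\<^sup>+\<omega>. ennreal ((softmax T (\<lambda>k. s k + h * lin_field I a \<omega> k))\<^sup>2) \<partial>gauss I)
      \<le> (\<integral>\<^sup>+\<omega>. ennreal ((softmax T (\<lambda>k. s k + h * lin_field J b \<omega> k))\<^sup>2) \<partial>gauss J)
        + ennreal (h ^ 3 * K) * ennreal (softmax T s)"
    by (rule softmax_small_step) blast
  define F where "F = (\<lambda>s. ennreal ((softmax T s)\<^sup>2))"
  define X where "X = lin_field I a"
  define Y where "Y = lin_field J b"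
  have [measurable]: "(\<lambda>\<omega>. X \<omega> k) \<in> borel_measurable (gauss I)"
    "(\<lambda>\<omega>. Y \<omega> k) \<in> borel_measurable (gauss J)" for k
    unfolding X_def Y_def by measurable
  define V where "V = (\<lambda>x y. \<integral>\<^sup>+\<omega>. \<integral>\<^sup>+\<omega>'. F (\<lambda>k. x * X \<omega> k + y * Y \<omega>' k) \<partial>gauss J \<partial>gauss I)"
  define cX where "cX = (\<lambda>\<omega>. (\<Sum>k\<in>T. \<Sum>i\<in>I. \<bar>a k i\<bar>) * (\<Sum>i\<in>I. \<bar>\<omega> i\<bar>))"
  define cY where "cY = (\<lambda>\<omega>. (\<Sum>k\<in>T. \<Sum>j\<in>J. \<bar>b k j\<bar>) * (\<Sum>j\<in>J. \<bar>\<omega> j\<bar>))"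
  have c0: "cX \<omega> \<ge> 0" "cY \<omega>' \<ge> 0" for \<omega> \<omega>'
    unfolding cX_def cY_def by (intro mult_nonneg_nonneg sum_nonneg; simp)+
  have icX: "integrable (gauss I) cX"
    using gauss_norm1_power_integrable[OF I, of 1] unfolding cX_def power_one_right
    by (rule integrable_mult_right)
  have icY: "integrable (gauss J) cY"
    using gauss_norm1_power_integrable[OF J, of 1] unfolding cY_def power_one_right
    by (rule integrable_mult_right)
  define L0 where "L0 = softmax T (\<lambda>_. 0)"
  have L0: "L0 \<ge> 0" unfolding L0_def using softmax_ge_1[of T "\<lambda>_. 0"] by simp
  define B where "B = L0 + (\<integral>\<omega>. cY \<omega> \<partial>gauss J) + (\<integral>\<omega>. cX \<omega> \<partial>gauss I)"
  have EcY: "(\<integral>\<omega>. cY \<omega> \<partial>gauss J) \<ge> 0" by (intro integral_nonneg_AE AE_I2 c0)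
  have EcX: "(\<integral>\<omega>. cX \<omega> \<partial>gauss I) \<ge> 0" by (intro integral_nonneg_AE AE_I2 c0)
  have B0: "B \<ge> 0" unfolding B_def using L0 EcX EcY by simp
  \<comment> \<open>The error of a step is proportional to the soft maximum at the base point; its expectation is
      bounded uniformly over the whole interpolation.\<close>
  have bound: "(\<integral>\<^sup>+\<omega>. \<integral>\<^sup>+\<omega>'. ennreal (softmax T (\<lambda>k. x * X \<omega> k + y * Y \<omega>' k)) \<partial>gauss J \<partial>gauss I) \<le> ennreal B"
    if "0 \<le> x" "x \<le> 1" "0 \<le> y" "y \<le> 1" for x y :: real
  proof -
    have pt: "softmax T (\<lambda>k. x * X \<omega> k + y * Y \<omega>' k) \<le> L0 + cX \<omega> + cY \<omega>'" for \<omega> \<omega>'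
    proof -
      have "softmax T (\<lambda>k. 0 + (x * X \<omega> k + y * Y \<omega>' k)) \<le> L0 + (cX \<omega> + cY \<omega>')"
        unfolding L0_def
      proof (rule softmax_perturb[OF T])
        fix k assume k: "k \<in> T"
        have "\<bar>x * X \<omega> k\<bar> \<le> 1 * cX \<omega>" unfolding abs_mult
          using lin_field_bound[OF T I k, of a \<omega>] that unfolding X_def cX_def by (intro mult_mono) auto
        moreover have "\<bar>y * Y \<omega>' k\<bar> \<le> 1 * cY \<omega>'" unfolding abs_mult
          using lin_field_bound[OF T J k, of b \<omega>'] that unfolding Y_def cY_def by (intro mult_mono) auto
        ultimately show "\<bar>x * X \<omega> k + y * Y \<omega>' k\<bar> \<le> cX \<omega> + cY \<omega>'" by linarith
      qed (use c0 in simp)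
      then show ?thesis by simp
    qed
    have "(\<integral>\<^sup>+\<omega>. \<integral>\<^sup>+\<omega>'. ennreal (softmax T (\<lambda>k. x * X \<omega> k + y * Y \<omega>' k)) \<partial>gauss J \<partial>gauss I)
        \<le> (\<integral>\<^sup>+\<omega>. \<integral>\<^sup>+\<omega>'. ennreal (L0 + cX \<omega> + cY \<omega>') \<partial>gauss J \<partial>gauss I)"
      by (intro nn_integral_mono ennreal_leI pt)
    also have "\<dots> = (\<integral>\<^sup>+\<omega>. ennreal (L0 + cX \<omega> + (\<integral>\<omega>'. cY \<omega>' \<partial>gauss J)) \<partial>gauss I)"
    proof (intro nn_integral_cong)
      fix \<omega>
      have "(\<integral>\<^sup>+\<omega>'. ennreal (L0 + cX \<omega> + cY \<omega>') \<partial>gauss J) = ennreal (\<integral>\<omega>'. L0 + cX \<omega> + cY \<omega>' \<partial>gauss J)"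
        using c0 L0 by (intro nn_integral_eq_integral AE_I2 Bochner_Integration.integrable_add
            GJ.integrable_const icY) (simp add: add_nonneg_nonneg)
      also have "(\<integral>\<omega>'. L0 + cX \<omega> + cY \<omega>' \<partial>gauss J) = L0 + cX \<omega> + (\<integral>\<omega>'. cY \<omega>' \<partial>gauss J)"
        by (subst Bochner_Integration.integral_add) (simp_all add: icY GJ.prob_space)
      finally show "(\<integral>\<^sup>+\<omega>'. ennreal (L0 + cX \<omega> + cY \<omega>') \<partial>gauss J)
        = ennreal (L0 + cX \<omega> + (\<integral>\<omega>'. cY \<omega>' \<partial>gauss J))" .
    qed
    also have "\<dots> = (\<integral>\<^sup>+\<omega>. ennreal ((L0 + (\<integral>\<omega>'. cY \<omega>' \<partial>gauss J)) + cX \<omega>) \<partial>gauss I)"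
      by (simp add: ac_simps)
    also have "\<dots> = ennreal (\<integral>\<omega>. (L0 + (\<integral>\<omega>'. cY \<omega>' \<partial>gauss J)) + cX \<omega> \<partial>gauss I)"
      using c0 L0 EcY by (intro nn_integral_eq_integral AE_I2 Bochner_Integration.integrable_add
            GI.integrable_const icX) (simp add: add_nonneg_nonneg)
    also have "(\<integral>\<omega>. (L0 + (\<integral>\<omega>'. cY \<omega>' \<partial>gauss J)) + cX \<omega> \<partial>gauss I) = B"
      unfolding B_def by (subst Bochner_Integration.integral_add) (simp_all add: icX GI.prob_space)
    finally show ?thesis .
  qed
  \<comment> \<open>One exchange: split off a piece of size \<open>h\<close> from the first field, replace it by a piece of
      the second field, and merge that piece with the second field.\<close>
  have stepV: "V (sqrt (x\<^sup>2 + h\<^sup>2)) y \<le> V x (sqrt (y\<^sup>2 + h\<^sup>2)) + ennreal (h ^ 3 * K) * ennreal B"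
    if x: "0 \<le> x" "x \<le> 1" and y: "0 \<le> y" "y \<le> 1" and h: "0 < h" "h \<le> 1" for x y h :: real
  proof -
    define r where "r = sqrt (x\<^sup>2 + h\<^sup>2)"
    define t where "t = sqrt (y\<^sup>2 + h\<^sup>2)"
    have "V r y = (\<integral>\<^sup>+\<omega>'. \<integral>\<^sup>+\<omega>. F (\<lambda>k. r * X \<omega> k + y * Y \<omega>' k) \<partial>gauss I \<partial>gauss J)"
      unfolding V_def F_def
      by (rule PIJ.Fubini'[of "\<lambda>\<omega> \<omega>'. ennreal ((softmax T (\<lambda>k. r * X \<omega> k + y * Y \<omega>' k))\<^sup>2)", symmetric]) measurable
    also have "\<dots> = (\<integral>\<^sup>+\<omega>'. \<integral>\<^sup>+\<omega>. \<integral>\<^sup>+\<zeta>. F (\<lambda>k. x * X \<omega> k + h * X \<zeta> k + y * Y \<omega>' k)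
        \<partial>gauss I \<partial>gauss I \<partial>gauss J)"
      unfolding r_def X_def
    proof (rule nn_integral_cong)
      fix \<omega>'
      show "(\<integral>\<^sup>+\<omega>. F (\<lambda>k. sqrt (x\<^sup>2 + h\<^sup>2) * lin_field I a \<omega> k + y * Y \<omega>' k) \<partial>gauss I)
        = (\<integral>\<^sup>+\<omega>. \<integral>\<^sup>+\<zeta>. F (\<lambda>k. x * lin_field I a \<omega> k + h * lin_field I a \<zeta> k + y * Y \<omega>' k)
            \<partial>gauss I \<partial>gauss I)"
        by (rule gauss_rotate_scaled[OF I x(1) h(1), where G = "\<lambda>s. F (\<lambda>k. s k + y * Y \<omega>' k)"])
          (unfold F_def, measurable)
    qed
    also have "\<dots> \<le> (\<integral>\<^sup>+\<omega>'. \<integral>\<^sup>+\<omega>. (\<integral>\<^sup>+\<zeta>. F (\<lambda>k. x * X \<omega> k + y * Y \<omega>' k + h * Y \<zeta> k) \<partial>gauss J)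
        + ennreal (h ^ 3 * K) * ennreal (softmax T (\<lambda>k. x * X \<omega> k + y * Y \<omega>' k)) \<partial>gauss I \<partial>gauss J)"
    proof (intro nn_integral_mono)
      fix \<omega> \<omega>'
      have "(\<lambda>\<zeta>. F (\<lambda>k. x * X \<omega> k + h * X \<zeta> k + y * Y \<omega>' k))
          = (\<lambda>\<zeta>. F (\<lambda>k. (x * X \<omega> k + y * Y \<omega>' k) + h * X \<zeta> k))"
        by (simp add: ac_simps)
      then show "(\<integral>\<^sup>+\<zeta>. F (\<lambda>k. x * X \<omega> k + h * X \<zeta> k + y * Y \<omega>' k) \<partial>gauss I)
        \<le> (\<integral>\<^sup>+\<zeta>. F (\<lambda>k. x * X \<omega> k + y * Y \<omega>' k + h * Y \<zeta> k) \<partial>gauss J)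
        + ennreal (h ^ 3 * K) * ennreal (softmax T (\<lambda>k. x * X \<omega> k + y * Y \<omega>' k))"
        using step[of h "\<lambda>k. x * X \<omega> k + y * Y \<omega>' k"] h unfolding F_def X_def Y_def by simp
    qed
    also have "\<dots> = (\<integral>\<^sup>+\<omega>. \<integral>\<^sup>+\<omega>'. (\<integral>\<^sup>+\<zeta>. F (\<lambda>k. x * X \<omega> k + y * Y \<omega>' k + h * Y \<zeta> k) \<partial>gauss J)
        + ennreal (h ^ 3 * K) * ennreal (softmax T (\<lambda>k. x * X \<omega> k + y * Y \<omega>' k)) \<partial>gauss J \<partial>gauss I)"
      unfolding F_def
      by (rule PIJ.Fubini'[of "\<lambda>\<omega> \<omega>'.
            (\<integral>\<^sup>+\<zeta>. ennreal ((softmax T (\<lambda>k. x * X \<omega> k + y * Y \<omega>' k + h * Y \<zeta> k))\<^sup>2) \<partial>gauss J)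
              + ennreal (h ^ 3 * K) * ennreal (softmax T (\<lambda>k. x * X \<omega> k + y * Y \<omega>' k))"]) measurable
    also have "\<dots> = (\<integral>\<^sup>+\<omega>. (\<integral>\<^sup>+\<omega>'. \<integral>\<^sup>+\<zeta>. F (\<lambda>k. x * X \<omega> k + y * Y \<omega>' k + h * Y \<zeta> k) \<partial>gauss J \<partial>gauss J)
        + ennreal (h ^ 3 * K) * (\<integral>\<^sup>+\<omega>'. ennreal (softmax T (\<lambda>k. x * X \<omega> k + y * Y \<omega>' k)) \<partial>gauss J) \<partial>gauss I)"
      unfolding F_def
      by (intro nn_integral_cong, subst nn_integral_add, measurable, subst nn_integral_cmult, measurable)
    also have "\<dots> = (\<integral>\<^sup>+\<omega>. (\<integral>\<^sup>+\<omega>'. F (\<lambda>k. x * X \<omega> k + t * Y \<omega>' k) \<partial>gauss J)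
        + ennreal (h ^ 3 * K) * (\<integral>\<^sup>+\<omega>'. ennreal (softmax T (\<lambda>k. x * X \<omega> k + y * Y \<omega>' k)) \<partial>gauss J) \<partial>gauss I)"
    proof -
      have "(\<integral>\<^sup>+\<omega>'. F (\<lambda>k. x * X \<omega> k + sqrt (y\<^sup>2 + h\<^sup>2) * lin_field J b \<omega>' k) \<partial>gauss J)
        = (\<integral>\<^sup>+\<omega>'. \<integral>\<^sup>+\<zeta>. F (\<lambda>k. x * X \<omega> k + (y * lin_field J b \<omega>' k + h * lin_field J b \<zeta> k))
            \<partial>gauss J \<partial>gauss J)" for \<omega>
        by (rule gauss_rotate_scaled[OF J y(1) h(1), where G = "\<lambda>s. F (\<lambda>k. x * X \<omega> k + s k)"])
          (unfold F_def, measurable)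
      then have "(\<integral>\<^sup>+\<omega>'. \<integral>\<^sup>+\<zeta>. F (\<lambda>k. x * X \<omega> k + y * Y \<omega>' k + h * Y \<zeta> k) \<partial>gauss J \<partial>gauss J)
        = (\<integral>\<^sup>+\<omega>'. F (\<lambda>k. x * X \<omega> k + t * Y \<omega>' k) \<partial>gauss J)" for \<omega>
        unfolding t_def Y_def add.assoc by (rule sym)
      then show ?thesis by (simp only:)
    qed
    also have "\<dots> = V x t + ennreal (h ^ 3 * K)
        * (\<integral>\<^sup>+\<omega>. \<integral>\<^sup>+\<omega>'. ennreal (softmax T (\<lambda>k. x * X \<omega> k + y * Y \<omega>' k)) \<partial>gauss J \<partial>gauss I)"
      unfolding V_def F_def
      by (subst nn_integral_add, measurable, subst nn_integral_cmult, measurable)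
    also have "\<dots> \<le> V x t + ennreal (h ^ 3 * K) * ennreal B"
      by (intro add_left_mono mult_left_mono bound x y) simp
    finally show ?thesis unfolding r_def t_def .
  qed
  have iter: "V (sqrt (n / N)) (sqrt ((N - n) / N)) \<le> V 0 1 + of_nat n * ennreal ((1 / sqrt N) ^ 3 * K * B)"
    if N: "N > 0" and n: "n \<le> N" for n N :: nat
    using n
  proof (induction n)
    case 0
    then show ?case using N by simp
  next
    case (Suc n)
    define h where "h = 1 / sqrt N"
    have h: "0 < h" "h \<le> 1" "h\<^sup>2 = 1 / N" unfolding h_def using N by (auto simp: power_divide)
    have n: "n < N" using Suc by simp
    have e1: "sqrt (Suc n / N) = sqrt ((sqrt (n / N))\<^sup>2 + h\<^sup>2)"
      using N by (simp add: h add_divide_distrib add.commute)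
    have e2: "sqrt ((N - n) / N) = sqrt ((sqrt ((N - Suc n) / N))\<^sup>2 + h\<^sup>2)"
    proof -
      have "real (N - n) = real (N - Suc n) + 1" using n by (simp add: of_nat_diff)
      then have "real (N - n) / N = real (N - Suc n) / N + 1 / N" by (simp only: add_divide_distrib)
      moreover have "(sqrt (real (N - Suc n) / N))\<^sup>2 = real (N - Suc n) / N"
        by (rule real_sqrt_pow2) simp
      ultimately show ?thesis by (simp only: h)
    qed
    have "V (sqrt (Suc n / N)) (sqrt ((N - Suc n) / N))
        \<le> V (sqrt (n / N)) (sqrt ((N - n) / N)) + ennreal (h ^ 3 * K) * ennreal B"
      unfolding e1 e2 by (rule stepV) (use n h N in \<open>auto simp: divide_le_eq\<close>)
    also have "ennreal (h ^ 3 * K) * ennreal B = ennreal (h ^ 3 * K * B)"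
      using h K B0 by (subst ennreal_mult) auto
    also have "V (sqrt (n / N)) (sqrt ((N - n) / N)) + ennreal (h ^ 3 * K * B)
        \<le> V 0 1 + of_nat n * ennreal (h ^ 3 * K * B) + ennreal (h ^ 3 * K * B)"
      unfolding h_def using Suc by (intro add_right_mono) auto
    also have "\<dots> = V 0 1 + of_nat (Suc n) * ennreal (h ^ 3 * K * B)"
      by (simp add: algebra_simps)
    finally show ?case unfolding h_def by simp
  qed
  \<comment> \<open>There are \<open>N\<close> steps of size \<open>h = 1 / sqrt N\<close>, each with an error of order \<open>h^3\<close>.\<close>
  have limit: "V 1 0 \<le> V 0 1 + ennreal (K * B / sqrt N)" if N: "N > 0" for N :: nat
  proof -
    have "V 1 0 \<le> V 0 1 + of_nat N * ennreal ((1 / sqrt N) ^ 3 * K * B)"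
      using iter[OF N, of N] N by simp
    also have "of_nat N * ennreal ((1 / sqrt N) ^ 3 * K * B) = ennreal (N * ((1 / sqrt N) ^ 3 * K * B))"
      using K B0 by (simp add: ennreal_mult ennreal_of_nat_eq_real_of_nat)
    also have "N * ((1 / sqrt N) ^ 3 * K * B) = K * B / sqrt N"
    proof -
      have "real N = sqrt N * sqrt N" by simp
      then have "N * (1 / sqrt N) ^ 3 = 1 / sqrt N"
        using N by (simp add: power3_eq_cube field_simps)
      then show ?thesis by (simp add: mult.assoc[symmetric])
    qed
    finally show ?thesis .
  qed
  have "V 1 0 \<le> V 0 1"
  proof (rule ennreal_le_epsilon)
    fix e :: real assume e: "0 < e"
    obtain N :: nat where N: "(K * B / e)\<^sup>2 < N" using reals_Archimedean2 by blast
    then have N0: "N > 0" using zero_le_power2[of "K * B / e"] by (cases "N = 0") auto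
    have "K * B / e \<le> sqrt N" using N by (intro real_le_rsqrt) simp
    then have "K * B / sqrt N \<le> e" using e N0 by (simp add: field_simps)
    then show "V 1 0 \<le> V 0 1 + ennreal e"
      using limit[OF N0] by (meson add_left_mono ennreal_leI order_trans)
  qed
  moreover have "V 1 0 = (\<integral>\<^sup>+\<omega>. F (X \<omega>) \<partial>gauss I)" "V 0 1 = (\<integral>\<^sup>+\<omega>. F (Y \<omega>) \<partial>gauss J)"
    unfolding V_def by (simp_all add: GI.emeasure_space_1 GJ.emeasure_space_1)
  ultimately show ?thesis unfolding F_def X_def Y_def by simp
qed

end

section \<open>Second moments of suprema of bilinear Gaussian forms\<close>

lemma le_of_le_add_inverse_nat:
  fixes x y C :: real
  assumes "\<And>n. (0::nat) < n \<Longrightarrow> x \<le> y + C / real n"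
  shows "x \<le> y"
proof (rule field_le_epsilon)
  fix e :: real assume e: "0 < e"
  obtain n :: nat where n: "\<bar>C\<bar> / e < n" using reals_Archimedean2 by blast
  moreover have "0 \<le> \<bar>C\<bar> / e" using e by simp
  ultimately have n0: "real n > 0" by linarith
  then have "C / real n \<le> e" using n e by (simp add: field_simps)
  then show "x \<le> y + e" using assms[of n] n0 by simp
qed

text \<open>
  The triangle inequality in \<open>L^2\<close>, from \<open>2 f g \<le> t f^2 + g^2 / t\<close> with the optimal \<open>t = b / a\<close>. To
  have a positive quotient, \<open>a\<close> and \<open>b\<close> are first increased by \<open>e / 2\<close>.
\<close>

lemma integral_square_add_le:
  fixes f g :: "'a \<Rightarrow> real"
  assumes f: "integrable M (\<lambda>x. (f x)\<^sup>2)" "(\<integral>x. (f x)\<^sup>2 \<partial>M) \<le> a\<^sup>2" "a \<ge> 0" "f \<in> borel_measurable M"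
    and g: "integrable M (\<lambda>x. (g x)\<^sup>2)" "(\<integral>x. (g x)\<^sup>2 \<partial>M) \<le> b\<^sup>2" "b \<ge> 0" "g \<in> borel_measurable M"
  shows "integrable M (\<lambda>x. (f x + g x)\<^sup>2)" and "(\<integral>x. (f x + g x)\<^sup>2 \<partial>M) \<le> (a + b)\<^sup>2"
proof -
  have amgm: "(f x + g x)\<^sup>2 \<le> (1 + t) * (f x)\<^sup>2 + (1 + 1 / t) * (g x)\<^sup>2" if "t > 0" for t x
  proof -
    have "2 * f x * g x \<le> t * (f x)\<^sup>2 + 1 / t * (g x)\<^sup>2"
    proof -
      have "0 \<le> (t * f x - g x)\<^sup>2 / t" using that by simp
      then show ?thesis using that by (simp add: power2_eq_square field_simps)
    qed
    then show ?thesis by (simp add: power2_sum algebra_simps)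
  qed
  have ib: "integrable M (\<lambda>x. (1 + t) * (f x)\<^sup>2 + (1 + 1 / t) * (g x)\<^sup>2)" for t
    by (intro Bochner_Integration.integrable_add integrable_mult_right f g)
  show int: "integrable M (\<lambda>x. (f x + g x)\<^sup>2)"
    by (rule Bochner_Integration.integrable_bound[OF ib[of 1]])
      (use amgm[of 1] f(4) g(4) in \<open>auto intro!: AE_I2 order_trans[OF _ abs_ge_self]\<close>)
  have I0: "(\<integral>x. (f x + g x)\<^sup>2 \<partial>M) \<ge> 0" by (intro integral_nonneg_AE) auto
  have "sqrt (\<integral>x. (f x + g x)\<^sup>2 \<partial>M) \<le> a + b"
  proof (rule field_le_epsilon)
    fix e :: real assume e: "0 < e"
    define a' where "a' = a + e / 2"
    define b' where "b' = b + e / 2"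
    have a': "a' > 0" "a\<^sup>2 \<le> a'\<^sup>2" and b': "b' > 0" "b\<^sup>2 \<le> b'\<^sup>2"
      unfolding a'_def b'_def using e f(3) g(3) by (auto intro: power_mono)
    have "(\<integral>x. (f x + g x)\<^sup>2 \<partial>M) \<le> (\<integral>x. (1 + b' / a') * (f x)\<^sup>2 + (1 + 1 / (b' / a')) * (g x)\<^sup>2 \<partial>M)"
      by (intro integral_mono int ib amgm) (use a' b' in simp)
    also have "\<dots> = (1 + b' / a') * (\<integral>x. (f x)\<^sup>2 \<partial>M) + (1 + 1 / (b' / a')) * (\<integral>x. (g x)\<^sup>2 \<partial>M)"
      by (subst Bochner_Integration.integral_add) (simp_all add: f g)
    also have "\<dots> \<le> (1 + b' / a') * a'\<^sup>2 + (1 + 1 / (b' / a')) * b'\<^sup>2"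
      using a' b' f g by (intro add_mono mult_left_mono) (auto intro: order_trans)
    also have "\<dots> = (a' + b')\<^sup>2"
      using a' b' by (simp add: power2_eq_square field_simps)
    finally have "sqrt (\<integral>x. (f x + g x)\<^sup>2 \<partial>M) \<le> a' + b'"
      using a' b' by (intro real_le_lsqrt) auto
    then show "sqrt (\<integral>x. (f x + g x)\<^sup>2 \<partial>M) \<le> a + b + e" unfolding a'_def b'_def by simp
  qed
  then show "(\<integral>x. (f x + g x)\<^sup>2 \<partial>M) \<le> (a + b)\<^sup>2"
    by (rule sqrt_le_D)
qed

definition unit_sphere :: "nat \<Rightarrow> (nat \<Rightarrow> real) set" where
  "unit_sphere n = {v. (\<Sum>i<n. (v i)\<^sup>2) = 1}"

lemma unit_sphere_abs_le_1:
  assumes "v \<in> unit_sphere n" "i < n"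
  shows "\<bar>v i\<bar> \<le> 1"
proof -
  have "(v i)\<^sup>2 \<le> (\<Sum>i<n. (v i)\<^sup>2)" by (rule member_le_sum) (use assms in auto)
  then show ?thesis using assms by (simp add: unit_sphere_def abs_square_le_1)
qed

text \<open>
  Round the coordinates down to multiples of \<open>1 / m\<close> and choose, for each of the finitely many
  values of the rounding map on the sphere, one unit vector with this value. Choosing unit vectors,
  and not the rounded ones, matters: the covariance comparison needs \<open>|v| = 1\<close>.
\<close>

lemma unit_sphere_net:
  assumes "m > (0::nat)"
  obtains N where "finite N" "N \<subseteq> unit_sphere n"
    and "\<And>v. v \<in> unit_sphere n \<Longrightarrow> \<exists>u\<in>N. \<forall>i<n. \<bar>v i - u i\<bar> \<le> 1 / m"
proof -
  define r where "r = (\<lambda>v::nat\<Rightarrow>real. \<lambda>i\<in>{..<n}. \<lfloor>m * v i\<rfloor>)"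
  define S where "S = unit_sphere n"
  have "r ` S \<subseteq> PiE {..<n} (\<lambda>_. {- int m..int m})"
  proof (rule image_subsetI)
    fix v assume v: "v \<in> S"
    have "\<lfloor>m * v i\<rfloor> \<in> {- int m..int m}" if "i < n" for i
    proof -
      have "\<bar>v i\<bar> \<le> 1" using unit_sphere_abs_le_1[of v n i] v that by (simp add: S_def)
      then have "real m * v i \<le> real m * 1" "real m * (- 1) \<le> real m * v i"
        by (intro mult_left_mono; simp)+
      then show ?thesis by (auto simp: le_floor_iff floor_le_iff)
    qed
    then show "r v \<in> PiE {..<n} (\<lambda>_. {- int m..int m})" unfolding r_def by auto
  qed
  then have fin: "finite (r ` S)" by (rule finite_subset) (intro finite_PiE; simp)
  define N where "N = inv_into S r ` (r ` S)"
  show ?thesis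
  proof (rule that[of N])
    show "finite N" unfolding N_def using fin by simp
    show "N \<subseteq> unit_sphere n" unfolding N_def S_def[symmetric] by (auto intro: inv_into_into)
    fix v assume "v \<in> unit_sphere n"
    then have v: "r v \<in> r ` S" unfolding S_def by simp
    define u where "u = inv_into S r (r v)"
    have ru: "r u = r v" unfolding u_def by (rule f_inv_into_f[OF v])
    have "\<bar>v i - u i\<bar> \<le> 1 / m" if "i < n" for i
    proof -
      have "\<lfloor>m * v i\<rfloor> = \<lfloor>m * u i\<rfloor>" using fun_cong[OF ru, of i] that unfolding r_def by simp
      then have "\<bar>m * v i - m * u i\<bar> \<le> 1" by linarith
      then have "m * \<bar>v i - u i\<bar> \<le> 1" by (simp add: right_diff_distrib[symmetric] abs_mult)
      then show ?thesis using assms by (simp add: field_simps)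
    qed
    moreover have "u \<in> N" unfolding N_def u_def using v by blast
    ultimately show "\<exists>u\<in>N. \<forall>i<n. \<bar>v i - u i\<bar> \<le> 1 / m" by blast
  qed
qed

lemma sum_times_le_norms:
  fixes x y :: "'a \<Rightarrow> real"
  shows "(\<Sum>i\<in>A. x i * y i) \<le> sqrt (\<Sum>i\<in>A. (x i)\<^sup>2) * sqrt (\<Sum>i\<in>A. (y i)\<^sup>2)"
  using real_le_rsqrt[OF Cauchy_Schwarz_ineq_sum[of x y A]] by (simp add: real_sqrt_mult)

text \<open>
  Chevet's inequality for a finite index set \<open>T\<close> of pairs \<open>(x, v)\<close>. Here \<open>W\<close> is any function below
  the positive part of the maximum of \<open><x, \<omega> v>\<close> over \<open>T\<close>, and \<open>U\<close> any bound for the comparison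
  process on all of \<open>T\<close>; in this form the maxima themselves do not occur. Both fields are multiplied by a
  large \<open>\<beta>\<close>, which makes the error \<open>ln (e + card T)\<close> of the soft maximum negligible.
\<close>

lemma finite_chevet:
  fixes T :: "((nat \<Rightarrow> real) \<times> (nat \<Rightarrow> real)) set" and p q :: nat
  defines "J \<equiv> {..<p} <+> {..<q}"
  assumes T: "finite T" and \<sigma>: "\<sigma> \<ge> 0"
    and Tx: "\<And>x v. (x, v) \<in> T \<Longrightarrow> (\<Sum>i<p. (x i)\<^sup>2) \<le> \<sigma>\<^sup>2"
    and Tv: "\<And>x v. (x, v) \<in> T \<Longrightarrow> v \<in> unit_sphere q"
    and W0: "\<And>\<omega>. W \<omega> \<ge> 0"
    and W: "\<And>\<omega>. W \<omega> = 0 \<or> (\<exists>(x, v)\<in>T. W \<omega> \<le> (\<Sum>i<p. \<Sum>j<q. x i * v j * \<omega> (i, j)))"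
    and U0: "\<And>\<omega>. U \<omega> \<ge> 0" and U_meas: "U \<in> borel_measurable (gauss J)"
    and U_int: "integrable (gauss J) (\<lambda>\<omega>. (U \<omega>)\<^sup>2)"
    and U: "\<And>x v \<omega>. (x, v) \<in> T \<Longrightarrow> (\<Sum>i<p. x i * \<omega> (Inl i)) + \<sigma> * (\<Sum>j<q. v j * \<omega> (Inr j)) \<le> U \<omega>"
  shows "(\<integral>\<^sup>+\<omega>. ennreal ((W \<omega>)\<^sup>2) \<partial>gauss ({..<p} \<times> {..<q})) \<le> ennreal (\<integral>\<omega>. (U \<omega>)\<^sup>2 \<partial>gauss J)"
proof -
  let ?I = "{..<p} \<times> {..<q}"
  interpret GJ: prob_space "gauss J" by (rule prob_space_gauss)
  have J: "finite J" unfolding J_def by simp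
  define c where "c = ln (exp 1 + real (card T))"
  have "ln (exp 1) \<le> c" unfolding c_def by (subst ln_le_cancel_iff) (auto intro: add_pos_nonneg)
  then have c0: "c \<ge> 0" by simp
  have U1: "integrable (gauss J) U"
  proof (rule Bochner_Integration.integrable_bound)
    show "integrable (gauss J) (\<lambda>\<omega>. 1 + (U \<omega>)\<^sup>2)"
      by (intro Bochner_Integration.integrable_add U_int GJ.integrable_const)
    have "U \<omega> \<le> 1 + (U \<omega>)\<^sup>2" for \<omega>
      using zero_le_power2[of "U \<omega> - 1"] U0[of \<omega>] by (simp add: power2_diff)
    then show "AE \<omega> in gauss J. norm (U \<omega>) \<le> norm (1 + (U \<omega>)\<^sup>2)"
      using U0 by (intro AE_I2) simp
  qed (rule U_meas)
  define C where "C = (\<integral>\<omega>. 2 * c * U \<omega> + c\<^sup>2 \<partial>gauss J)"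
  have iC: "integrable (gauss J) (\<lambda>\<omega>. 2 * c * U \<omega> + c\<^sup>2)"
    by (intro Bochner_Integration.integrable_add integrable_mult_right U1 GJ.integrable_const)
  have main: "(\<integral>\<^sup>+\<omega>. ennreal ((W \<omega>)\<^sup>2) \<partial>gauss ?I)
      \<le> ennreal (\<integral>\<omega>. (U \<omega>)\<^sup>2 \<partial>gauss J) + ennreal (C / n)" if n: "n > 0" for n :: nat
  proof -
    define \<beta> where "\<beta> = real n"
    have \<beta>: "\<beta> \<ge> 1" unfolding \<beta>_def using n by simp
    define a :: "(nat \<Rightarrow> real) \<times> (nat \<Rightarrow> real) \<Rightarrow> nat \<times> nat \<Rightarrow> real"
      where "a = (\<lambda>k ij. \<beta> * (fst k (fst ij) * snd k (snd ij)))"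
    define b :: "(nat \<Rightarrow> real) \<times> (nat \<Rightarrow> real) \<Rightarrow> nat + nat \<Rightarrow> real"
      where "b = (\<lambda>k. case_sum (\<lambda>i. \<beta> * fst k i) (\<lambda>j. \<beta> * \<sigma> * snd k j))"
    define ip where "ip = (\<lambda>(n::nat) (x::nat\<Rightarrow>real) y. \<Sum>i<n. x i * y i)"
    \<comment> \<open>Nonnegative by the Cauchy-Schwarz inequality; the second factor vanishes for \<open>k = l\<close> even when
        \<open>|x| < \<sigma>\<close>.\<close>
    define D where "D = (\<lambda>k l. \<beta>\<^sup>2 * ((\<sigma>\<^sup>2 - ip p (fst k) (fst l)) * (1 - ip q (snd k) (snd l))))"
    have covI: "(\<Sum>ij\<in>?I. a k ij * a l ij) = \<beta>\<^sup>2 * (ip p (fst k) (fst l) * ip q (snd k) (snd l))" for k l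
    proof -
      have "ip p (fst k) (fst l) * ip q (snd k) (snd l)
          = (\<Sum>ij\<in>?I. (fst k (fst ij) * fst l (fst ij)) * (snd k (snd ij) * snd l (snd ij)))"
        unfolding ip_def sum_product sum.cartesian_product by (intro sum.cong refl) auto
      then show ?thesis
        unfolding a_def by (simp add: sum_distrib_left power2_eq_square algebra_simps)
    qed
    have covJ: "(\<Sum>j\<in>J. b k j * b l j) = \<beta>\<^sup>2 * (ip p (fst k) (fst l) + \<sigma>\<^sup>2 * ip q (snd k) (snd l))" for k l
      unfolding J_def b_def ip_def
      by (subst sum.Plus) (auto simp: sum_distrib_left power2_eq_square algebra_simps intro!: arg_cong2[where f = "(+)"] sum.cong)
    have ipx: "ip p (fst k) (fst l) \<le> \<sigma>\<^sup>2" if "k \<in> T" "l \<in> T" for k l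
    proof -
      have "ip p (fst k) (fst l) \<le> sqrt (\<Sum>i<p. (fst k i)\<^sup>2) * sqrt (\<Sum>i<p. (fst l i)\<^sup>2)"
        unfolding ip_def by (rule sum_times_le_norms)
      also have "\<dots> \<le> sqrt (\<sigma>\<^sup>2) * sqrt (\<sigma>\<^sup>2)"
        using Tx[of "fst k" "snd k"] Tx[of "fst l" "snd l"] that
        by (intro mult_mono real_sqrt_le_mono) (auto intro: sum_nonneg)
      finally show ?thesis by (simp add: power2_eq_square)
    qed
    have ipv: "ip q (snd k) (snd l) \<le> 1" if "k \<in> T" "l \<in> T" for k l
    proof -
      have "ip q (snd k) (snd l) \<le> sqrt (\<Sum>i<q. (snd k i)\<^sup>2) * sqrt (\<Sum>i<q. (snd l i)\<^sup>2)"
        unfolding ip_def by (rule sum_times_le_norms)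
      then show ?thesis
        using Tv[of "fst k" "snd k"] Tv[of "fst l" "snd l"] that by (simp add: unit_sphere_def)
    qed
    have ipvv: "ip q (snd k) (snd k) = 1" if "k \<in> T" for k
      using Tv[of "fst k" "snd k"] that by (simp add: unit_sphere_def ip_def power2_eq_square)
    have comparison: "(\<integral>\<^sup>+\<omega>. ennreal ((softmax T (lin_field ?I a \<omega>))\<^sup>2) \<partial>gauss ?I)
      \<le> (\<integral>\<^sup>+\<omega>. ennreal ((softmax T (lin_field J b \<omega>))\<^sup>2) \<partial>gauss J)"
    proof (rule softmax_square_comparison[where D = D and \<tau> = "\<beta>\<^sup>2 * \<sigma>\<^sup>2"])
      show "finite T" "finite ?I" "finite J" by (use T J in auto)
      fix k l assume kl: "k \<in> T" "l \<in> T"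
      show "(\<Sum>i\<in>?I. a k i * a l i) - (\<Sum>j\<in>J. b k j * b l j) = D k l - \<beta>\<^sup>2 * \<sigma>\<^sup>2"
        unfolding covI covJ D_def by (simp add: algebra_simps)
      show "D k l \<ge> 0" unfolding D_def using ipx[OF kl] ipv[OF kl] by simp
    next
      fix k assume "k \<in> T"
      then show "D k k = 0" unfolding D_def by (simp add: ipvv)
    qed simp
    have lower: "W \<omega> \<le> softmax T (lin_field ?I a \<omega>) / \<beta>" for \<omega>
    proof (cases "W \<omega> = 0")
      case True then show ?thesis using \<beta> softmax_ge_1[of T "lin_field ?I a \<omega>"] by simp
    next
      case False
      then obtain x v where xv: "(x, v) \<in> T" "W \<omega> \<le> (\<Sum>i<p. \<Sum>j<q. x i * v j * \<omega> (i, j))"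
        using W[of \<omega>] by auto
      have eq: "lin_field ?I a \<omega> (x, v) = \<beta> * (\<Sum>i<p. \<Sum>j<q. x i * v j * \<omega> (i, j))"
        unfolding lin_field_def a_def sum_distrib_left sum.cartesian_product
        by (intro sum.cong refl) auto
      have "\<beta> * W \<omega> \<le> lin_field ?I a \<omega> (x, v)"
        unfolding eq using xv(2) \<beta> by (intro mult_left_mono) auto
      also have "\<dots> \<le> softmax T (lin_field ?I a \<omega>)"
        by (rule softmax_ge[OF T xv(1)])
      finally have "\<beta> * W \<omega> \<le> softmax T (lin_field ?I a \<omega>)" .
      then show ?thesis using \<beta> by (simp add: field_simps)
    qed
    have upper: "softmax T (lin_field J b \<omega>) / \<beta> \<le> U \<omega> + c / \<beta>" for \<omega>
    proof -
      have "softmax T (lin_field J b \<omega>) \<le> \<beta> * U \<omega> + ln (exp 1 + card T)"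
      proof (rule softmax_le[OF T])
        show "0 \<le> \<beta> * U \<omega>" using \<beta> U0 by simp
        fix k assume k: "k \<in> T"
        have "lin_field J b \<omega> k = \<beta> * ((\<Sum>i<p. fst k i * \<omega> (Inl i)) + \<sigma> * (\<Sum>j<q. snd k j * \<omega> (Inr j)))"
          unfolding lin_field_def J_def b_def
          by (subst sum.Plus) (auto simp: sum_distrib_left algebra_simps)
        also have "\<dots> \<le> \<beta> * U \<omega>"
          using \<beta> U[of "fst k" "snd k" \<omega>] k by (intro mult_left_mono) auto
        finally show "lin_field J b \<omega> k \<le> \<beta> * U \<omega>" .
      qed
      then show ?thesis using \<beta> unfolding c_def by (simp add: field_simps)
    qed
    have sq_upper: "(softmax T (lin_field J b \<omega>) / \<beta>)\<^sup>2 \<le> (U \<omega>)\<^sup>2 + (2 * c * U \<omega> + c\<^sup>2) / n" for \<omega>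
    proof -
      have "(softmax T (lin_field J b \<omega>) / \<beta>)\<^sup>2 \<le> (U \<omega> + c / \<beta>)\<^sup>2"
        using upper \<beta> softmax_ge_1[of T "lin_field J b \<omega>"] by (intro power_mono) auto
      also have "\<dots> = (U \<omega>)\<^sup>2 + (2 * c * U \<omega> + c\<^sup>2 / \<beta>) / \<beta>"
        using \<beta> by (simp add: power2_eq_square field_simps)
      also have "\<dots> \<le> (U \<omega>)\<^sup>2 + (2 * c * U \<omega> + c\<^sup>2) / \<beta>"
        using \<beta> by (intro add_left_mono divide_right_mono) (auto simp: divide_le_eq mult_le_cancel_left1)
      finally show ?thesis unfolding \<beta>_def .
    qed
    have resc: "ennreal ((softmax T s / \<beta>)\<^sup>2) = ennreal (1 / \<beta>\<^sup>2) * ennreal ((softmax T s)\<^sup>2)" for s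
      by (subst ennreal_mult[symmetric]) (auto simp: power_divide)
    have "(\<integral>\<^sup>+\<omega>. ennreal ((W \<omega>)\<^sup>2) \<partial>gauss ?I)
        \<le> (\<integral>\<^sup>+\<omega>. ennreal ((softmax T (lin_field ?I a \<omega>) / \<beta>)\<^sup>2) \<partial>gauss ?I)"
      by (intro nn_integral_mono ennreal_leI power_mono lower W0)
    also have "\<dots> = ennreal (1 / \<beta>\<^sup>2) * (\<integral>\<^sup>+\<omega>. ennreal ((softmax T (lin_field ?I a \<omega>))\<^sup>2) \<partial>gauss ?I)"
      unfolding resc by (rule nn_integral_cmult) measurable
    also have "\<dots> \<le> ennreal (1 / \<beta>\<^sup>2) * (\<integral>\<^sup>+\<omega>. ennreal ((softmax T (lin_field J b \<omega>))\<^sup>2) \<partial>gauss J)"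
      by (intro mult_left_mono comparison) simp
    also have "\<dots> = (\<integral>\<^sup>+\<omega>. ennreal ((softmax T (lin_field J b \<omega>) / \<beta>)\<^sup>2) \<partial>gauss J)"
      unfolding resc by (rule nn_integral_cmult[symmetric]) measurable
    also have "\<dots> \<le> (\<integral>\<^sup>+\<omega>. ennreal ((U \<omega>)\<^sup>2 + (2 * c * U \<omega> + c\<^sup>2) / n) \<partial>gauss J)"
      by (intro nn_integral_mono ennreal_leI sq_upper)
    also have "\<dots> = ennreal (\<integral>\<omega>. (U \<omega>)\<^sup>2 + (2 * c * U \<omega> + c\<^sup>2) / n \<partial>gauss J)"
      using U0 c0
      by (intro nn_integral_eq_integral AE_I2 Bochner_Integration.integrable_add U_int integrable_divide iC) simp
    also have "(\<integral>\<omega>. (U \<omega>)\<^sup>2 + (2 * c * U \<omega> + c\<^sup>2) / n \<partial>gauss J) = (\<integral>\<omega>. (U \<omega>)\<^sup>2 \<partial>gauss J) + C / n"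
      unfolding C_def
      by (subst Bochner_Integration.integral_add[OF U_int integrable_divide[OF iC]]) simp
    also have "ennreal \<dots> = ennreal (\<integral>\<omega>. (U \<omega>)\<^sup>2 \<partial>gauss J) + ennreal (C / n)"
      unfolding C_def using U0 c0
      by (intro ennreal_plus integral_nonneg_AE AE_I2 divide_nonneg_nonneg) auto
    finally show ?thesis .
  qed
  show ?thesis
  proof (rule ennreal_le_epsilon)
    fix e :: real assume e: "0 < e"
    obtain n :: nat where n: "\<bar>C\<bar> / e < n" using reals_Archimedean2 by blast
    moreover have "0 \<le> \<bar>C\<bar> / e" using e by simp
    ultimately have n0: "real n > 0" by linarith
    then have "C / n \<le> e" using n e by (simp add: field_simps)
    then show "(\<integral>\<^sup>+\<omega>. ennreal ((W \<omega>)\<^sup>2) \<partial>gauss ?I) \<le> ennreal (\<integral>\<omega>. (U \<omega>)\<^sup>2 \<partial>gauss J) + ennreal e"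
      using main[of n] n0 by (meson add_left_mono ennreal_leI of_nat_0_less_iff order_trans)
  qed
qed


text \<open>
  Passing from nets to the sphere costs at most \<open>2 R / m\<close>, where \<open>R\<close> is a multiple of the sum of the
  absolute values of the entries. The comparison process is bounded by
  \<open>|B^T g| + \<sigma> |h|\<close>, whose summands have the second moments \<open>|B|_F^2\<close> and \<open>\<sigma>^2 q\<close>. The function
  \<open>S\<close> stands for the supremum over pairs of unit vectors, in a form that is independent of the way in
  which its measurability is established.
\<close>

lemma chevet_second_moment:
  fixes B :: "nat \<Rightarrow> nat \<Rightarrow> real" and p q r :: nat and S :: "(nat \<times> nat \<Rightarrow> real) \<Rightarrow> real"
  defines "I \<equiv> {..<p} \<times> {..<q}"
  assumes \<sigma>: "\<sigma> \<ge> 0"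
    and B: "\<And>w. w \<in> unit_sphere r \<Longrightarrow> (\<Sum>i<p. (\<Sum>k<r. B i k * w k)\<^sup>2) \<le> \<sigma>\<^sup>2"
    and S_meas: "S \<in> borel_measurable (gauss I)" and S0: "\<And>\<omega>. S \<omega> \<ge> 0"
    and S: "\<And>\<omega>. \<exists>w\<in>unit_sphere r. \<exists>v\<in>unit_sphere q.
      S \<omega> \<le> (\<Sum>i<p. \<Sum>j<q. (\<Sum>k<r. B i k * w k) * v j * \<omega> (i, j))"
  shows "integrable (gauss I) (\<lambda>\<omega>. (S \<omega>)\<^sup>2)"
    and "(\<integral>\<omega>. (S \<omega>)\<^sup>2 \<partial>gauss I) \<le> (sqrt (\<Sum>i<p. \<Sum>k<r. (B i k)\<^sup>2) + \<sigma> * sqrt q)\<^sup>2"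
proof -
  have I: "finite I" unfolding I_def by simp
  define x where "x = (\<lambda>w i. \<Sum>k<r. B i k * w k)"
  define f where "f = (\<lambda>w v \<omega>. \<Sum>i<p. \<Sum>j<q. x w i * v j * \<omega> (i, j))"
  define C where "C = (\<Sum>i<p. \<Sum>k<r. \<bar>B i k\<bar>)"
  define R where "R = (\<lambda>\<omega>. C * (\<Sum>ij\<in>I. \<bar>\<omega> ij\<bar>))"
  have C0: "C \<ge> 0" unfolding C_def by (intro sum_nonneg) auto
  have R0: "R \<omega> \<ge> 0" for \<omega> unfolding R_def by (intro mult_nonneg_nonneg C0 sum_nonneg) auto
  have R_sum: "R \<omega> = (\<Sum>i<p. \<Sum>j<q. C * \<bar>\<omega> (i, j)\<bar>)" for \<omega>
    unfolding R_def I_def sum.cartesian_product sum_distrib_left by (intro sum.cong refl) auto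
  have row: "(\<Sum>k<r. \<bar>B i k\<bar>) \<le> C" if "i < p" for i
    unfolding C_def by (rule member_le_sum) (use that in \<open>auto intro: sum_nonneg\<close>)
  have x_le: "\<bar>x w i\<bar> \<le> C * d" if "i < p" "\<And>k. k < r \<Longrightarrow> \<bar>w k\<bar> \<le> d" "d \<ge> 0" for w d i
  proof -
    have "\<bar>x w i\<bar> \<le> (\<Sum>k<r. \<bar>B i k\<bar> * \<bar>w k\<bar>)"
      unfolding x_def abs_mult[symmetric] by (rule sum_abs)
    also have "\<dots> \<le> (\<Sum>k<r. \<bar>B i k\<bar> * d)" by (intro sum_mono mult_left_mono) (use that in auto)
    also have "\<dots> \<le> C * d" unfolding sum_distrib_right[symmetric] by (intro mult_right_mono row that)
    finally show ?thesis .
  qed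
  have x_diff: "x w i - x w' i = x (\<lambda>k. w k - w' k) i" for w w' i
    unfolding x_def sum_subtractf[symmetric] by (simp add: algebra_simps)
  have f_le: "f w v \<omega> \<le> R \<omega>" if w: "w \<in> unit_sphere r" and v: "v \<in> unit_sphere q" for w v \<omega>
    unfolding f_def R_sum
  proof (intro sum_mono)
    fix i j assume ij: "i \<in> {..<p}" "j \<in> {..<q}"
    have "\<bar>x w i\<bar> * \<bar>v j\<bar> \<le> (C * 1) * 1"
      by (intro mult_mono x_le unit_sphere_abs_le_1[OF w] unit_sphere_abs_le_1[OF v])
        (use ij C0 in auto)
    then have "\<bar>x w i * v j * \<omega> (i, j)\<bar> \<le> C * \<bar>\<omega> (i, j)\<bar>"
      unfolding abs_mult by (intro mult_right_mono) auto
    then show "x w i * v j * \<omega> (i, j) \<le> C * \<bar>\<omega> (i, j)\<bar>" by linarith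
  qed
  have f_near: "f w v \<omega> - f w' v' \<omega> \<le> 2 * d * R \<omega>"
    if w: "w \<in> unit_sphere r" "w' \<in> unit_sphere r" and v: "v \<in> unit_sphere q"
      and dw: "\<forall>k<r. \<bar>w k - w' k\<bar> \<le> d" and dv: "\<forall>j<q. \<bar>v j - v' j\<bar> \<le> d" and d: "d \<ge> 0"
    for w w' v v' d \<omega>
  proof -
    have "f w v \<omega> - f w' v' \<omega> = (\<Sum>i<p. \<Sum>j<q. (x w i * v j - x w' i * v' j) * \<omega> (i, j))"
      unfolding f_def sum_subtractf[symmetric] by (simp add: algebra_simps)
    also have "\<dots> \<le> (\<Sum>i<p. \<Sum>j<q. (2 * d) * (C * \<bar>\<omega> (i, j)\<bar>))"
    proof (intro sum_mono)
      fix i j assume ij: "i \<in> {..<p}" "j \<in> {..<q}"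
      have "\<bar>x w i * v j - x w' i * v' j\<bar>
          \<le> \<bar>x (\<lambda>k. w k - w' k) i\<bar> * \<bar>v j\<bar> + \<bar>x w' i\<bar> * \<bar>v j - v' j\<bar>"
        unfolding x_diff[symmetric] abs_mult[symmetric]
        by (rule order_trans[OF _ abs_triangle_ineq]) (simp add: algebra_simps)
      also have "\<dots> \<le> (C * d) * 1 + (C * 1) * d"
        by (intro add_mono mult_mono x_le unit_sphere_abs_le_1[OF w(2)] unit_sphere_abs_le_1[OF v])
          (use ij C0 dw dv d in auto)
      finally have "\<bar>x w i * v j - x w' i * v' j\<bar> \<le> 2 * d * C" by (simp add: ac_simps)
      then have "\<bar>(x w i * v j - x w' i * v' j) * \<omega> (i, j)\<bar> \<le> (2 * d * C) * \<bar>\<omega> (i, j)\<bar>"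
        unfolding abs_mult by (intro mult_right_mono) auto
      then show "(x w i * v j - x w' i * v' j) * \<omega> (i, j) \<le> (2 * d) * (C * \<bar>\<omega> (i, j)\<bar>)"
        by (simp add: mult.assoc)
    qed
    also have "\<dots> = 2 * d * R \<omega>" unfolding R_sum sum_distrib_left ..
    finally show ?thesis .
  qed
  have SR: "S \<omega> \<le> R \<omega>" for \<omega>
    using S[of \<omega>] f_le unfolding f_def x_def by (meson order_trans)
  have iR: "integrable (gauss I) (\<lambda>\<omega>. (R \<omega>)\<^sup>2)"
    unfolding R_def power_mult_distrib by (intro integrable_mult_right gauss_norm1_power_integrable I)
  have dominated: "integrable (gauss I) (\<lambda>\<omega>. (g \<omega>)\<^sup>2)"
    if "g \<in> borel_measurable (gauss I)" "\<And>\<omega>. 0 \<le> g \<omega>" "\<And>\<omega>. g \<omega> \<le> R \<omega>" for g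
  proof (rule Bochner_Integration.integrable_bound[OF iR])
    show "AE \<omega> in gauss I. norm ((g \<omega>)\<^sup>2) \<le> norm ((R \<omega>)\<^sup>2)"
      using that by (intro AE_I2) (simp add: power_mono)
    show "(\<lambda>\<omega>. (g \<omega>)\<^sup>2) \<in> borel_measurable (gauss I)"
      using that(1) by (rule borel_measurable_power)
  qed
  show iS: "integrable (gauss I) (\<lambda>\<omega>. (S \<omega>)\<^sup>2)"
    by (rule dominated[OF S_meas S0 SR])

  define J where "J = {..<p} <+> {..<q}"
  have J: "finite J" unfolding J_def by simp
  interpret GJ: prob_space "gauss J" by (rule prob_space_gauss)
  define bt where "bt = (\<lambda>k. case_sum (\<lambda>i. B i k) (\<lambda>j::nat. 0::real))"
  define U1 where "U1 = (\<lambda>\<omega>. sqrt (\<Sum>k<r. (lin_field J bt \<omega> k)\<^sup>2))"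
  define U2 where "U2 = (\<lambda>\<omega>::nat+nat\<Rightarrow>real. \<sigma> * sqrt (\<Sum>j<q. (\<omega> (Inr j))\<^sup>2))"
  have bt: "lin_field J bt \<omega> k = (\<Sum>i<p. B i k * \<omega> (Inl i))" for \<omega> k
    unfolding lin_field_def J_def bt_def by (subst sum.Plus) auto
  have U1sq: "(U1 \<omega>)\<^sup>2 = (\<Sum>k<r. lin_field J bt \<omega> k * lin_field J bt \<omega> k)" for \<omega>
    unfolding U1_def by (subst real_sqrt_pow2) (auto simp: power2_eq_square intro: sum_nonneg)
  have U2sq: "(U2 \<omega>)\<^sup>2 = \<sigma>\<^sup>2 * (\<Sum>j<q. \<omega> (Inr j) * \<omega> (Inr j))" for \<omega>
    unfolding U2_def power_mult_distrib
    by (subst real_sqrt_pow2) (auto simp: power2_eq_square intro: sum_nonneg)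
  have Jr: "Inr j \<in> J" if "j < q" for j unfolding J_def using that by auto
  have U1_int: "integrable (gauss J) (\<lambda>\<omega>. (U1 \<omega>)\<^sup>2)"
    unfolding U1sq by (intro Bochner_Integration.integrable_sum lin_field_integral J)
  have U2_int: "integrable (gauss J) (\<lambda>\<omega>. (U2 \<omega>)\<^sup>2)"
    unfolding U2sq
    by (intro integrable_mult_right Bochner_Integration.integrable_sum gauss_integral_second J Jr) auto
  have U1_eq: "(\<integral>\<omega>. (U1 \<omega>)\<^sup>2 \<partial>gauss J) = (\<Sum>i<p. \<Sum>k<r. (B i k)\<^sup>2)"
  proof -
    have "(\<integral>\<omega>. (U1 \<omega>)\<^sup>2 \<partial>gauss J) = (\<Sum>k<r. \<integral>\<omega>. lin_field J bt \<omega> k * lin_field J bt \<omega> k \<partial>gauss J)"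
      unfolding U1sq by (intro Bochner_Integration.integral_sum lin_field_integral J)
    also have "\<dots> = (\<Sum>k<r. \<Sum>j\<in>J. bt k j * bt k j)"
      unfolding lin_field_integral(4)[OF J] ..
    also have "\<dots> = (\<Sum>k<r. \<Sum>i<p. (B i k)\<^sup>2)"
      unfolding J_def bt_def by (intro sum.cong refl, subst sum.Plus) (auto simp: power2_eq_square)
    also have "\<dots> = (\<Sum>i<p. \<Sum>k<r. (B i k)\<^sup>2)" by (rule sum.swap)
    finally show ?thesis .
  qed
  have U2_eq: "(\<integral>\<omega>. (U2 \<omega>)\<^sup>2 \<partial>gauss J) = \<sigma>\<^sup>2 * q"
  proof -
    have "(\<integral>\<omega>. (U2 \<omega>)\<^sup>2 \<partial>gauss J) = \<sigma>\<^sup>2 * (\<Sum>j<q. \<integral>\<omega>. \<omega> (Inr j) * \<omega> (Inr j) \<partial>gauss J)"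
      unfolding U2sq integral_mult_right_zero
      by (subst Bochner_Integration.integral_sum)
        (auto intro!: gauss_integral_second J Jr)
    also have "(\<Sum>j<q. \<integral>\<omega>. \<omega> (Inr j) * \<omega> (Inr j) \<partial>gauss J) = (\<Sum>j<q. 1)"
      by (intro sum.cong refl, subst gauss_integral_second(2)[OF J Jr Jr]) auto
    finally show ?thesis by simp
  qed
  have U1_meas: "U1 \<in> borel_measurable (gauss J)" unfolding U1_def by measurable
  have U2_meas: "U2 \<in> borel_measurable (gauss J)"
  proof -
    have [measurable]: "(\<lambda>\<omega>. \<Sum>j<q. (\<omega> (Inr j))\<^sup>2) \<in> borel_measurable (gauss J)"
      by (intro borel_measurable_sum borel_measurable_power measurable_gauss_component Jr) simp
    show ?thesis unfolding U2_def by measurable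
  qed
  define F where "F = (\<Sum>i<p. \<Sum>k<r. (B i k)\<^sup>2)"
  have F0: "F \<ge> 0" unfolding F_def by (intro sum_nonneg) auto
  have iU: "integrable (gauss J) (\<lambda>\<omega>. (U1 \<omega> + U2 \<omega>)\<^sup>2)"
    and EU: "(\<integral>\<omega>. (U1 \<omega> + U2 \<omega>)\<^sup>2 \<partial>gauss J) \<le> (sqrt F + \<sigma> * sqrt q)\<^sup>2"
    using integral_square_add_le[OF U1_int _ _ U1_meas U2_int _ _ U2_meas, of "sqrt F" "\<sigma> * sqrt q"]
      F0 \<sigma> unfolding U1_eq U2_eq F_def[symmetric] by (simp_all add: power_mult_distrib)
  have Ubound: "(\<Sum>i<p. x w i * \<omega> (Inl i)) + \<sigma> * (\<Sum>j<q. v j * \<omega> (Inr j)) \<le> U1 \<omega> + U2 \<omega>"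
    if w: "w \<in> unit_sphere r" and v: "v \<in> unit_sphere q" for w v \<omega>
  proof -
    have "(\<Sum>i<p. x w i * \<omega> (Inl i)) = (\<Sum>i<p. \<Sum>k<r. w k * (B i k * \<omega> (Inl i)))"
      unfolding x_def sum_distrib_right by (simp add: algebra_simps)
    also have "\<dots> = (\<Sum>k<r. w k * lin_field J bt \<omega> k)"
      unfolding bt sum_distrib_left by (rule sum.swap)
    also have "\<dots> \<le> sqrt (\<Sum>k<r. (w k)\<^sup>2) * sqrt (\<Sum>k<r. (lin_field J bt \<omega> k)\<^sup>2)"
      by (rule sum_times_le_norms)
    finally have 1: "(\<Sum>i<p. x w i * \<omega> (Inl i)) \<le> U1 \<omega>"
      using w by (simp add: U1_def unit_sphere_def)
    have "(\<Sum>j<q. v j * \<omega> (Inr j)) \<le> sqrt (\<Sum>j<q. (v j)\<^sup>2) * sqrt (\<Sum>j<q. (\<omega> (Inr j))\<^sup>2)"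
      by (rule sum_times_le_norms)
    then have "(\<Sum>j<q. v j * \<omega> (Inr j)) \<le> sqrt (\<Sum>j<q. (\<omega> (Inr j))\<^sup>2)"
      using v by (simp add: unit_sphere_def)
    then have "\<sigma> * (\<Sum>j<q. v j * \<omega> (Inr j)) \<le> U2 \<omega>"
      unfolding U2_def using \<sigma> by (rule mult_left_mono)
    with 1 show ?thesis by simp
  qed
  have "(\<integral>\<omega>. (S \<omega>)\<^sup>2 \<partial>gauss I) \<le> (sqrt F + \<sigma> * sqrt q)\<^sup>2 + (4 * (\<integral>\<omega>. (R \<omega>)\<^sup>2 \<partial>gauss I)) / m"
    if m: "0 < (m::nat)" for m
  proof -
    define d where "d = 1 / real m"
    have d0: "d \<ge> 0" unfolding d_def by simp
    obtain N1 where N1: "finite N1" "N1 \<subseteq> unit_sphere r"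
      and N1': "\<And>w. w \<in> unit_sphere r \<Longrightarrow> \<exists>u\<in>N1. \<forall>k<r. \<bar>w k - u k\<bar> \<le> 1 / m"
      using unit_sphere_net[OF m, of r] by blast
    obtain N2 where N2: "finite N2" "N2 \<subseteq> unit_sphere q"
      and N2': "\<And>v. v \<in> unit_sphere q \<Longrightarrow> \<exists>u\<in>N2. \<forall>j<q. \<bar>v j - u j\<bar> \<le> 1 / m"
      using unit_sphere_net[OF m, of q] by blast
    define T where "T = (\<lambda>(w, v). (x w, v)) ` (N1 \<times> N2)"
    define W where "W = (\<lambda>\<omega>. max 0 (S \<omega> - 2 * d * R \<omega>))"
    have W0: "W \<omega> \<ge> 0" for \<omega> unfolding W_def by simp
    have "(\<integral>\<^sup>+\<omega>. ennreal ((W \<omega>)\<^sup>2) \<partial>gauss I) \<le> ennreal (\<integral>\<omega>. (U1 \<omega> + U2 \<omega>)\<^sup>2 \<partial>gauss J)"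
      unfolding I_def J_def
    proof (rule finite_chevet)
      show "finite T" unfolding T_def using N1 N2 by simp
      show "(\<Sum>i<p. (y i)\<^sup>2) \<le> \<sigma>\<^sup>2" if "(y, v) \<in> T" for y v
        using that B N1 unfolding T_def x_def by auto
      show "v \<in> unit_sphere q" if "(y, v) \<in> T" for y v
        using that N2 unfolding T_def by auto
      show "W \<omega> = 0 \<or> (\<exists>(y, v)\<in>T. W \<omega> \<le> (\<Sum>i<p. \<Sum>j<q. y i * v j * \<omega> (i, j)))" for \<omega>
      proof (cases "S \<omega> - 2 * d * R \<omega> \<le> 0")
        case True then show ?thesis unfolding W_def by simp
      next
        case False
        obtain w v where w: "w \<in> unit_sphere r" and v: "v \<in> unit_sphere q" and "S \<omega> \<le> f w v \<omega>"
          using S[of \<omega>] unfolding f_def x_def by blast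
        moreover obtain w' v' where w': "w' \<in> N1" "\<forall>k<r. \<bar>w k - w' k\<bar> \<le> d"
          and v': "v' \<in> N2" "\<forall>j<q. \<bar>v j - v' j\<bar> \<le> d"
          using N1'[OF w] N2'[OF v] unfolding d_def by blast
        moreover have "f w v \<omega> - f w' v' \<omega> \<le> 2 * d * R \<omega>"
          by (rule f_near[OF w _ v w'(2) v'(2) d0]) (use w'(1) N1 in auto)
        ultimately have "W \<omega> \<le> f w' v' \<omega>" using False unfolding W_def by simp
        moreover have "(x w', v') \<in> T" unfolding T_def using w' v' by auto
        ultimately show ?thesis unfolding f_def by auto
      qed
      show "0 \<le> U1 \<omega> + U2 \<omega>" for \<omega>
        unfolding U1_def U2_def using \<sigma> by (auto intro!: add_nonneg_nonneg mult_nonneg_nonneg sum_nonneg)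
      show "(\<lambda>\<omega>. U1 \<omega> + U2 \<omega>) \<in> borel_measurable (gauss ({..<p} <+> {..<q}))"
        using U1_meas U2_meas unfolding J_def by (rule borel_measurable_add)
      show "integrable (gauss ({..<p} <+> {..<q})) (\<lambda>\<omega>. (U1 \<omega> + U2 \<omega>)\<^sup>2)"
        using iU unfolding J_def .
      show "(\<Sum>i<p. y i * \<omega> (Inl i)) + \<sigma> * (\<Sum>j<q. v j * \<omega> (Inr j)) \<le> U1 \<omega> + U2 \<omega>"
        if yv: "(y, v) \<in> T" for y v \<omega>
      proof -
        obtain w where "y = x w" "w \<in> unit_sphere r" "v \<in> unit_sphere q"
          using yv N1 N2 unfolding T_def by auto
        then show ?thesis using Ubound by simp
      qed
    qed (use \<sigma> W0 in auto)
    also have "\<dots> \<le> ennreal ((sqrt F + \<sigma> * sqrt q)\<^sup>2)" by (rule ennreal_leI[OF EU])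
    finally have nnW: "(\<integral>\<^sup>+\<omega>. ennreal ((W \<omega>)\<^sup>2) \<partial>gauss I) \<le> ennreal ((sqrt F + \<sigma> * sqrt q)\<^sup>2)" .
    have R_meas: "R \<in> borel_measurable (gauss I)" unfolding R_def by measurable
    have iW: "integrable (gauss I) (\<lambda>\<omega>. (W \<omega>)\<^sup>2)"
    proof (rule dominated)
      show "W \<in> borel_measurable (gauss I)"
        unfolding W_def using S_meas R_meas
        by (intro borel_measurable_max borel_measurable_diff borel_measurable_times borel_measurable_const)
      show "W \<omega> \<le> R \<omega>" for \<omega>
        unfolding W_def using SR[of \<omega>] R0[of \<omega>] mult_nonneg_nonneg[OF d0 R0[of \<omega>]] by simp
    qed (rule W0)
    have "(\<integral>\<^sup>+\<omega>. ennreal ((W \<omega>)\<^sup>2) \<partial>gauss I) = ennreal (\<integral>\<omega>. (W \<omega>)\<^sup>2 \<partial>gauss I)"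
      by (intro nn_integral_eq_integral iW AE_I2) simp
    then have EW: "(\<integral>\<omega>. (W \<omega>)\<^sup>2 \<partial>gauss I) \<le> (sqrt F + \<sigma> * sqrt q)\<^sup>2"
      using nnW by simp
    have pt: "(S \<omega>)\<^sup>2 \<le> (W \<omega>)\<^sup>2 + 4 * d * (R \<omega>)\<^sup>2" for \<omega>
    proof -
      define z where "z = 2 * d * R \<omega>"
      have z0: "z \<ge> 0" unfolding z_def using d0 R0 by simp
      have zS: "z * S \<omega> \<le> z * R \<omega>" using z0 SR by (intro mult_left_mono)
      have zR: "z * R \<omega> \<ge> 0" using z0 R0 by simp
      have "(S \<omega>)\<^sup>2 \<le> (W \<omega>)\<^sup>2 + 2 * (z * R \<omega>)"
      proof (cases "S \<omega> \<le> z")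
        case True
        then have "S \<omega> * S \<omega> \<le> z * S \<omega>" using S0 by (intro mult_right_mono)
        then show ?thesis
          unfolding power2_eq_square using zS zR zero_le_square[of "W \<omega>"] by linarith
      next
        case False
        then have "(W \<omega>)\<^sup>2 = (S \<omega> - z)\<^sup>2" unfolding W_def z_def by simp
        also have "\<dots> \<ge> (S \<omega>)\<^sup>2 - 2 * (z * S \<omega>)"
          by (simp add: power2_diff)
        finally show ?thesis using zS by linarith
      qed
      then show ?thesis unfolding z_def by (simp add: power2_eq_square algebra_simps)
    qed
    have "(\<integral>\<omega>. (S \<omega>)\<^sup>2 \<partial>gauss I) \<le> (\<integral>\<omega>. (W \<omega>)\<^sup>2 + 4 * d * (R \<omega>)\<^sup>2 \<partial>gauss I)"
      by (intro integral_mono iS Bochner_Integration.integrable_add iW integrable_mult_right iR pt)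
    also have "\<dots> = (\<integral>\<omega>. (W \<omega>)\<^sup>2 \<partial>gauss I) + 4 * d * (\<integral>\<omega>. (R \<omega>)\<^sup>2 \<partial>gauss I)"
      by (subst Bochner_Integration.integral_add[OF iW integrable_mult_right[OF iR]]) simp
    finally show ?thesis using EW unfolding d_def by simp
  qed
  then show "(\<integral>\<omega>. (S \<omega>)\<^sup>2 \<partial>gauss I) \<le> (sqrt (\<Sum>i<p. \<Sum>k<r. (B i k)\<^sup>2) + \<sigma> * sqrt q)\<^sup>2"
    unfolding F_def by (rule le_of_le_add_inverse_nat)
qed

section \<open>The largest singular value as a maximum over unit vectors\<close>

lemma continuous_on_coordinate: "continuous_on S (\<lambda>v::nat \<Rightarrow> real. v i)"
  by (rule continuous_on_subset[OF continuous_on_product_coordinates]) simp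

text \<open>
  Vectors are functions on all natural numbers; vanishing outside the first \<open>n\<close> coordinates makes the
  sphere compact in the product topology.
\<close>

lemma compact_supported_sphere:
  "compact {v \<in> unit_sphere n. \<forall>i\<ge>n. v i = 0}"
proof -
  define C where "C = (\<lambda>i::nat. if i < n then {-1..1} else {0::real})"
  have "compact (PiE UNIV C)"
    using compactin_PiE[of "\<lambda>_. euclidean" UNIV C]
    unfolding euclidean_product_topology compactin_euclidean_iff by (auto simp: C_def)
  moreover have "closed (unit_sphere n)"
    unfolding unit_sphere_def
    by (intro closed_Collect_eq continuous_on_sum continuous_on_power continuous_on_const
        continuous_on_coordinate)
  ultimately have "compact (PiE UNIV C \<inter> unit_sphere n)" by (rule compact_Int_closed)
  moreover have "PiE UNIV C \<inter> unit_sphere n = {v \<in> unit_sphere n. \<forall>i\<ge>n. v i = 0}"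
  proof (intro equalityI subsetI)
    fix v assume v: "v \<in> PiE UNIV C \<inter> unit_sphere n"
    then have "v i \<in> C i" for i by auto
    then have "v i = 0" if "i \<ge> n" for i using that unfolding C_def by (metis not_le singletonD)
    with v show "v \<in> {v \<in> unit_sphere n. \<forall>i\<ge>n. v i = 0}" by auto
  next
    fix v assume v: "v \<in> {v \<in> unit_sphere n. \<forall>i\<ge>n. v i = 0}"
    then have "v i \<in> C i" for i
      using unit_sphere_abs_le_1[of v n i] unfolding C_def by (auto simp: abs_le_iff)
    with v show "v \<in> PiE UNIV C \<inter> unit_sphere n" by auto
  qed
  ultimately show ?thesis by simp
qed

text \<open>
  Only the number of columns is a parameter, since the rows are selected by the argument \<open>i\<close>.
\<close>

definition mat_apply :: "(nat \<times> nat \<Rightarrow> real) \<Rightarrow> nat \<Rightarrow> (nat \<Rightarrow> real) \<Rightarrow> nat \<Rightarrow> real" where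
  "mat_apply M q v i = (\<Sum>j<q. M (i, j) * v j)"

context
  fixes M :: "nat \<times> nat \<Rightarrow> real" and p q :: nat
  assumes q: "1 \<le> q"
begin

lemma mat_apply_add_scaled: "mat_apply M q (\<lambda>j. v j + t * u j) i = mat_apply M q v i + t * mat_apply M q u i"
  unfolding mat_apply_def by (simp add: sum.distrib sum_distrib_left algebra_simps)

lemma rayleigh_maximizer:
  obtains v0 where "v0 \<in> unit_sphere q"
    and "\<And>v. (\<Sum>i<p. (mat_apply M q v i)\<^sup>2) \<le> (\<Sum>i<p. (mat_apply M q v0 i)\<^sup>2) * (\<Sum>j<q. (v j)\<^sup>2)"
proof -
  define f where "f = (\<lambda>v. \<Sum>i<p. (mat_apply M q v i)\<^sup>2)"
  let ?K = "{v \<in> unit_sphere q. \<forall>i\<ge>q. v i = 0}"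
  have "(\<lambda>j. if j = 0 then 1 else 0) \<in> ?K"
    using q by (auto simp: unit_sphere_def if_distrib[of "\<lambda>x. x\<^sup>2"] cong: if_cong)
  then have ne: "?K \<noteq> {}" by blast
  have "continuous_on ?K f"
    unfolding f_def mat_apply_def
    by (intro continuous_on_sum continuous_on_power continuous_on_mult continuous_on_const
        continuous_on_coordinate)
  from continuous_attains_sup[OF compact_supported_sphere ne this]
  obtain v0 where v0: "v0 \<in> ?K" and max: "\<And>v. v \<in> ?K \<Longrightarrow> f v \<le> f v0" by blast
  have "f v \<le> f v0 * (\<Sum>j<q. (v j)\<^sup>2)" for v
  proof (cases "(\<Sum>j<q. (v j)\<^sup>2) = 0")
    case True
    then have "\<forall>j<q. v j = 0" by (simp add: sum_nonneg_eq_0_iff)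
    then show ?thesis by (simp add: f_def mat_apply_def)
  next
    case False
    define n where "n = sqrt (\<Sum>j<q. (v j)\<^sup>2)"
    have S0: "(\<Sum>j<q. (v j)\<^sup>2) \<ge> 0" by (intro sum_nonneg) auto
    have n: "n > 0" "n\<^sup>2 = (\<Sum>j<q. (v j)\<^sup>2)" unfolding n_def using False S0 by auto
    define u where "u = (\<lambda>j. if j < q then v j / n else 0)"
    have "(\<Sum>j<q. (u j)\<^sup>2) = (\<Sum>j<q. (v j)\<^sup>2) / n\<^sup>2"
      unfolding u_def sum_divide_distrib by (intro sum.cong) (auto simp: power_divide)
    then have "u \<in> ?K" using n False by (auto simp: unit_sphere_def u_def)
    then have "f u \<le> f v0" by (rule max)
    moreover have "f v = n\<^sup>2 * f u"
    proof -
      have "mat_apply M q v i = n * mat_apply M q u i" for i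
        unfolding mat_apply_def u_def sum_distrib_left using n by (intro sum.cong) auto
      then show ?thesis unfolding f_def by (simp add: power_mult_distrib sum_distrib_left)
    qed
    ultimately show ?thesis unfolding n(2)[symmetric] by (simp add: mult.commute mult_left_mono mult_right_mono)
  qed
  then show ?thesis using that[of v0] v0 unfolding f_def by blast
qed

lemma mat_mult_vec_nth:
  assumes "v \<in> carrier_vec q" "i < p"
  shows "(mat p q M *\<^sub>v v) $ i = mat_apply M q (\<lambda>j. v $ j) i"
  using assms by (simp add: scalar_prod_def mat_apply_def atLeast0LessThan)

lemma mat_mult_vec_norm:
  assumes "v \<in> carrier_vec q"
  shows "(mat p q M *\<^sub>v v) \<bullet> (mat p q M *\<^sub>v v) = (\<Sum>i<p. (mat_apply M q (\<lambda>j. v $ j) i)\<^sup>2)"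
  using mat_mult_vec_nth[OF assms]
  by (simp add: scalar_prod_def[of "mat p q M *\<^sub>v v"] atLeast0LessThan power2_eq_square)

lemma gram_mult_vec_nth:
  assumes v: "v \<in> carrier_vec q" and j: "j < q"
  shows "((transpose_mat (mat p q M) * mat p q M) *\<^sub>v v) $ j = (\<Sum>i<p. M (i, j) * mat_apply M q (\<lambda>j. v $ j) i)"
proof -
  have "(transpose_mat (mat p q M) * mat p q M) *\<^sub>v v = transpose_mat (mat p q M) *\<^sub>v (mat p q M *\<^sub>v v)"
    by (rule assoc_mult_mat_vec[of _ q p _ q]) (use v in auto)
  also have "\<dots> $ j = (\<Sum>i<p. M (i, j) * (mat p q M *\<^sub>v v) $ i)"
    using j by (simp add: scalar_prod_def[of _ "mat p q M *\<^sub>v v"] atLeast0LessThan)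
  also have "\<dots> = (\<Sum>i<p. M (i, j) * mat_apply M q (\<lambda>j. v $ j) i)"
    using mat_mult_vec_nth[OF v] by (intro sum.cong) auto
  finally show ?thesis .
qed

text \<open>
  A maximiser \<open>v0\<close> of the Rayleigh quotient \<open>|M v|^2 / |v|^2\<close> is an eigenvector of \<open>M^T M\<close>, and its
  eigenvalue, the maximum, is the largest one. This identifies \<^const>\<open>sigma1\<close>, which is defined by
  eigenvalues, with the operator norm, and provides the variational description used from here on.
\<close>

lemma sigma1_properties:
  defines "s \<equiv> sigma1 (mat p q M)"
  shows "s \<ge> 0" and "op_norm (mat p q M) = s"
    and "\<exists>v\<in>unit_sphere q. (\<Sum>i<p. (mat_apply M q v i)\<^sup>2) = s\<^sup>2"
    and "\<And>v. (\<Sum>i<p. (mat_apply M q v i)\<^sup>2) \<le> s\<^sup>2 * (\<Sum>j<q. (v j)\<^sup>2)"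
proof -
  let ?B = "mat p q M"
  let ?G = "transpose_mat ?B * ?B"
  have G: "?G \<in> carrier_mat q q" by (rule mult_carrier_mat[of _ q p]) auto
  obtain v0 where v0: "v0 \<in> unit_sphere q"
    and max: "\<And>v. (\<Sum>i<p. (mat_apply M q v i)\<^sup>2) \<le> (\<Sum>i<p. (mat_apply M q v0 i)\<^sup>2) * (\<Sum>j<q. (v j)\<^sup>2)"
    by (rule rayleigh_maximizer) blast
  define l where "l = (\<Sum>i<p. (mat_apply M q v0 i)\<^sup>2)"
  have l0: "l \<ge> 0" unfolding l_def by (intro sum_nonneg) auto
  have n0: "(\<Sum>j<q. (v0 j)\<^sup>2) = 1" using v0 by (simp add: unit_sphere_def)
  \<comment> \<open>The first order condition at the maximiser: the quadratic function
      \<open>t \<mapsto> l |v0 + t u|^2 - |M (v0 + t u)|^2\<close> is nonnegative and vanishes at \<open>t = 0\<close>.\<close>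
  have critical: "(\<Sum>i<p. mat_apply M q u i * mat_apply M q v0 i) = l * (\<Sum>j<q. u j * v0 j)" for u
  proof -
    define d where "d = (\<Sum>i<p. mat_apply M q u i * mat_apply M q v0 i) - l * (\<Sum>j<q. u j * v0 j)"
    define c where "c = l * (\<Sum>j<q. (u j)\<^sup>2) - (\<Sum>i<p. (mat_apply M q u i)\<^sup>2)"
    have c0: "c \<ge> 0" unfolding c_def l_def using max[of u] by simp
    \<comment> \<open>Taking \<open>t = d / (c + 1)\<close> below forces \<open>d = 0\<close>; the \<open>1\<close> avoids a division by zero.\<close>
    have quad: "2 * t * d \<le> t\<^sup>2 * c" for t
    proof -
      have "(\<Sum>i<p. (mat_apply M q (\<lambda>j. v0 j + t * u j) i)\<^sup>2)
          = l + 2 * t * (\<Sum>i<p. mat_apply M q u i * mat_apply M q v0 i) + t\<^sup>2 * (\<Sum>i<p. (mat_apply M q u i)\<^sup>2)"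
        unfolding mat_apply_add_scaled l_def
        by (simp add: power2_sum power_mult_distrib sum.distrib sum_distrib_left algebra_simps)
      moreover have "(\<Sum>j<q. (v0 j + t * u j)\<^sup>2)
          = 1 + 2 * t * (\<Sum>j<q. u j * v0 j) + t\<^sup>2 * (\<Sum>j<q. (u j)\<^sup>2)"
        unfolding n0[symmetric]
        by (simp add: power2_sum power_mult_distrib sum.distrib sum_distrib_left algebra_simps)
      moreover note max[of "\<lambda>j. v0 j + t * u j", folded l_def]
      ultimately show ?thesis unfolding d_def c_def by (simp add: algebra_simps)
    qed
    define e where "e = c + 1"
    have e: "e > 0" unfolding e_def using c0 by simp
    have "2 * (d / e) * d * e\<^sup>2 \<le> (d / e)\<^sup>2 * c * e\<^sup>2"
      by (intro mult_right_mono quad) simp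
    then have "2 * d\<^sup>2 * e \<le> d\<^sup>2 * c"
      using e by (simp add: power2_eq_square)
    then have "2 * d\<^sup>2 * (c + 1) \<le> d\<^sup>2 * c" unfolding e_def .
    then have "d\<^sup>2 * (c + 2) \<le> 0" by (simp add: algebra_simps)
    then have "d\<^sup>2 \<le> 0" using c0 by (simp add: mult_le_0_iff)
    then show ?thesis unfolding d_def by simp
  qed
  have "eigenvector ?G (vec q v0) l"
    unfolding eigenvector_def
  proof (intro conjI)
    show "vec q v0 \<in> carrier_vec (dim_row ?G)" by simp
    show "vec q v0 \<noteq> 0\<^sub>v (dim_row ?G)"
    proof
      assume "vec q v0 = 0\<^sub>v (dim_row ?G)"
      then have "v0 j = 0" if "j < q" for j using that by (metis index_vec index_zero_vec(1) index_mult_mat(2) index_transpose_mat(2) dim_col_mat(1))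
      then show False using n0 by simp
    qed
    show "?G *\<^sub>v vec q v0 = l \<cdot>\<^sub>v vec q v0"
    proof (rule eq_vecI)
      fix j assume "j < dim_vec (l \<cdot>\<^sub>v vec q v0)"
      then have j: "j < q" by simp
      have apj: "mat_apply M q (\<lambda>k. if k = j then 1 else 0) i = M (i, j)" for i
        unfolding mat_apply_def using j by (simp add: if_distrib cong: if_cong)
      have ap0: "mat_apply M q (\<lambda>k. vec q v0 $ k) i = mat_apply M q v0 i" for i
        unfolding mat_apply_def by (intro sum.cong) auto
      have "(?G *\<^sub>v vec q v0) $ j = (\<Sum>i<p. M (i, j) * mat_apply M q v0 i)"
        by (subst gram_mult_vec_nth) (use j ap0 in auto)
      also have "\<dots> = l * v0 j"
        using critical[of "\<lambda>k. if k = j then 1 else 0"] j unfolding apj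
        by (simp add: if_distrib[of "\<lambda>x. x * _"] cong: if_cong)
      finally show "(?G *\<^sub>v vec q v0) $ j = (l \<cdot>\<^sub>v vec q v0) $ j" using j by simp
    qed simp
  qed
  then have ev: "eigenvalue ?G l" unfolding eigenvalue_def by blast
  have ev_le: "k \<le> l" if k: "eigenvalue ?G k" for k
  proof -
    obtain w where w: "w \<in> carrier_vec q" "w \<noteq> 0\<^sub>v q" "?G *\<^sub>v w = k \<cdot>\<^sub>v w"
      using k unfolding eigenvalue_def eigenvector_def by auto
    have "\<exists>j<q. w $ j \<noteq> 0"
    proof (rule ccontr)
      assume "\<not> (\<exists>j<q. w $ j \<noteq> 0)"
      then have "w = 0\<^sub>v q" using w(1) by (intro eq_vecI) auto
      then show False using w(2) by simp
    qed
    then have nw: "(\<Sum>j<q. (w $ j)\<^sup>2) > 0"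
      by (auto intro!: sum_pos2[of "{..<q}"])
    have "k * (\<Sum>j<q. (w $ j)\<^sup>2) = (\<Sum>j<q. w $ j * ((?G *\<^sub>v w) $ j))"
      unfolding w(3) using w(1) by (simp add: sum_distrib_left power2_eq_square algebra_simps)
    also have "\<dots> = (\<Sum>j<q. \<Sum>i<p. w $ j * (M (i, j) * mat_apply M q (\<lambda>j. w $ j) i))"
      using gram_mult_vec_nth[OF w(1)] by (simp add: sum_distrib_left)
    also have "\<dots> = (\<Sum>i<p. \<Sum>j<q. w $ j * (M (i, j) * mat_apply M q (\<lambda>j. w $ j) i))"
      by (rule sum.swap)
    also have "\<dots> = (\<Sum>i<p. (mat_apply M q (\<lambda>j. w $ j) i)\<^sup>2)"
    proof (intro sum.cong refl)
      fix i
      have "(\<Sum>j<q. w $ j * (M (i, j) * mat_apply M q (\<lambda>j. w $ j) i)) = (\<Sum>j<q. M (i, j) * w $ j) * mat_apply M q (\<lambda>j. w $ j) i"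
        unfolding sum_distrib_right by (intro sum.cong) auto
      then show "(\<Sum>j<q. w $ j * (M (i, j) * mat_apply M q (\<lambda>j. w $ j) i)) = (mat_apply M q (\<lambda>j. w $ j) i)\<^sup>2"
        unfolding mat_apply_def[of M q "\<lambda>j. w $ j" i, symmetric] power2_eq_square .
    qed
    also have "\<dots> \<le> l * (\<Sum>j<q. (w $ j)\<^sup>2)"
      using max[of "\<lambda>j. w $ j"] unfolding l_def .
    finally show ?thesis using nw by simp
  qed
  have "finite {k. eigenvalue ?G k}"
  proof -
    have "char_poly ?G \<noteq> 0"
      using degree_monic_char_poly[OF G] by auto
    then show ?thesis
      unfolding eigenvalue_root_char_poly[OF G] by (rule poly_roots_finite)
  qed
  then have s: "s = sqrt l"
    unfolding s_def sigma1_def singular_values_def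
    by (intro Max_eqI) (use ev ev_le in auto)
  show "s \<ge> 0" unfolding s using l0 by simp
  have s2: "s\<^sup>2 = l" unfolding s using l0 by simp
  show "\<exists>v\<in>unit_sphere q. (\<Sum>i<p. (mat_apply M q v i)\<^sup>2) = s\<^sup>2"
    unfolding s2 using v0 l_def by blast
  show le: "(\<Sum>i<p. (mat_apply M q v i)\<^sup>2) \<le> s\<^sup>2 * (\<Sum>j<q. (v j)\<^sup>2)" for v
    unfolding s2 using max[of v] by (simp add: l_def)
  have nv: "v \<bullet> v = (\<Sum>j<q. (v $ j)\<^sup>2)" if "v \<in> carrier_vec q" for v :: "real vec"
    using that by (simp add: scalar_prod_def atLeast0LessThan power2_eq_square)
  show "op_norm ?B = s"
    unfolding op_norm_def
  proof (rule cSup_eq_maximum)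
    show "s \<in> (\<lambda>v. sqrt ((?B *\<^sub>v v) \<bullet> (?B *\<^sub>v v))) ` {v \<in> carrier_vec (dim_col ?B). v \<bullet> v \<le> 1}"
    proof (rule image_eqI)
      have "mat_apply M q (\<lambda>j. vec q v0 $ j) = mat_apply M q v0" unfolding mat_apply_def by (intro ext sum.cong) auto
      then show "s = sqrt ((?B *\<^sub>v vec q v0) \<bullet> (?B *\<^sub>v vec q v0))"
        by (subst mat_mult_vec_norm) (auto simp: s l_def)
      show "vec q v0 \<in> {v \<in> carrier_vec (dim_col ?B). v \<bullet> v \<le> 1}"
        using nv[of "vec q v0"] n0 by simp
    qed
    fix y assume "y \<in> (\<lambda>v. sqrt ((?B *\<^sub>v v) \<bullet> (?B *\<^sub>v v))) ` {v \<in> carrier_vec (dim_col ?B). v \<bullet> v \<le> 1}"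
    then obtain v :: "real vec" where v: "v \<in> carrier_vec q" "v \<bullet> v \<le> 1" and y: "y = sqrt ((?B *\<^sub>v v) \<bullet> (?B *\<^sub>v v))"
      by auto
    have "(?B *\<^sub>v v) \<bullet> (?B *\<^sub>v v) \<le> l * (v \<bullet> v)"
      unfolding mat_mult_vec_norm[OF v(1)] nv[OF v(1)] using le[of "\<lambda>j. v $ j"] unfolding s2 .
    also have "\<dots> \<le> l" using mult_left_mono[OF v(2) l0] by simp
    finally show "y \<le> s" unfolding y s by simp
  qed
qed

end

section \<open>Second moments of largest singular values and chi-square deviations\<close>

lemma (in prob_space) abs_moment_le:
  fixes X :: "'a \<Rightarrow> real"
  assumes X: "X \<in> borel_measurable M" and X2: "integrable M (\<lambda>x. (X x)\<^sup>2)"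
    and m: "expectation (\<lambda>x. (X x)\<^sup>2) \<le> m\<^sup>2" "m \<ge> 0"
  shows "integrable M X" and "expectation (\<lambda>x. \<bar>X x\<bar>) \<le> m"
proof -
  have "\<bar>X x\<bar> \<le> 1 + (X x)\<^sup>2" for x
    using zero_le_power2[of "\<bar>X x\<bar> - 1"] by (simp add: power2_diff)
  then show X1: "integrable M X"
    by (intro Bochner_Integration.integrable_bound[OF Bochner_Integration.integrable_add[OF integrable_const[of 1] X2]] X)
      (auto intro!: AE_I2)
  have "0 \<le> variance (\<lambda>x. \<bar>X x\<bar>)" by (rule variance_positive)
  also have "\<dots> = expectation (\<lambda>x. (X x)\<^sup>2) - (expectation (\<lambda>x. \<bar>X x\<bar>))\<^sup>2"
    by (subst variance_eq) (use X1 X2 in \<open>simp_all\<close>)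
  finally have "(expectation (\<lambda>x. \<bar>X x\<bar>))\<^sup>2 \<le> expectation (\<lambda>x. (X x)\<^sup>2)" by simp
  also note m(1)
  finally have "(expectation (\<lambda>x. \<bar>X x\<bar>))\<^sup>2 \<le> m\<^sup>2" .
  then show "expectation (\<lambda>x. \<bar>X x\<bar>) \<le> m" using m(2) by (rule power2_le_imp_le)
qed

text \<open>
  The rule for sums of independent normal variables needs positive variances, so the entries with
  \<open>v j = 0\<close> are left out of the sum.
\<close>

lemma gauss_row_normal:
  fixes p q :: nat
  assumes v: "v \<in> unit_sphere q" and i: "i < p"
  shows "distributed (gauss ({..<p} \<times> {..<q})) lborel (\<lambda>\<omega>. \<Sum>j<q. v j * \<omega> (i, j)) std_normal_density"
proof -
  have q: "1 \<le> q" using v by (cases q) (auto simp: unit_sphere_def)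
  have p: "1 \<le> p" using i by simp
  note entries = std_gaussian_entries[OF p q, unfolded std_gaussian_eq_gauss]
  interpret G: prob_space "gauss ({..<p} \<times> {..<q})" by (rule prob_space_gauss)
  define A where "A = {i} \<times> {j. j < q \<and> v j \<noteq> 0}"
  have sum_A: "(\<Sum>ij\<in>A. f (snd ij)) = (\<Sum>j | j < q \<and> v j \<noteq> 0. f j)" for f :: "nat \<Rightarrow> real"
    by (rule sum.reindex_bij_witness[of _ "Pair i" snd]) (auto simp: A_def)
  have sq: "(\<Sum>ij\<in>A. (v (snd ij))\<^sup>2) = 1"
  proof -
    have "(\<Sum>ij\<in>A. (v (snd ij))\<^sup>2) = (\<Sum>j<q. (v j)\<^sup>2)"
      unfolding sum_A[of "\<lambda>j. (v j)\<^sup>2"] by (rule sum.mono_neutral_left) auto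
    then show ?thesis using v by (simp add: unit_sphere_def)
  qed
  have "distributed (gauss ({..<p} \<times> {..<q})) lborel (\<lambda>\<omega>. \<Sum>ij\<in>A. v (snd ij) * \<omega> ij)
      (normal_density (\<Sum>ij\<in>A. 0) (sqrt (\<Sum>ij\<in>A. \<bar>v (snd ij)\<bar>\<^sup>2)))"
  proof (rule G.sum_indep_normal)
    show "finite A" unfolding A_def by simp
    show "A \<noteq> {}" using sq by auto
    show "G.indep_vars (\<lambda>i. borel) (\<lambda>ij \<omega>. v (snd ij) * \<omega> ij) A"
      by (rule G.indep_vars_compose2[OF G.indep_vars_subset[OF entries(2)]])
        (use i in \<open>auto simp: A_def\<close>)
    fix ij assume ij: "ij \<in> A"
    then show "0 < \<bar>v (snd ij)\<bar>" by (auto simp: A_def)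
    have "distributed (gauss ({..<p} \<times> {..<q})) lborel (\<lambda>\<omega>. \<omega> ij) std_normal_density"
      by (rule entries(3)) (use ij i in \<open>auto simp: A_def\<close>)
    from G.normal_density_affine[OF this, of "v (snd ij)" 0]
    show "distributed (gauss ({..<p} \<times> {..<q})) lborel (\<lambda>\<omega>. v (snd ij) * \<omega> ij) (normal_density 0 \<bar>v (snd ij)\<bar>)"
      using ij by (auto simp: A_def)
  qed
  moreover have "(\<Sum>ij\<in>A. v (snd ij) * \<omega> ij) = (\<Sum>j<q. v j * \<omega> (i, j))" for \<omega> :: "nat \<times> nat \<Rightarrow> real"
  proof -
    have "(\<Sum>ij\<in>A. v (snd ij) * \<omega> ij) = (\<Sum>ij\<in>A. v (snd ij) * \<omega> (i, snd ij))"
      by (intro sum.cong) (auto simp: A_def)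
    also have "\<dots> = (\<Sum>j<q. v j * \<omega> (i, j))"
      unfolding sum_A[of "\<lambda>j. v j * \<omega> (i, j)"] by (rule sum.mono_neutral_left) auto
    finally show ?thesis .
  qed
  ultimately show ?thesis using sq by simp
qed

text \<open>
  The rows of \<open>\<omega>\<close> are independent, so the variables \<open>(\<omega> v)_i^2 - 1\<close> are centred, uncorrelated and of
  variance \<open>3 - 1 = 2\<close>; hence \<open>X\<close> has variance \<open>2 p\<close>.
\<close>

lemma gauss_chi_square_deviation:
  fixes p q :: nat
  assumes v: "v \<in> unit_sphere q" and p: "1 \<le> p"
  defines "X \<equiv> \<lambda>\<omega>. (\<Sum>i<p. (\<Sum>j<q. v j * \<omega> (i, j))\<^sup>2) - real p"
  shows "integrable (gauss ({..<p} \<times> {..<q})) X"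
    and "(\<integral>\<omega>. \<bar>X \<omega>\<bar> \<partial>gauss ({..<p} \<times> {..<q})) \<le> sqrt (2 * p)"
proof -
  let ?G = "gauss ({..<p} \<times> {..<q})"
  have q: "1 \<le> q" using v by (cases q) (auto simp: unit_sphere_def)
  interpret G: prob_space ?G by (rule prob_space_gauss)
  define g where "g = (\<lambda>(i::nat) \<omega>. \<Sum>j<q. v j * \<omega> (i, j))"
  define Z where "Z = (\<lambda>i \<omega>. (g i \<omega>)\<^sup>2 - 1)"
  have dist: "distributed ?G lborel (g i) (\<lambda>x. ennreal (std_normal_density x))" if "i < p" for i
    unfolding g_def by (rule gauss_row_normal[OF v that])
  have mom: "integrable ?G (\<lambda>\<omega>. g i \<omega> ^ n)"
    "(\<integral>\<omega>. g i \<omega> ^ n \<partial>?G) = (\<integral>x. std_normal_density x * x ^ n \<partial>lborel)" if "i < p" for i n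
  proof -
    show "integrable ?G (\<lambda>\<omega>. g i \<omega> ^ n)"
      using distributed_integrable[OF dist[OF that], of "\<lambda>x. x ^ n"] integrable_std_normal_moment[of n]
      by fastforce
    show "(\<integral>\<omega>. g i \<omega> ^ n \<partial>?G) = (\<integral>x. std_normal_density x * x ^ n \<partial>lborel)"
      by (rule distributed_integral[OF dist[OF that], of "\<lambda>x. x ^ n", symmetric]) auto
  qed
  have m2: "(\<integral>\<omega>. g i \<omega> ^ 2 \<partial>?G) = 1" if "i < p" for i
  proof -
    have "(\<integral>\<omega>. g i \<omega> ^ 2 \<partial>?G) = fact (2 * 1) / (2 ^ 1 * fact 1)"
      unfolding mom(2)[OF that] using integral_std_normal_moment_even[of 1] unfolding mult_1_right .
    then show ?thesis by (simp add: fact_numeral)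
  qed
  have m4: "(\<integral>\<omega>. g i \<omega> ^ 4 \<partial>?G) = 3" if "i < p" for i
  proof -
    have "2 * 2 = (4::nat)" by simp
    then have "(\<integral>\<omega>. g i \<omega> ^ 4 \<partial>?G) = fact (2 * 2) / (2 ^ 2 * fact 2)"
      unfolding mom(2)[OF that] using integral_std_normal_moment_even[of 2] by (simp only:)
    then show ?thesis by (simp add: fact_numeral)
  qed
  have iZ: "integrable ?G (Z i)" if "i < p" for i
    unfolding Z_def by (intro Bochner_Integration.integrable_diff mom that G.integrable_const)
  have EZ: "(\<integral>\<omega>. Z i \<omega> \<partial>?G) = 0" if "i < p" for i
    unfolding Z_def
    by (subst Bochner_Integration.integral_diff[OF mom(1)[OF that] G.integrable_const])
      (simp add: m2[OF that] G.prob_space)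
  have Z2: "Z i \<omega> * Z i \<omega> = g i \<omega> ^ 4 - (2 * g i \<omega> ^ 2 - 1)" for i \<omega>
    unfolding Z_def by (simp add: power2_eq_square algebra_simps eval_nat_numeral)
  have iZ2: "integrable ?G (\<lambda>\<omega>. Z i \<omega> * Z i \<omega>)" if "i < p" for i
    unfolding Z2
    by (intro Bochner_Integration.integrable_diff integrable_mult_right mom that G.integrable_const)
  have EZ2: "(\<integral>\<omega>. Z i \<omega> * Z i \<omega> \<partial>?G) = 2" if "i < p" for i
  proof -
    have "(\<integral>\<omega>. Z i \<omega> * Z i \<omega> \<partial>?G) = (\<integral>\<omega>. g i \<omega> ^ 4 \<partial>?G) - (\<integral>\<omega>. 2 * g i \<omega> ^ 2 - 1 \<partial>?G)"
      unfolding Z2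
      by (intro Bochner_Integration.integral_diff Bochner_Integration.integrable_diff
          integrable_mult_right mom that G.integrable_const)
    also have "(\<integral>\<omega>. 2 * g i \<omega> ^ 2 - 1 \<partial>?G) = 2 * (\<integral>\<omega>. g i \<omega> ^ 2 \<partial>?G) - 1"
      by (subst Bochner_Integration.integral_diff[OF integrable_mult_right[OF mom(1)[OF that]] G.integrable_const])
        (simp add: G.prob_space)
    finally show ?thesis by (simp add: m2[OF that] m4[OF that])
  qed
  have "G.indep_vars (\<lambda>i. Pi\<^sub>M ({i} \<times> {..<q}) (\<lambda>_. borel))
      (\<lambda>i \<omega>. restrict (\<lambda>ij. \<omega> ij) ({i} \<times> {..<q})) {..<p}"
    by (rule G.indep_vars_restrict[OF std_gaussian_entries(2)[OF p q, unfolded std_gaussian_eq_gauss]])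
      (auto simp: disjoint_family_on_def)
  then have "G.indep_vars (\<lambda>i. borel)
      (\<lambda>i \<omega>. (\<Sum>j<q. v j * (restrict (\<lambda>ij. \<omega> ij) ({i} \<times> {..<q})) (i, j))\<^sup>2 - 1) {..<p}"
    by (rule G.indep_vars_compose2[where Y = "\<lambda>i x. (\<Sum>j<q. v j * x (i, j))\<^sup>2 - 1"]) measurable
  then have indep: "G.indep_vars (\<lambda>i. borel) Z {..<p}"
    unfolding Z_def g_def by simp
  have cross: "integrable ?G (\<lambda>\<omega>. Z i \<omega> * Z k \<omega>)" "(\<integral>\<omega>. Z i \<omega> * Z k \<omega> \<partial>?G) = 0"
    if "i < p" "k < p" "i \<noteq> k" for i k
  proof -
    have ik: "G.indep_vars (\<lambda>i. borel) Z {i, k}"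
      by (rule G.indep_vars_subset[OF indep]) (use that in auto)
    have int: "\<And>l. l \<in> {i, k} \<Longrightarrow> integrable ?G (Z l)" using iZ that by auto
    have prod: "(\<Prod>l\<in>{i, k}. Z l \<omega>) = Z i \<omega> * Z k \<omega>" for \<omega> using that by simp
    show "integrable ?G (\<lambda>\<omega>. Z i \<omega> * Z k \<omega>)"
      using G.indep_vars_integrable[OF _ ik int] unfolding prod by simp
    have "(\<integral>\<omega>. Z i \<omega> * Z k \<omega> \<partial>?G) = (\<Prod>l\<in>{i, k}. \<integral>\<omega>. Z l \<omega> \<partial>?G)"
      using G.indep_vars_lebesgue_integral[OF _ ik int] unfolding prod by simp
    then show "(\<integral>\<omega>. Z i \<omega> * Z k \<omega> \<partial>?G) = 0" using that EZ by simp
  qed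
  have iZZ: "integrable ?G (\<lambda>\<omega>. Z i \<omega> * Z k \<omega>)" if "i < p" "k < p" for i k
    using iZ2 cross(1) that by (cases "i = k") auto
  have EZZ: "(\<integral>\<omega>. Z i \<omega> * Z k \<omega> \<partial>?G) = (if k = i then 2 else 0)" if "i < p" "k < p" for i k
    using EZ2 cross(2) that by (cases "i = k") auto
  have XZ: "X \<omega> = (\<Sum>i<p. Z i \<omega>)" for \<omega>
    unfolding X_def Z_def g_def by (simp add: sum_subtractf)
  have Xsq: "(X \<omega>)\<^sup>2 = (\<Sum>i<p. \<Sum>k<p. Z i \<omega> * Z k \<omega>)" for \<omega>
    unfolding XZ power2_eq_square sum_product ..
  have iX: "integrable ?G X"
    unfolding XZ by (intro Bochner_Integration.integrable_sum iZ) simp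
  have iX2: "integrable ?G (\<lambda>\<omega>. (X \<omega>)\<^sup>2)"
    unfolding Xsq by (intro Bochner_Integration.integrable_sum iZZ) simp_all
  have "(\<integral>\<omega>. (X \<omega>)\<^sup>2 \<partial>?G) = (\<Sum>i<p. \<Sum>k<p. \<integral>\<omega>. Z i \<omega> * Z k \<omega> \<partial>?G)"
    unfolding Xsq
    by (subst Bochner_Integration.integral_sum, intro Bochner_Integration.integrable_sum iZZ, simp, simp,
        intro sum.cong refl Bochner_Integration.integral_sum iZZ) auto
  also have "\<dots> = (\<Sum>i<p. \<Sum>k<p. if k = i then 2 else 0)"
    by (intro sum.cong refl EZZ) auto
  also have "\<dots> = 2 * p" by simp
  finally have EX2: "(\<integral>\<omega>. (X \<omega>)\<^sup>2 \<partial>?G) \<le> (sqrt (2 * p))\<^sup>2" by simp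
  show "integrable ?G X" by (rule iX)
  show "(\<integral>\<omega>. \<bar>X \<omega>\<bar> \<partial>?G) \<le> sqrt (2 * p)"
    by (rule G.abs_moment_le(2)[OF borel_measurable_integrable[OF iX] iX2 EX2]) simp
qed

text \<open>
  The condition \<open>sigma1 \<le> a\<close> says that \<open>|M v|^2 \<le> a^2\<close> for all unit vectors \<open>v\<close>, and by continuity in
  \<open>v\<close> a countable dense set of them, the union of finite nets, is enough.
\<close>

lemma measurable_sigma1:
  assumes q: "1 \<le> q" and f: "\<And>i j. i < p \<Longrightarrow> j < q \<Longrightarrow> (\<lambda>x. f x (i, j)) \<in> borel_measurable M"
  shows "(\<lambda>x. sigma1 (mat p q (f x))) \<in> borel_measurable M"
proof (rule borel_measurable_iff_le[THEN iffD2, rule_format])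
  fix a :: real
  let ?s = "\<lambda>x. sigma1 (mat p q (f x))"
  define h where "h = (\<lambda>v x. \<Sum>i<p. (\<Sum>j<q. f x (i, j) * v j)\<^sup>2)"
  have h: "h v x = (\<Sum>i<p. (mat_apply (f x) q v i)\<^sup>2)" for v x unfolding h_def mat_apply_def ..
  have "\<exists>N. finite N \<and> N \<subseteq> unit_sphere q \<and> (\<forall>v\<in>unit_sphere q. \<exists>u\<in>N. \<forall>i<q. \<bar>v i - u i\<bar> \<le> 1 / Suc m)" for m
    using unit_sphere_net[of "Suc m" q] by (metis zero_less_Suc)
  then obtain N where N: "\<And>m. finite (N m)" "\<And>m. N m \<subseteq> unit_sphere q"
    and near: "\<And>m v. v \<in> unit_sphere q \<Longrightarrow> \<exists>u\<in>N m. \<forall>i<q. \<bar>v i - u i\<bar> \<le> 1 / Suc m"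
    by metis
  define D where "D = (\<Union>m. N m)"
  have D: "countable D" unfolding D_def using N(1) by (intro countable_UN) (auto intro: countable_finite)
  have dense: "h v x \<le> b" if v: "v \<in> unit_sphere q" and b: "\<And>u. u \<in> D \<Longrightarrow> h u x \<le> b" for v x b
  proof -
    obtain u where u: "\<And>m. u m \<in> N m" "\<And>m i. i < q \<Longrightarrow> \<bar>v i - u m i\<bar> \<le> 1 / Suc m"
      using near[OF v] by metis
    have "(\<lambda>m. u m i) \<longlonglongrightarrow> v i" if "i < q" for i
    proof (rule LIM_zero_cancel, rule tendsto_rabs_zero_cancel, rule tendsto_sandwich)
      show "\<forall>\<^sub>F m in sequentially. 0 \<le> \<bar>u m i - v i\<bar>" by simp
      show "\<forall>\<^sub>F m in sequentially. \<bar>u m i - v i\<bar> \<le> 1 / Suc m"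
        using u(2)[OF that] by (simp add: abs_minus_commute)
      show "(\<lambda>m. 1 / real (Suc m)) \<longlonglongrightarrow> 0" by (rule LIMSEQ_Suc[OF lim_1_over_n])
    qed simp
    then have "(\<lambda>m. h (u m) x) \<longlonglongrightarrow> h v x"
      unfolding h_def by (intro tendsto_sum tendsto_power tendsto_mult tendsto_const) auto
    then show ?thesis
      by (rule LIMSEQ_le_const2) (use b u(1) in \<open>auto simp: D_def\<close>)
  qed
  show "{x \<in> space M. ?s x \<le> a} \<in> sets M"
  proof (cases "a \<ge> 0")
    case False
    then have "{x \<in> space M. ?s x \<le> a} = {}"
      using sigma1_properties(1)[OF q] by (auto simp: not_le intro: less_le_trans)
    then show ?thesis by (metis sets.empty_sets)
  next
    case True
    have "?s x \<le> a \<longleftrightarrow> (\<forall>u\<in>D. h u x \<le> a\<^sup>2)" for x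
    proof
      assume s: "?s x \<le> a"
      show "\<forall>u\<in>D. h u x \<le> a\<^sup>2"
      proof
        fix u assume "u \<in> D"
        then have "u \<in> unit_sphere q" unfolding D_def using N by blast
        then have "h u x \<le> (?s x)\<^sup>2"
          using sigma1_properties(4)[OF q, where p = p and M = "f x" and v = u] unfolding h unit_sphere_def by simp
        also have "\<dots> \<le> a\<^sup>2" using s sigma1_properties(1)[OF q, where p = p and M = "f x"] by (intro power_mono)
        finally show "h u x \<le> a\<^sup>2" .
      qed
    next
      assume u: "\<forall>u\<in>D. h u x \<le> a\<^sup>2"
      obtain v where "v \<in> unit_sphere q" "h v x = (?s x)\<^sup>2"
        using sigma1_properties(3)[OF q, where p = p and M = "f x"] unfolding h by blast
      then have "(?s x)\<^sup>2 \<le> a\<^sup>2" using dense[of v x "a\<^sup>2"] u by simp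
      then show "?s x \<le> a" using True by (rule power2_le_imp_le)
    qed
    then have "{x \<in> space M. ?s x \<le> a} = {x \<in> space M. \<forall>u\<in>D. h u x \<le> a\<^sup>2}" by simp
    also have "\<dots> \<in> sets M"
    proof (rule sets.sets_Collect_countable_All'[OF _ D])
      fix u
      have "h u \<in> borel_measurable M"
        unfolding h_def
        by (intro borel_measurable_sum borel_measurable_power borel_measurable_times f borel_measurable_const) auto
      then show "{x \<in> space M. h u x \<le> a\<^sup>2} \<in> sets M" by measurable
    qed
    finally show ?thesis .
  qed
qed


lemma unit_vector_attaining_norm:
  fixes y :: "nat \<Rightarrow> real"
  assumes "1 \<le> r"
  obtains w where "w \<in> unit_sphere r" "(\<Sum>k<r. w k * y k) = sqrt (\<Sum>k<r. (y k)\<^sup>2)"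
proof (cases "(\<Sum>k<r. (y k)\<^sup>2) = 0")
  case True
  then have y0: "\<forall>k<r. y k = 0" by (simp add: sum_nonneg_eq_0_iff)
  have "(\<lambda>k. if k = 0 then 1 else 0) \<in> unit_sphere r"
    using assms by (auto simp: unit_sphere_def if_distrib[of "\<lambda>x. x\<^sup>2"] cong: if_cong)
  from that[OF this] show ?thesis using y0 by simp
next
  case False
  define n where "n = sqrt (\<Sum>k<r. (y k)\<^sup>2)"
  have "(\<Sum>k<r. (y k)\<^sup>2) \<ge> 0" by (intro sum_nonneg) auto
  then have n: "n > 0" "n\<^sup>2 = (\<Sum>k<r. (y k)\<^sup>2)" unfolding n_def using False by auto
  show ?thesis
  proof (rule that[of "\<lambda>k. y k / n"])
    show "(\<lambda>k. y k / n) \<in> unit_sphere r"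
      using n False by (simp add: unit_sphere_def power_divide sum_divide_distrib[symmetric])
    have "(\<Sum>k<r. y k / n * y k) = n\<^sup>2 / n"
      unfolding n(2) sum_divide_distrib by (simp add: power2_eq_square)
    then show "(\<Sum>k<r. y k / n * y k) = sqrt (\<Sum>k<r. (y k)\<^sup>2)"
      unfolding n_def[symmetric] using n(1) by (simp add: power2_eq_square)
  qed
qed

lemma bilinear_rearrange:
  fixes B :: "nat \<Rightarrow> nat \<Rightarrow> real" and \<omega> :: "nat \<times> nat \<Rightarrow> real"
  shows "(\<Sum>k<r. w k * (\<Sum>j<q. (\<Sum>i<p. B i k * \<omega> (i, j)) * v j))
    = (\<Sum>i<p. \<Sum>j<q. (\<Sum>k<r. B i k * w k) * v j * \<omega> (i, j))"
proof -
  have "(\<Sum>k<r. w k * (\<Sum>j<q. (\<Sum>i<p. B i k * \<omega> (i, j)) * v j))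
      = (\<Sum>k<r. \<Sum>j<q. \<Sum>i<p. B i k * w k * v j * \<omega> (i, j))"
    by (simp add: sum_distrib_left sum_distrib_right algebra_simps)
  also have "\<dots> = (\<Sum>k<r. \<Sum>i<p. \<Sum>j<q. B i k * w k * v j * \<omega> (i, j))"
    by (intro sum.cong refl sum.swap)
  also have "\<dots> = (\<Sum>i<p. \<Sum>k<r. \<Sum>j<q. B i k * w k * v j * \<omega> (i, j))"
    by (rule sum.swap)
  also have "\<dots> = (\<Sum>i<p. \<Sum>j<q. \<Sum>k<r. B i k * w k * v j * \<omega> (i, j))"
    by (intro sum.cong refl sum.swap)
  finally show ?thesis by (simp add: sum_distrib_right)
qed

text \<open>
  Chevet's inequality for the matrix product \<open>B^T \<omega>\<close>, whose largest singular value is the maximum of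
  \<open><w, B^T \<omega> v> = <B w, \<omega> v>\<close>.
\<close>

lemma sigma1_product_second_moment:
  fixes B :: "nat \<Rightarrow> nat \<Rightarrow> real" and p q r :: nat
  defines "S \<equiv> \<lambda>\<omega>. sigma1 (mat r q (\<lambda>(k, j). \<Sum>i<p. B i k * \<omega> (i, j)))"
  assumes q: "1 \<le> q" and r: "1 \<le> r" and \<sigma>: "\<sigma> \<ge> 0"
    and B: "\<And>w. w \<in> unit_sphere r \<Longrightarrow> (\<Sum>i<p. (\<Sum>k<r. B i k * w k)\<^sup>2) \<le> \<sigma>\<^sup>2"
  shows "S \<in> borel_measurable (gauss ({..<p} \<times> {..<q}))"
    and "integrable (gauss ({..<p} \<times> {..<q})) (\<lambda>\<omega>. (S \<omega>)\<^sup>2)"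
    and "(\<integral>\<omega>. (S \<omega>)\<^sup>2 \<partial>gauss ({..<p} \<times> {..<q}))
      \<le> (sqrt (\<Sum>i<p. \<Sum>k<r. (B i k)\<^sup>2) + \<sigma> * sqrt q)\<^sup>2"
proof -
  let ?C = "\<lambda>\<omega>. \<lambda>(k, j). \<Sum>i<p. B i k * \<omega> (i, j)"
  show meas: "S \<in> borel_measurable (gauss ({..<p} \<times> {..<q}))"
    unfolding S_def
  proof (rule measurable_sigma1[OF q])
    fix k j assume "k < r" "j < q"
    then have "(\<lambda>\<omega>. \<Sum>i<p. B i k * \<omega> (i, j)) \<in> borel_measurable (gauss ({..<p} \<times> {..<q}))"
      by (intro borel_measurable_sum borel_measurable_times borel_measurable_const
          measurable_gauss_component) auto
    then show "(\<lambda>\<omega>. ?C \<omega> (k, j)) \<in> borel_measurable (gauss ({..<p} \<times> {..<q}))" by simp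
  qed
  have S0: "S \<omega> \<ge> 0" for \<omega> unfolding S_def by (rule sigma1_properties(1)[OF q])
  have attained: "\<exists>w\<in>unit_sphere r. \<exists>v\<in>unit_sphere q.
      S \<omega> \<le> (\<Sum>i<p. \<Sum>j<q. (\<Sum>k<r. B i k * w k) * v j * \<omega> (i, j))" for \<omega>
  proof -
    obtain v where v: "v \<in> unit_sphere q" "(\<Sum>k<r. (mat_apply (?C \<omega>) q v k)\<^sup>2) = (S \<omega>)\<^sup>2"
      unfolding S_def using sigma1_properties(3)[OF q, where p = r and M = "?C \<omega>"] by blast
    obtain w where w: "w \<in> unit_sphere r"
      "(\<Sum>k<r. w k * mat_apply (?C \<omega>) q v k) = sqrt (\<Sum>k<r. (mat_apply (?C \<omega>) q v k)\<^sup>2)"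
      by (rule unit_vector_attaining_norm[OF r])
    have "S \<omega> = (\<Sum>k<r. w k * mat_apply (?C \<omega>) q v k)" unfolding w(2) v(2) using S0 by simp
    also have "\<dots> = (\<Sum>k<r. w k * (\<Sum>j<q. (\<Sum>i<p. B i k * \<omega> (i, j)) * v j))"
      unfolding mat_apply_def by simp
    also have "\<dots> = (\<Sum>i<p. \<Sum>j<q. (\<Sum>k<r. B i k * w k) * v j * \<omega> (i, j))"
      by (rule bilinear_rearrange)
    finally have eq: "S \<omega> = (\<Sum>i<p. \<Sum>j<q. (\<Sum>k<r. B i k * w k) * v j * \<omega> (i, j))" .
    show ?thesis
      by (rule bexI[where x = w], rule bexI[where x = v]) (rule eq_refl[OF eq] v(1) w(1))+
  qed
  note c = chevet_second_moment[OF \<sigma> B meas S0 attained]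
  show "integrable (gauss ({..<p} \<times> {..<q})) (\<lambda>\<omega>. (S \<omega>)\<^sup>2)" by (rule c(1))
  show "(\<integral>\<omega>. (S \<omega>)\<^sup>2 \<partial>gauss ({..<p} \<times> {..<q}))
      \<le> (sqrt (\<Sum>i<p. \<Sum>k<r. (B i k)\<^sup>2) + \<sigma> * sqrt q)\<^sup>2" by (rule c(2))
qed

section \<open>Deviation of the largest singular value\<close>

lemma sqrt_max_diff_le:
  fixes y p s :: real
  assumes "s \<ge> 0"
  defines "r \<equiv> sqrt (max (y - p) 0)"
  shows "\<bar>r - s\<bar>\<^sup>2 \<le> \<bar>y - p - s\<^sup>2\<bar>" and "s * \<bar>r - s\<bar> \<le> \<bar>y - p - s\<^sup>2\<bar>"
proof -
  have r0: "r \<ge> 0" unfolding r_def by simp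
  have "r\<^sup>2 = max (y - p) 0" unfolding r_def by simp
  then have le: "\<bar>r\<^sup>2 - s\<^sup>2\<bar> \<le> \<bar>y - p - s\<^sup>2\<bar>" by (auto simp: max_def abs_if)
  have fact: "\<bar>r\<^sup>2 - s\<^sup>2\<bar> = \<bar>r - s\<bar> * (r + s)"
  proof -
    have "r\<^sup>2 - s\<^sup>2 = (r - s) * (r + s)" by (simp add: power2_eq_square algebra_simps)
    then show ?thesis using r0 assms by (simp add: abs_mult)
  qed
  have "\<bar>r - s\<bar> * \<bar>r - s\<bar> \<le> \<bar>r - s\<bar> * (r + s)"
    using r0 assms(1) by (intro mult_left_mono) auto
  then show "\<bar>r - s\<bar>\<^sup>2 \<le> \<bar>y - p - s\<^sup>2\<bar>" using le fact by (simp add: power2_eq_square)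
  have "\<bar>r - s\<bar> * s \<le> \<bar>r - s\<bar> * (r + s)"
    using r0 by (intro mult_left_mono) auto
  then show "s * \<bar>r - s\<bar> \<le> \<bar>y - p - s\<^sup>2\<bar>" using le fact by (simp add: mult.commute)
qed

text \<open>
  The pointwise bound \<open>X \<le> 2 D + (E^2 - p) + 2 |Q|\<close>, with \<open>D = sigma1 (a^T \<omega>)\<close>, \<open>E = sigma1 \<omega>\<close> and
  \<open>Q = |\<omega> v0|^2 - p\<close>, combines the upper and the lower bound on the signed deviation. In the lower
  one, \<open>- Q \<le> (E^2 - p) + 2 |Q|\<close> holds since \<open>E^2 - p \<ge> Q\<close>.
\<close>

lemma expected_sigma1_square_deviation:
  fixes a :: "nat \<times> nat \<Rightarrow> real" and p q :: nat
  assumes q: "1 \<le> q" and qp: "q \<le> p"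
  defines "s \<equiv> sigma1 (mat p q a)"
  defines "X \<equiv> \<lambda>\<omega>. \<bar>(sigma1 (mat p q (\<lambda>ij. a ij + \<omega> ij)))\<^sup>2 - real p - s\<^sup>2\<bar>"
  shows "integrable (gauss ({..<p} \<times> {..<q})) X"
    and "(\<integral>\<omega>. X \<omega> \<partial>gauss ({..<p} \<times> {..<q}))
      \<le> 3 * sqrt (real p * real q) + 4 * s * sqrt q + sqrt (8 * real p)"
proof -
  let ?G = "gauss ({..<p} \<times> {..<q})"
  interpret G: prob_space ?G by (rule prob_space_gauss)
  have p: "1 \<le> p" using q qp by simp
  note sigma1_props = sigma1_properties[OF q]
  have s0: "s \<ge> 0" unfolding s_def by (rule sigma1_props)
  have a_le: "(\<Sum>i<p. (mat_apply a q v i)\<^sup>2) \<le> s\<^sup>2" if "v \<in> unit_sphere q" for v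
    using sigma1_props(4)[where p = p and M = a and v = v] that unfolding s_def unit_sphere_def by simp
  obtain v0 where v0: "v0 \<in> unit_sphere q" "(\<Sum>i<p. (mat_apply a q v0 i)\<^sup>2) = s\<^sup>2"
    unfolding s_def using sigma1_props(3)[where p = p and M = a] by blast

  define E where "E = (\<lambda>\<omega>. sigma1 (mat p q \<omega>))"
  have E_eq: "sigma1 (mat p q (\<lambda>(k, j). \<Sum>i<p. (if i = k then 1 else 0) * \<omega> (i, j))) = E \<omega>" for \<omega>
  proof -
    have "mat p q (\<lambda>(k, j). \<Sum>i<p. (if i = k then 1 else 0) * \<omega> (i, j)) = mat p q \<omega>"
      by (rule eq_matI) (auto simp: if_distrib[of "\<lambda>x. x * _"] cong: if_cong)
    then show ?thesis unfolding E_def by simp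
  qed
  have idB: "(\<Sum>i<p. (\<Sum>k<p. (if i = k then 1 else 0) * w k)\<^sup>2) \<le> 1\<^sup>2" if "w \<in> unit_sphere p" for w
    using that by (simp add: unit_sphere_def if_distrib[of "\<lambda>x. x * _"] cong: if_cong)
  note cE = sigma1_product_second_moment[where B = "\<lambda>i k. if i = k then 1 else 0" and r = p,
      OF q p zero_le_one idB, unfolded E_eq]
  have EE: "(\<integral>\<omega>. (E \<omega>)\<^sup>2 \<partial>?G) \<le> (sqrt p + sqrt q)\<^sup>2"
  proof -
    have "(\<Sum>i<p. \<Sum>k<p. (if i = k then 1 else 0 :: real)\<^sup>2) = real p"
      by (simp add: if_distrib[of "\<lambda>x. x\<^sup>2"] cong: if_cong)
    then show ?thesis using cE(3) by simp
  qed

  define D where "D = (\<lambda>\<omega>. sigma1 (mat q q (\<lambda>(k, j). \<Sum>i<p. a (i, k) * \<omega> (i, j))))"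
  have aB: "(\<Sum>i<p. (\<Sum>k<q. a (i, k) * w k)\<^sup>2) \<le> s\<^sup>2" if "w \<in> unit_sphere q" for w
    using a_le[OF that] unfolding mat_apply_def .
  note cD = sigma1_product_second_moment[where B = "\<lambda>i k. a (i, k)" and r = q,
      OF q q s0 aB, unfolded D_def[THEN fun_cong, symmetric]]
  have D0: "D \<omega> \<ge> 0" for \<omega> unfolding D_def by (rule sigma1_props)
  \<comment> \<open>The columns are images of unit vectors, so each has norm at most \<open>s\<close>.\<close>
  have frob: "(\<Sum>i<p. \<Sum>k<q. (a (i, k))\<^sup>2) \<le> s\<^sup>2 * q"
  proof -
    have "(\<Sum>i<p. \<Sum>k<q. (a (i, k))\<^sup>2) = (\<Sum>k<q. \<Sum>i<p. (a (i, k))\<^sup>2)" by (rule sum.swap)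
    also have "\<dots> \<le> (\<Sum>k<q. s\<^sup>2)"
    proof (rule sum_mono)
      fix k assume k: "k \<in> {..<q}"
      have "(\<lambda>j. if j = k then 1 else 0) \<in> unit_sphere q"
        using k by (auto simp: unit_sphere_def if_distrib[of "\<lambda>x. x\<^sup>2"] cong: if_cong)
      from aB[OF this] show "(\<Sum>i<p. (a (i, k))\<^sup>2) \<le> s\<^sup>2"
        using k by (simp add: if_distrib[of "\<lambda>x. _ * x"] cong: if_cong)
    qed
    finally show ?thesis by (simp add: mult.commute)
  qed
  have ED2: "(\<integral>\<omega>. (D \<omega>)\<^sup>2 \<partial>?G) \<le> (2 * s * sqrt q)\<^sup>2"
  proof -
    have "sqrt (\<Sum>i<p. \<Sum>k<q. (a (i, k))\<^sup>2) \<le> sqrt (s\<^sup>2 * q)" using frob by simp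
    also have "\<dots> = s * sqrt q" using s0 by (simp add: real_sqrt_mult)
    finally have "(sqrt (\<Sum>i<p. \<Sum>k<q. (a (i, k))\<^sup>2) + s * sqrt q)\<^sup>2 \<le> (s * sqrt q + s * sqrt q)\<^sup>2"
      using s0 by (intro power_mono add_right_mono) (auto intro!: add_nonneg_nonneg sum_nonneg)
    with cD(3) show ?thesis by (simp add: algebra_simps)
  qed
  have iD: "integrable ?G D" and ED: "(\<integral>\<omega>. D \<omega> \<partial>?G) \<le> 2 * s * sqrt q"
    using G.abs_moment_le[OF cD(1) cD(2) ED2] s0 D0 by simp_all

  define Q where "Q = (\<lambda>\<omega>. (\<Sum>i<p. (\<Sum>j<q. v0 j * \<omega> (i, j))\<^sup>2) - real p)"
  have cQ: "integrable ?G Q" "(\<integral>\<omega>. \<bar>Q \<omega>\<bar> \<partial>?G) \<le> sqrt (2 * real p)"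
    unfolding Q_def using gauss_chi_square_deviation[OF v0(1) p] by simp_all
  have Q_eq: "(\<Sum>i<p. (mat_apply \<omega> q v0 i)\<^sup>2) = Q \<omega> + p" for \<omega>
    unfolding Q_def mat_apply_def by (simp add: mult.commute)

  have cross: "\<bar>\<Sum>i<p. mat_apply a q v i * mat_apply \<omega> q v i\<bar> \<le> D \<omega>" if v: "v \<in> unit_sphere q" for v \<omega>
  proof -
    let ?C = "\<lambda>(k, j). \<Sum>i<p. a (i, k) * \<omega> (i, j)"
    have "(\<Sum>i<p. mat_apply a q v i * mat_apply \<omega> q v i) = (\<Sum>k<q. v k * mat_apply ?C q v k)"
    proof -
      have "(\<Sum>i<p. mat_apply a q v i * mat_apply \<omega> q v i)
          = (\<Sum>i<p. \<Sum>j<q. (\<Sum>k<q. a (i, k) * v k) * v j * \<omega> (i, j))"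
        unfolding mat_apply_def
        by (intro sum.cong refl, subst sum_distrib_left, intro sum.cong refl) (simp only: mult_ac)
      then show ?thesis
        unfolding mat_apply_def[of ?C] using bilinear_rearrange
          [where w = v and v = v and r = q and q = q and p = p and B = "\<lambda>i k. a (i, k)" and \<omega> = \<omega>] by simp
    qed
    moreover have "sqrt (\<Sum>k<q. (mat_apply ?C q v k)\<^sup>2) \<le> D \<omega>"
    proof (rule real_le_lsqrt)
      show "(\<Sum>k<q. (mat_apply ?C q v k)\<^sup>2) \<le> (D \<omega>)\<^sup>2"
        using sigma1_props(4)[where p = q and M = ?C and v = v] v unfolding D_def unit_sphere_def by simp
    qed (auto intro: D0)
    moreover have "(\<Sum>k<q. v k * mat_apply ?C q v k) \<le> sqrt (\<Sum>k<q. (mat_apply ?C q v k)\<^sup>2)"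
      using sum_times_le_norms[of v "mat_apply ?C q v" "{..<q}"] v by (simp add: unit_sphere_def)
    moreover have "- (\<Sum>k<q. v k * mat_apply ?C q v k) \<le> sqrt (\<Sum>k<q. (mat_apply ?C q v k)\<^sup>2)"
      using sum_times_le_norms[of "\<lambda>k. - v k" "mat_apply ?C q v" "{..<q}"] v
      by (simp add: unit_sphere_def sum_negf)
    ultimately show ?thesis by linarith
  qed
  have E_le: "(\<Sum>i<p. (mat_apply \<omega> q v i)\<^sup>2) \<le> (E \<omega>)\<^sup>2" if "v \<in> unit_sphere q" for v \<omega>
    using sigma1_props(4)[where p = p and M = \<omega> and v = v] that unfolding E_def unit_sphere_def by simp
  define Y where "Y = (\<lambda>\<omega>. sigma1 (mat p q (\<lambda>ij. a ij + \<omega> ij)))"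
  have Y_expand: "(\<Sum>i<p. (mat_apply (\<lambda>ij. a ij + \<omega> ij) q v i)\<^sup>2)
      = (\<Sum>i<p. (mat_apply a q v i)\<^sup>2) + 2 * (\<Sum>i<p. mat_apply a q v i * mat_apply \<omega> q v i) + (\<Sum>i<p. (mat_apply \<omega> q v i)\<^sup>2)" for v \<omega>
  proof -
    have "mat_apply (\<lambda>ij. a ij + \<omega> ij) q v i = mat_apply a q v i + mat_apply \<omega> q v i" for i
      unfolding mat_apply_def by (simp add: sum.distrib distrib_right)
    then show ?thesis by (simp add: power2_sum sum.distrib sum_distrib_left algebra_simps)
  qed
  have X_eq: "X \<omega> = \<bar>(Y \<omega>)\<^sup>2 - real p - s\<^sup>2\<bar>" for \<omega> unfolding X_def Y_def ..
  have X_le: "X \<omega> \<le> 2 * D \<omega> + ((E \<omega>)\<^sup>2 - p) + 2 * \<bar>Q \<omega>\<bar>" for \<omega>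
  proof -
    obtain v where v: "v \<in> unit_sphere q" "(\<Sum>i<p. (mat_apply (\<lambda>ij. a ij + \<omega> ij) q v i)\<^sup>2) = (Y \<omega>)\<^sup>2"
      unfolding Y_def using sigma1_props(3)[where p = p and M = "\<lambda>ij. a ij + \<omega> ij"] by blast
    have up: "(Y \<omega>)\<^sup>2 \<le> s\<^sup>2 + 2 * D \<omega> + (E \<omega>)\<^sup>2"
      using v(2) Y_expand[of \<omega> v] a_le[OF v(1)] cross[OF v(1), of \<omega>] E_le[OF v(1), of \<omega>] by linarith
    have "(\<Sum>i<p. (mat_apply (\<lambda>ij. a ij + \<omega> ij) q v0 i)\<^sup>2) \<le> (Y \<omega>)\<^sup>2"
      using sigma1_props(4)[where p = p and M = "\<lambda>ij. a ij + \<omega> ij" and v = v0] v0(1)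
      unfolding Y_def unit_sphere_def by simp
    then have down: "(Y \<omega>)\<^sup>2 \<ge> s\<^sup>2 - 2 * D \<omega> + (Q \<omega> + p)"
      using Y_expand[of \<omega> v0] v0(2) cross[OF v0(1), of \<omega>] Q_eq[of \<omega>] by linarith
    have "Q \<omega> + p \<le> (E \<omega>)\<^sup>2" using E_le[OF v0(1), of \<omega>] Q_eq[of \<omega>] by simp
    with up down show ?thesis unfolding X_eq by linarith
  qed
  have X0: "X \<omega> \<ge> 0" for \<omega> unfolding X_def by simp
  have Y_meas: "Y \<in> borel_measurable ?G"
    unfolding Y_def
    by (intro measurable_sigma1 q borel_measurable_add borel_measurable_const measurable_gauss_component) auto
  have X_meas: "X \<in> borel_measurable ?G"
    unfolding X_eq[abs_def] using Y_meas
    by (intro borel_measurable_abs borel_measurable_diff borel_measurable_power borel_measurable_const)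
  have iE2: "integrable ?G (\<lambda>\<omega>. (E \<omega>)\<^sup>2 - p)"
    by (intro Bochner_Integration.integrable_diff cE(2) G.integrable_const)
  have iDE: "integrable ?G (\<lambda>\<omega>. 2 * D \<omega> + ((E \<omega>)\<^sup>2 - p))"
    by (intro Bochner_Integration.integrable_add integrable_mult_right iD iE2)
  have iQ: "integrable ?G (\<lambda>\<omega>. 2 * \<bar>Q \<omega>\<bar>)"
    by (intro integrable_mult_right integrable_abs cQ(1))
  show iX: "integrable ?G X"
  proof (rule Bochner_Integration.integrable_bound[OF Bochner_Integration.integrable_add[OF iDE iQ] X_meas])
    show "AE \<omega> in ?G. norm (X \<omega>) \<le> norm (2 * D \<omega> + ((E \<omega>)\<^sup>2 - p) + 2 * \<bar>Q \<omega>\<bar>)"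
      using X_le X0 by (intro AE_I2) (metis abs_of_nonneg order_trans real_norm_def)
  qed
  have "(\<integral>\<omega>. X \<omega> \<partial>?G) \<le> (\<integral>\<omega>. 2 * D \<omega> + ((E \<omega>)\<^sup>2 - p) + 2 * \<bar>Q \<omega>\<bar> \<partial>?G)"
    by (intro integral_mono iX Bochner_Integration.integrable_add iDE iQ X_le)
  also have "\<dots> = (\<integral>\<omega>. 2 * D \<omega> + ((E \<omega>)\<^sup>2 - p) \<partial>?G) + 2 * (\<integral>\<omega>. \<bar>Q \<omega>\<bar> \<partial>?G)"
    by (subst Bochner_Integration.integral_add[OF iDE iQ]) simp
  also have "(\<integral>\<omega>. 2 * D \<omega> + ((E \<omega>)\<^sup>2 - p) \<partial>?G) = 2 * (\<integral>\<omega>. D \<omega> \<partial>?G) + (\<integral>\<omega>. (E \<omega>)\<^sup>2 - p \<partial>?G)"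
    by (subst Bochner_Integration.integral_add[OF integrable_mult_right[OF iD] iE2]) simp
  also have "(\<integral>\<omega>. (E \<omega>)\<^sup>2 - p \<partial>?G) = (\<integral>\<omega>. (E \<omega>)\<^sup>2 \<partial>?G) - p"
  proof -
    have const: "(\<integral>\<omega>. real p \<partial>?G) = real p"
      by (subst Bochner_Integration.lebesgue_integral_const) (simp only: G.prob_space scaleR_one)
    have "(\<integral>\<omega>. (E \<omega>)\<^sup>2 - real p \<partial>?G) = (\<integral>\<omega>. (E \<omega>)\<^sup>2 \<partial>?G) - (\<integral>\<omega>. real p \<partial>?G)"
      by (rule Bochner_Integration.integral_diff[OF cE(2) G.integrable_const])
    also note const
    finally show ?thesis .
  qed
  also have "2 * (\<integral>\<omega>. D \<omega> \<partial>?G) + ((\<integral>\<omega>. (E \<omega>)\<^sup>2 \<partial>?G) - p) + 2 * (\<integral>\<omega>. \<bar>Q \<omega>\<bar> \<partial>?G)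
      \<le> 2 * (2 * s * sqrt q) + ((sqrt p + sqrt q)\<^sup>2 - p) + 2 * sqrt (2 * real p)"
    using ED EE cQ(2) by (intro add_mono mult_left_mono diff_right_mono) auto
  also have "(sqrt p + sqrt q)\<^sup>2 - p \<le> 3 * sqrt (real p * real q)"
  proof -
    have "(sqrt p + sqrt q)\<^sup>2 = p + 2 * sqrt (real p * real q) + q"
      by (simp add: power2_sum real_sqrt_mult)
    moreover have "real q \<le> sqrt (real p * real q)"
      by (rule real_le_rsqrt) (use qp in \<open>simp add: power2_eq_square mult_right_mono\<close>)
    ultimately show ?thesis by simp
  qed
  also have "2 * sqrt (2 * real p) = sqrt (8 * real p)"
  proof -
    have "sqrt (8 * real p) = sqrt (2\<^sup>2 * (2 * real p))" by simp
    also have "\<dots> = 2 * sqrt (2 * real p)" unfolding real_sqrt_mult[of "2\<^sup>2"] by simp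
    finally show ?thesis by simp
  qed
  finally show "(\<integral>\<omega>. X \<omega> \<partial>?G) \<le> 3 * sqrt (real p * real q) + 4 * s * sqrt q + sqrt (8 * real p)"
    by simp
qed

theorem proposition2p5:
  shows "\<exists>c::real. c > 0 \<and> (\<forall>(p::nat) (q::nat) (A::real mat).
    1 \<le> q \<longrightarrow> q \<le> p \<longrightarrow> A \<in> carrier_mat p q \<longrightarrow>
      integrable (std_gaussian p q)
        (\<lambda>\<omega>. \<bar>(sigma1 (A + mat p q \<omega>))\<^sup>2 - real p - (sigma1 A)\<^sup>2\<bar>) \<and>
      (\<integral>\<omega>. \<bar>(sigma1 (A + mat p q \<omega>))\<^sup>2 - real p - (sigma1 A)\<^sup>2\<bar> \<partial>std_gaussian p q)
        \<le> 3 * sqrt (real p * real q) + 4 * op_norm A * sqrt (real q)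
            + 8 * exp (- real p / 4) + sqrt (64 * pi * real p) \<and>
      integrable (std_gaussian p q)
        (\<lambda>\<omega>. \<bar>sqrt (max ((sigma1 (A + mat p q \<omega>))\<^sup>2 - real p) 0) - op_norm A\<bar>) \<and>
      (\<integral>\<omega>. \<bar>sqrt (max ((sigma1 (A + mat p q \<omega>))\<^sup>2 - real p) 0) - op_norm A\<bar> \<partial>std_gaussian p q)
        \<le> c * (real p * real q) powr (1 / 4))"
\<comment> \<open>The constant \<open>10\<close> is what \<open>s |R - s| \<le> |X|\<close> gives for \<open>s > g\<close>: \<open>(6 g^2 + 4 s g) / s \<le> 10 g\<close>.
    For \<open>s \<le> g\<close>, the mean of \<open>|R - s|^2\<close> is at most \<open>10 g^2 \<le> (4 g)^2\<close>.\<close>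
proof (intro exI[of _ 10] conjI allI impI)
  fix p q :: nat and A :: "real mat"
  assume q: "1 \<le> q" and qp: "q \<le> p" and A: "A \<in> carrier_mat p q"
  let ?G = "gauss ({..<p} \<times> {..<q})"
  interpret G: prob_space ?G by (rule prob_space_gauss)
  note G_eq = std_gaussian_eq_gauss
  define a where "a = (\<lambda>ij. A $$ ij)"
  have A_eq: "A = mat p q a" unfolding a_def using A by (intro eq_matI) auto
  have Y_eq: "A + mat p q \<omega> = mat p q (\<lambda>ij. a ij + \<omega> ij)" for \<omega>
    unfolding A_eq by (intro eq_matI) auto
  define s where "s = sigma1 (mat p q a)"
  have s0: "s \<ge> 0" unfolding s_def by (rule sigma1_properties(1)[OF q])
  have op: "op_norm A = s" unfolding A_eq s_def by (rule sigma1_properties(2)[OF q])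
  have sA: "sigma1 A = s" unfolding A_eq s_def ..
  define Y where "Y = (\<lambda>\<omega>. sigma1 (mat p q (\<lambda>ij. a ij + \<omega> ij)))"
  define X where "X = (\<lambda>\<omega>. \<bar>(Y \<omega>)\<^sup>2 - real p - s\<^sup>2\<bar>)"
  have dev: "integrable ?G X"
    "(\<integral>\<omega>. X \<omega> \<partial>?G) \<le> 3 * sqrt (real p * real q) + 4 * s * sqrt q + sqrt (8 * real p)"
    unfolding X_def Y_def s_def by (rule expected_sigma1_square_deviation[OF q qp])+
  have p1: "real p \<ge> 1" and q1: "real q \<ge> 1" using q qp by auto
  show "integrable (std_gaussian p q) (\<lambda>\<omega>. \<bar>(sigma1 (A + mat p q \<omega>))\<^sup>2 - real p - (sigma1 A)\<^sup>2\<bar>)"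
    using dev(1) unfolding G_eq Y_eq sA X_def Y_def .
  have "sqrt (8 * real p) \<le> sqrt (64 * pi * real p)"
    using pi_gt3 by (intro real_sqrt_le_mono mult_right_mono) auto
  moreover have "8 * exp (- real p / 4) \<ge> 0" by simp
  ultimately show "(\<integral>\<omega>. \<bar>(sigma1 (A + mat p q \<omega>))\<^sup>2 - real p - (sigma1 A)\<^sup>2\<bar> \<partial>std_gaussian p q)
        \<le> 3 * sqrt (real p * real q) + 4 * op_norm A * sqrt (real q)
            + 8 * exp (- real p / 4) + sqrt (64 * pi * real p)"
    using dev(2) unfolding G_eq Y_eq sA op X_def Y_def by linarith

  define Z where "Z = (\<lambda>\<omega>. \<bar>sqrt (max ((Y \<omega>)\<^sup>2 - real p) 0) - s\<bar>)"
  have Z0: "Z \<omega> \<ge> 0" for \<omega> unfolding Z_def by simp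
  have Zsq: "(Z \<omega>)\<^sup>2 \<le> X \<omega>" and sZ: "s * Z \<omega> \<le> X \<omega>" for \<omega>
    unfolding Z_def X_def by (rule sqrt_max_diff_le[OF s0])+
  have Y_meas: "Y \<in> borel_measurable ?G"
    unfolding Y_def
    by (intro measurable_sigma1 q borel_measurable_add borel_measurable_const measurable_gauss_component) auto
  have Z_meas: "Z \<in> borel_measurable ?G"
    unfolding Z_def using Y_meas by measurable
  have iZ2: "integrable ?G (\<lambda>\<omega>. (Z \<omega>)\<^sup>2)"
    by (rule Bochner_Integration.integrable_bound[OF dev(1)])
      (use Z_meas Zsq in \<open>auto intro!: AE_I2 order_trans[OF _ abs_ge_self]\<close>)
  have iZ: "integrable ?G Z"
    by (rule G.abs_moment_le(1)[OF Z_meas iZ2, of "sqrt (\<integral>\<omega>. (Z \<omega>)\<^sup>2 \<partial>?G)"]) auto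
  show "integrable (std_gaussian p q) (\<lambda>\<omega>. \<bar>sqrt (max ((sigma1 (A + mat p q \<omega>))\<^sup>2 - real p) 0) - op_norm A\<bar>)"
    using iZ unfolding G_eq Y_eq op Z_def Y_def .

  define g where "g = (real p * real q) powr (1 / 4)"
  have pq1: "real p * real q \<ge> 1" using mult_mono[OF p1 q1] by simp
  have g1: "g \<ge> 1" unfolding g_def using pq1 by (intro ge_one_powr_ge_zero) auto
  have g2: "sqrt (real p * real q) = g\<^sup>2"
    unfolding g_def power2_eq_square powr_add[symmetric] using pq1 by (simp add: powr_half_sqrt)
  have sqrt_p: "sqrt (real p) \<le> g\<^sup>2"
    unfolding g2[symmetric] using q1 by (intro real_sqrt_le_mono) (simp add: mult_le_cancel_left1)
  have sqrt_q: "sqrt (real q) \<le> g"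
  proof (rule power2_le_imp_le)
    have "real q \<le> sqrt (real p * real q)"
      by (rule real_le_rsqrt) (use qp in \<open>simp add: power2_eq_square mult_right_mono\<close>)
    then show "(sqrt (real q))\<^sup>2 \<le> g\<^sup>2" unfolding g2 by simp
  qed (use g1 in simp)
  have EX: "(\<integral>\<omega>. X \<omega> \<partial>?G) \<le> 6 * g\<^sup>2 + 4 * s * g"
  proof -
    have "sqrt (8 * real p) \<le> sqrt (3\<^sup>2 * real p)" by (intro real_sqrt_le_mono) simp
    also have "\<dots> = 3 * sqrt (real p)" unfolding real_sqrt_mult by simp
    finally have "sqrt (8 * real p) \<le> 3 * g\<^sup>2" using sqrt_p by simp
    moreover have "4 * s * sqrt (real q) \<le> 4 * s * g" using sqrt_q s0 by (intro mult_left_mono) auto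
    ultimately show ?thesis using dev(2) unfolding g2 by linarith
  qed
  have "(\<integral>\<omega>. Z \<omega> \<partial>?G) \<le> 10 * g"
  proof (cases "s \<le> g")
    case True
    have "(\<integral>\<omega>. (Z \<omega>)\<^sup>2 \<partial>?G) \<le> (\<integral>\<omega>. X \<omega> \<partial>?G)"
      by (intro integral_mono iZ2 dev(1) Zsq)
    also have "\<dots> \<le> 6 * g\<^sup>2 + 4 * s * g" by (rule EX)
    also have "\<dots> \<le> (4 * g)\<^sup>2"
      using mult_right_mono[OF True, of g] g1 by (simp add: power2_eq_square)
    finally have "(\<integral>\<omega>. \<bar>Z \<omega>\<bar> \<partial>?G) \<le> 4 * g"
      using g1 by (intro G.abs_moment_le(2)[OF Z_meas iZ2]) auto
    then show ?thesis using Z0 g1 by simp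
  next
    case False
    then have s: "s > 0" using g1 by simp
    have "s * (\<integral>\<omega>. Z \<omega> \<partial>?G) = (\<integral>\<omega>. s * Z \<omega> \<partial>?G)" by simp
    also have "\<dots> \<le> (\<integral>\<omega>. X \<omega> \<partial>?G)"
      by (intro integral_mono integrable_mult_right iZ dev(1) sZ)
    also have "\<dots> \<le> 6 * g\<^sup>2 + 4 * s * g" by (rule EX)
    also have "\<dots> \<le> s * (10 * g)"
      using mult_right_mono[of g s g] False g1 by (simp add: power2_eq_square)
    finally have "(\<integral>\<omega>. Z \<omega> \<partial>?G) \<le> 10 * g" using s by simp
    then show ?thesis using g1 by simp
  qed
  then show "(\<integral>\<omega>. \<bar>sqrt (max ((sigma1 (A + mat p q \<omega>))\<^sup>2 - real p) 0) - op_norm A\<bar> \<partial>std_gaussian p q)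
        \<le> 10 * (real p * real q) powr (1 / 4)"
    unfolding G_eq Y_eq op Z_def Y_def g_def .
qed simp

end
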